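(* The module $V(T(\bar v))$ is irreducible whenever $\bar v_{rs}-\bar v_{r-1,t}\notin\mathbb Z$ for any $1\le t<r\le n$ and $1\le s\le r$ (where $\bar v_{ns}=a_s$).
   Context: Ground field $\mathbb C$; $E_{rs}$ are the elementary matrices in $\mathfrak{gl}(n)$. Fix $n$, integers $1\le i<j\le k\le n-1$ and $a_1,\dots,a_n\in\mathbb C$. A vector $v=(v_{rs})_{1\le s\le r\le n-1}\in\mathbb C^{n(n-1)/2}$ is extended by $v_{ns}=a_s$; vectors $z\in\mathbb Z^{n(n-1)/2}$ are extended by $z_{ns}=0$. $\delta^{rs}$ is the vector with $(r,s)$ entry $1$ and all others $0$. $v$ is generic if $v_{rs}-v_{ru}\notin\mathbb Z$ for all $1\le s<u\le r\le n-1$. Fix $\bar v$ with $\bar v_{ki}=\bar v_{kj}$ and all other such differences non-integer. $\tau$ interchanges the $(k,i)$ and $(k,j)$ entries of a vector. Put $x=v_{ki}$, $y=v_{kj}$. Generic modules: for generic $v$, $V(T(v))$ is the $\mathfrak{gl}(n)$-module with basis the tableaux (symbols) $T(w)$, $w\in v+\mathbb Z^{n(n-1)/2}$, and action $$E_{p,p+1}T(w)=-\sum_{q=1}^{p}\frac{\prod_{u=1}^{p+1}(w_{pq}-w_{p+1,u})}{\prod_{u\ne q}(w_{pq}-w_{pu})}T(w+\delta^{pq}),\quad E_{p+1,p}T(w)=\sum_{q=1}^{p}\frac{\prod_{u=1}^{p-1}(w_{pq}-w_{p-1,u})}{\prod_{u\ne q}(w_{pq}-w_{pu})}T(w-\delta^{pq}),$$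 $$E_{pp}T(w)=\Big(\sum_{q=1}^{p}(w_{pq}+q-1)-\sum_{q=1}^{p-1}(w_{p-1,q}+q-1)\Big)T(w)$$ (this determines all $E_{rs}$). For each $r,s$ and $z$, $E_{rs}T(v+z)$ is regarded as a finite combination of the $T(v+z')$ whose coefficients are rational functions of the variables $v_{pq}$. The coefficients of $(x-y)E_{rs}T(v+z)$ are regular at $\bar v$, and so are those of $E_{rs}T(v+w)$ if $\tau(w)\ne w$. $V(T(\bar v))$ is the vector space spanned by symbols $T(\bar v+z)$ and $\mathcal DT(\bar v+z)$, $z\in\mathbb Z^{n(n-1)/2}$, subject only to $T(\bar v+z)=T(\bar v+\tau(z))$ and $\mathcal DT(\bar v+z)=-\mathcal DT(\bar v+\tau(z))$. For a rational function $f$ of $v$ regular at $\bar v$ put $\mathcal D^{\bar v}(f)=\frac12\big(\frac{\partial f}{\partial x}-\frac{\partial f}{\partial y}\big)(\bar v)$, and extend linearly by $\mathcal D^{\bar v}(fT(v+z))=\mathcal D^{\bar v}(f)T(\bar v+z)+f(\bar v)\mathcal DT(\bar v+z)$. $V(T(\bar v))$ is a $\mathfrak{gl}(n)$-module via $E_{rs}(T(\bar v+z))=\mathcal D^{\bar v}((x-y)E_{rs}T(v+z))$ and $E_{rs}(\mathcal DT(\bar v+w))=\mathcal D^{\bar v}(E_{rs}T(v+w))$ for $\tau(w)\ne w$. *)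

theory Defs
  imports "HOL-Analysis.Analysis" "HOL-Library.Poly_Mapping"
begin

section \<open>Free complex vector spaces\<close>

text \<open>The vector space with basis a type \<open>'b\<close> is \<open>'b \<Rightarrow>\<^sub>0 complex\<close>; the basis vector
  of \<open>b\<close> is \<open>Poly_Mapping.single b 1\<close>.\<close>

definition cscale :: "complex \<Rightarrow> ('b \<Rightarrow>\<^sub>0 complex) \<Rightarrow> ('b \<Rightarrow>\<^sub>0 complex)" where
  "cscale c f = Poly_Mapping.map ((*) c) f"

lemma lookup_cscale [simp]: "Poly_Mapping.lookup (cscale c f) b = c * Poly_Mapping.lookup f b"
  by (simp add: cscale_def Poly_Mapping.map.rep_eq when_def)

global_interpretation free: vector_space cscale
  by unfold_locales (auto intro!: poly_mapping_eqI simp: lookup_add algebra_simps)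

definition lin_ext :: "('b \<Rightarrow> ('d \<Rightarrow>\<^sub>0 complex)) \<Rightarrow> ('b \<Rightarrow>\<^sub>0 complex) \<Rightarrow> ('d \<Rightarrow>\<^sub>0 complex)" where
  "lin_ext A f = (\<Sum>b\<in>Poly_Mapping.keys f. cscale (Poly_Mapping.lookup f b) (A b))"


section \<open>Tableaux\<close>

type_synonym arr = "nat \<Rightarrow> nat \<Rightarrow> complex"
type_synonym shift = "nat \<Rightarrow> nat \<Rightarrow> int"

text \<open>Only the entries of an array with \<open>1 \<le> s \<le> r \<le> n - 1\<close> are meaningful.\<close>

definition ext :: "nat \<Rightarrow> (nat \<Rightarrow> complex) \<Rightarrow> arr \<Rightarrow> arr" where
  "ext n a v r s = (if r = n then a s else v r s)"

definition shifts :: "nat \<Rightarrow> shift set" where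
  "shifts n = {z. \<forall>r s. \<not> (1 \<le> s \<and> s \<le> r \<and> r \<le> n - 1) \<longrightarrow> z r s = 0}"

definition translate :: "arr \<Rightarrow> shift \<Rightarrow> arr" where
  "translate v z r s = v r s + of_int (z r s)"

definition upd :: "(nat \<Rightarrow> nat \<Rightarrow> 'x) \<Rightarrow> nat \<Rightarrow> nat \<Rightarrow> 'x \<Rightarrow> (nat \<Rightarrow> nat \<Rightarrow> 'x)" where
  "upd w r s c = w(r := (w r)(s := c))"

definition swap :: "nat \<Rightarrow> nat \<Rightarrow> nat \<Rightarrow> (nat \<Rightarrow> nat \<Rightarrow> 'x) \<Rightarrow> (nat \<Rightarrow> nat \<Rightarrow> 'x)" where
  "swap k i j w = upd (upd w k i (w k j)) k j (w k i)"

definition generic :: "nat \<Rightarrow> arr \<Rightarrow> bool" where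
  "generic n v \<longleftrightarrow>
     (\<forall>r s u. 1 \<le> s \<and> s < u \<and> u \<le> r \<and> r \<le> n - 1 \<longrightarrow> v r s - v r u \<notin> \<int>)"


section \<open>Generic modules\<close>

text \<open>For a fixed generic \<open>v\<close> the basis tableau \<open>T(v + z)\<close> is represented by \<open>z\<close>. In the
  following three maps \<open>w\<close> is the array of \<open>v + z\<close>, extended by the top row \<open>a\<close>.\<close>

definition gen_up :: "nat \<Rightarrow> (nat \<Rightarrow> complex) \<Rightarrow> arr \<Rightarrow> nat \<Rightarrow> shift \<Rightarrow> (shift \<Rightarrow>\<^sub>0 complex)" where
  "gen_up n a v p z = (let w = ext n a (translate v z) in
     - (\<Sum>q = 1..p. Poly_Mapping.single (upd z p q (z p q + 1))
          ((\<Prod>u = 1..p+1. w p q - w (p+1) u) / (\<Prod>u\<in>{1..p} - {q}. w p q - w p u))))"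

definition gen_down :: "nat \<Rightarrow> (nat \<Rightarrow> complex) \<Rightarrow> arr \<Rightarrow> nat \<Rightarrow> shift \<Rightarrow> (shift \<Rightarrow>\<^sub>0 complex)" where
  "gen_down n a v p z = (let w = ext n a (translate v z) in
     (\<Sum>q = 1..p. Poly_Mapping.single (upd z p q (z p q - 1))
          ((\<Prod>u = 1..p-1. w p q - w (p-1) u) / (\<Prod>u\<in>{1..p} - {q}. w p q - w p u))))"

definition gen_diag :: "nat \<Rightarrow> (nat \<Rightarrow> complex) \<Rightarrow> arr \<Rightarrow> nat \<Rightarrow> shift \<Rightarrow> (shift \<Rightarrow>\<^sub>0 complex)" where
  "gen_diag n a v p z = (let w = ext n a (translate v z) in
     Poly_Mapping.single z
       ((\<Sum>q = 1..p. w p q + of_nat q - 1) - (\<Sum>q = 1..p-1. w (p-1) q + of_nat q - 1)))"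

definition commutator :: "('m::ab_group_add \<Rightarrow> 'm) \<Rightarrow> ('m \<Rightarrow> 'm) \<Rightarrow> 'm \<Rightarrow> 'm" where
  "commutator A B x = A (B x) - B (A x)"

text \<open>The operator of \<open>E\<^sub>r\<^sub>s\<close> on \<open>V(T(v))\<close>. The non-simple root vectors come from
  \<open>E\<^sub>r\<^sub>s = [E\<^sub>r\<^sub>t, E\<^sub>t\<^sub>s]\<close>, used with \<open>t = s - 1\<close> for \<open>s > r + 1\<close> and
  with \<open>t = r - 1\<close> for \<open>r > s + 1\<close>.\<close>

function gen_E ::
  "nat \<Rightarrow> (nat \<Rightarrow> complex) \<Rightarrow> arr \<Rightarrow> nat \<Rightarrow> nat \<Rightarrow> (shift \<Rightarrow>\<^sub>0 complex) \<Rightarrow> (shift \<Rightarrow>\<^sub>0 complex)"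
where
  "gen_E n a v r s =
    (if r = s then lin_ext (gen_diag n a v r)
     else if s = r + 1 then lin_ext (gen_up n a v r)
     else if r = s + 1 then lin_ext (gen_down n a v s)
     else if r < s then commutator (gen_E n a v r (s - 1)) (gen_E n a v (s - 1) s)
     else commutator (gen_E n a v r (r - 1)) (gen_E n a v (r - 1) s))"
  by pat_completeness auto
termination
  by (relation "Wellfounded.measure (\<lambda>(n, a, v, r, s). (r - s) + (s - r))") auto

declare gen_E.simps [simp del]

text \<open>The coefficient of \<open>T(v + z')\<close> in \<open>E\<^sub>r\<^sub>s T(v + z)\<close>, as a function of \<open>v\<close>.\<close>

definition gen_coeff ::
  "nat \<Rightarrow> (nat \<Rightarrow> complex) \<Rightarrow> nat \<Rightarrow> nat \<Rightarrow> shift \<Rightarrow> shift \<Rightarrow> arr \<Rightarrow> complex" where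
  "gen_coeff n a r s z z' v = Poly_Mapping.lookup (gen_E n a v r s (Poly_Mapping.single z 1)) z'"


section \<open>Rational functions of the tableau entries\<close>

inductive poly_fun :: "nat \<Rightarrow> (arr \<Rightarrow> complex) \<Rightarrow> bool" for n where
  const: "poly_fun n (\<lambda>v. c)"
| coord: "1 \<le> q \<Longrightarrow> q \<le> p \<Longrightarrow> p \<le> n - 1 \<Longrightarrow> poly_fun n (\<lambda>v. v p q)"
| add: "poly_fun n P \<Longrightarrow> poly_fun n Q \<Longrightarrow> poly_fun n (\<lambda>v. P v + Q v)"
| mult: "poly_fun n P \<Longrightarrow> poly_fun n Q \<Longrightarrow> poly_fun n (\<lambda>v. P v * Q v)"

text \<open>A rational function is given by its values on the (Zariski dense) set of generic arrays;
  its values elsewhere are irrelevant, and are replaced by the value of any fraction \<open>P / Q\<close>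
  that represents it and is defined at the point in question.\<close>

definition represents ::
  "nat \<Rightarrow> (arr \<Rightarrow> complex) \<Rightarrow> (arr \<Rightarrow> complex) \<Rightarrow> (arr \<Rightarrow> complex) \<Rightarrow> bool" where
  "represents n P Q f \<longleftrightarrow>
     poly_fun n P \<and> poly_fun n Q \<and> (\<forall>v. generic n v \<longrightarrow> f v * Q v = P v)"

definition rat_value :: "nat \<Rightarrow> (arr \<Rightarrow> complex) \<Rightarrow> arr \<Rightarrow> complex" where
  "rat_value n f u = (THE c. \<exists>P Q. represents n P Q f \<and> Q u \<noteq> 0 \<and> c = P u / Q u)"

text \<open>\<open>\<partial>f/\<partial>v\<^sub>p\<^sub>q\<close> at \<open>u\<close>.\<close>

definition rat_partial :: "nat \<Rightarrow> nat \<Rightarrow> nat \<Rightarrow> (arr \<Rightarrow> complex) \<Rightarrow> arr \<Rightarrow> complex" where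
  "rat_partial n p q f u = deriv (\<lambda>t. rat_value n f (upd u p q t)) (u p q)"

definition D_bar ::
  "nat \<Rightarrow> nat \<Rightarrow> nat \<Rightarrow> nat \<Rightarrow> arr \<Rightarrow> (arr \<Rightarrow> complex) \<Rightarrow> complex" where
  "D_bar n k i j vb f = (rat_partial n k i f vb - rat_partial n k j f vb) / 2"


section \<open>The singular module\<close>

text \<open>\<open>Tab z\<close> and \<open>DTab z\<close> are the symbols \<open>T(vb + z)\<close> and \<open>DT(vb + z)\<close>, where \<open>vb\<close> is the
  fixed singular array.\<close>

datatype symb = Tab shift | DTab shift

abbreviation "tab z \<equiv> Poly_Mapping.single (Tab z) (1::complex)"
abbreviation "dtab z \<equiv> Poly_Mapping.single (DTab z) (1::complex)"

definition symb_space :: "nat \<Rightarrow> (symb \<Rightarrow>\<^sub>0 complex) set" where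
  "symb_space n = {f. Poly_Mapping.keys f \<subseteq> Tab ` shifts n \<union> DTab ` shifts n}"

definition relators :: "nat \<Rightarrow> nat \<Rightarrow> nat \<Rightarrow> nat \<Rightarrow> (symb \<Rightarrow>\<^sub>0 complex) set" where
  "relators n k i j = free.span
     ((\<lambda>z. tab z - tab (swap k i j z)) ` shifts n \<union> (\<lambda>z. dtab z + dtab (swap k i j z)) ` shifts n)"

text \<open>\<open>D_comb\<close> applies the linear extension of \<open>D_bar\<close> to the finite combination of the
  \<open>T(v + z')\<close> with coefficient functions \<open>F z'\<close>.\<close>

definition D_comb ::
  "nat \<Rightarrow> nat \<Rightarrow> nat \<Rightarrow> nat \<Rightarrow> arr \<Rightarrow> (shift \<Rightarrow> arr \<Rightarrow> complex) \<Rightarrow> (symb \<Rightarrow>\<^sub>0 complex)" where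
  "D_comb n k i j vb F =
     (\<Sum>z' \<in> {z'. \<exists>v. generic n v \<and> F z' v \<noteq> 0}.
        cscale (D_bar n k i j vb (F z')) (tab z') + cscale (rat_value n (F z') vb) (dtab z'))"

text \<open>If \<open>\<tau>(w) = w\<close> then \<open>DT(vb + w) = 0\<close> in the quotient, whence the value \<open>0\<close>.\<close>

fun sing_E_symb ::
  "nat \<Rightarrow> nat \<Rightarrow> nat \<Rightarrow> nat \<Rightarrow> (nat \<Rightarrow> complex) \<Rightarrow> arr \<Rightarrow> nat \<Rightarrow> nat \<Rightarrow> symb \<Rightarrow> (symb \<Rightarrow>\<^sub>0 complex)"
where
  "sing_E_symb n k i j a vb r s (Tab z) =
     D_comb n k i j vb (\<lambda>z' v. (v k i - v k j) * gen_coeff n a r s z z' v)"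
| "sing_E_symb n k i j a vb r s (DTab w) =
     (if swap k i j w = w then 0 else D_comb n k i j vb (gen_coeff n a r s w))"

text \<open>Quotient vector spaces, as sets of cosets.\<close>

definition coset :: "'m::ab_group_add set \<Rightarrow> 'm \<Rightarrow> 'm set" where
  "coset R f = {g. g - f \<in> R}"

text \<open>The operations are computed on representatives. The unions are over equal cosets as soon as
  the operation is well defined on the quotient.\<close>

record 'm gl_module =
  m_carrier :: "'m set"
  m_zero :: 'm
  m_add :: "'m \<Rightarrow> 'm \<Rightarrow> 'm"
  m_scale :: "complex \<Rightarrow> 'm \<Rightarrow> 'm"
  m_E :: "nat \<Rightarrow> nat \<Rightarrow> 'm \<Rightarrow> 'm"

definition sing_module ::
  "nat \<Rightarrow> nat \<Rightarrow> nat \<Rightarrow> nat \<Rightarrow> (nat \<Rightarrow> complex) \<Rightarrow> arr \<Rightarrow> (symb \<Rightarrow>\<^sub>0 complex) set gl_module" where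
  "sing_module n k i j a vb = (let R = relators n k i j in
     \<lparr> m_carrier = coset R ` symb_space n,
       m_zero = coset R 0,
       m_add = (\<lambda>X Y. \<Union>f\<in>X. \<Union>g\<in>Y. coset R (f + g)),
       m_scale = (\<lambda>c X. \<Union>f\<in>X. coset R (cscale c f)),
       m_E = (\<lambda>r s X. \<Union>f\<in>X. coset R (lin_ext (sing_E_symb n k i j a vb r s) f)) \<rparr>)"

definition gl_submodule :: "nat \<Rightarrow> 'm set \<Rightarrow> 'm gl_module \<Rightarrow> bool" where
  "gl_submodule n W M \<longleftrightarrow>
     W \<subseteq> m_carrier M \<and> m_zero M \<in> W \<and>
     (\<forall>x\<in>W. \<forall>y\<in>W. m_add M x y \<in> W) \<and>
     (\<forall>c. \<forall>x\<in>W. m_scale M c x \<in> W) \<and>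
     (\<forall>r\<in>{1..n}. \<forall>s\<in>{1..n}. \<forall>x\<in>W. m_E M r s x \<in> W)"

definition gl_irreducible :: "nat \<Rightarrow> 'm gl_module \<Rightarrow> bool" where
  "gl_irreducible n M \<longleftrightarrow>
     m_carrier M \<noteq> {m_zero M} \<and>
     (\<forall>W. gl_submodule n W M \<longrightarrow> W = {m_zero M} \<or> W = m_carrier M)"

end

theory Submission
  imports Defs "HOL-Computational_Algebra.Formal_Laurent_Series"
begin

text \<open>The singular module is a limit of generic modules, and the proof carries the limit out
algebraically. Put \<open>v\<^sub>t = vb + t (\<delta>\<^sup>k\<^sup>i - \<delta>\<^sup>k\<^sup>j)\<close>. Over the field of Laurent series in \<open>t\<close> the array
\<open>v\<^sub>t\<close> is generic, so the Gelfand-Tsetlin formulas act on combinations \<open>\<Sum> h(z) T(v\<^sub>t + z)\<close> with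
Laurent coefficients. The substitution \<open>t \<mapsto> -t\<close> together with \<open>\<tau>\<close> is a symmetry of these formulas.
Let \<open>L\<close> be the set of the invariant \<open>h\<close> all of whose coefficients have order at least \<open>-1\<close>. It is
stable, because a coefficient has a pole only where \<open>\<tau> z = z\<close>, and there \<open>h(z)\<close> is even, hence
regular. Since \<open>\<D>\<close> is half the derivative along \<open>v\<^sub>t\<close> and \<open>x - y = 2t\<close>, the singular module is
\<open>L / t\<^sup>2 L\<close>: the symbol \<open>T(vb + z)\<close> is the sum of \<open>T(v\<^sub>t + z)\<close> and \<open>T(v\<^sub>t + \<tau> z)\<close>, and \<open>DT(vb + z)\<close> is
their difference divided by \<open>2t\<close> (\<open>Psi\<close>, \<open>Psi_E\<close>). A submodule thus becomes a complex
subspace \<open>W\<close> of \<open>L\<close> that contains \<open>t\<^sup>2 L\<close> and is stable under the operators \<open>ladder\<close> of the simple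
root vectors and under the diagonal matrices.

Tableaux are separated inside \<open>W\<close> by the quadratic Casimir elements of the subalgebras \<open>\<gg>\<ll>(m)\<close>,
which here take the form of the statement that \<open>W\<close> is stable under multiplication by the sum \<open>Q\<^sub>m\<close>
of the squares of the entries of row \<open>m\<close> (\<open>preserves_row_square\<close>). It follows by induction
on \<open>m\<close> from one identity, \<open>quadratic_recursion\<close>: if \<open>E\<close> and \<open>F\<close> raise and lower row \<open>m\<close>,
then \<open>F Q\<^sub>m E + E Q\<^sub>m F - Q\<^sub>m F E - F E Q\<^sub>m\<close> is diagonal, and its eigenvalue is \<open>Q\<^sub>m\<^sub>+\<^sub>1\<close> plus a polynomial in
quantities already known to preserve \<open>W\<close>. Hence \<open>W\<close> contains the part of each of its elements
on which the constant term of \<open>Q\<^sub>m\<close> has a given value (\<open>W_restrict_row\<close>).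

Suppose now that \<open>W\<close> is not contained in \<open>t\<^sup>2 L\<close>, and take an element outside \<open>t\<^sup>2 L\<close> whose support
meets as few \<open>\<tau>\<close>-orbits as possible. Minimality makes all \<open>Q\<^sub>m\<close> constant on the support up to
order \<open>1\<close>. Raise the entry \<open>(p,q)\<close> and project to the value of \<open>Q\<^sub>p\<close> belonging to one tableau \<open>z0\<close> of
the support: since \<open>Q\<^sub>p\<close> grows by \<open>2w + 1\<close> when the entry \<open>w\<close> is raised, exactly the tableaux
with the same \<open>(p,q)\<close> entry as \<open>z0\<close> survive, up to \<open>\<tau>\<close>. By minimality no orbit is lost, so
all entries agree and there is a single orbit (\<open>minimal_single_orbit\<close>). From one tableau the same
projected steps reach all neighbours, because the hypothesis on adjacent rows keeps the
numerators nonzero at \<open>t = 0\<close>; a step out of a tableau with \<open>\<tau> z = z\<close> has a pole and so produces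
the derivative tableaux as well (\<open>Tvec_step\<close>, \<open>Dvec_step\<close>, \<open>W_full\<close>).\<close>

unbundle no vec_syntax
notation fps_nth (infixl "$" 75)
notation fls_nth (infixl "$$" 75)

section \<open>Divided differences\<close>

text \<open>For a polynomial \<open>g\<close> this is the coefficient of degree \<open>card I - 1\<close> of the polynomial that
interpolates \<open>g\<close> at the points \<open>p i\<close>; it is also the sum of the residues of
\<open>g(x) / \<Prod> (x - p i)\<close>. The sums over a row in the Gelfand-Tsetlin formulas have this form.\<close>

definition divdiff :: "'i set \<Rightarrow> ('i \<Rightarrow> 'a::field) \<Rightarrow> ('a \<Rightarrow> 'a) \<Rightarrow> 'a" where
  "divdiff I p g = (\<Sum>i\<in>I. g (p i) / (\<Prod>j\<in>I - {i}. p i - p j))"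

definition monic_roots :: "'a::field list \<Rightarrow> 'a \<Rightarrow> 'a" where
  "monic_roots zs x = (\<Prod>z\<leftarrow>zs. x - z)"

lemma divdiff_add: "divdiff I p (\<lambda>x. g x + h x) = divdiff I p g + divdiff I p h"
  by (simp add: divdiff_def add_divide_distrib sum.distrib)

lemma divdiff_cmult: "divdiff I p (\<lambda>x. c * g x) = c * divdiff I p g"
  by (simp add: divdiff_def sum_distrib_left)

text \<open>A zero at a node removes the node. All evaluations below come from it by peeling off one zero
of a monic polynomial: \<open>x - z = (x - p a) + (p a - z)\<close>.\<close>

lemma divdiff_cancel_root:
  assumes "finite I" "a \<in> I" "inj_on p I"
  shows "divdiff I p (\<lambda>x. (x - p a) * g x) = divdiff (I - {a}) p g"
proof -
  have "divdiff I p (\<lambda>x. (x - p a) * g x)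
      = (\<Sum>i\<in>I - {a}. (p i - p a) * g (p i) / (\<Prod>j\<in>I - {i}. p i - p j))"
    unfolding divdiff_def using assms by (subst sum.remove[of I a]) auto
  also have "\<dots> = divdiff (I - {a}) p g"
    unfolding divdiff_def
  proof (rule sum.cong[OF refl])
    fix i assume i: "i \<in> I - {a}"
    then have "p i - p a \<noteq> 0" using assms by (auto dest: inj_onD)
    moreover have "(\<Prod>j\<in>I - {i}. p i - p j) = (p i - p a) * (\<Prod>j\<in>I - {a} - {i}. p i - p j)"
      using assms i prod.remove[of "I - {i}" a "\<lambda>j. p i - p j"]
      by (auto simp: Diff_insert[symmetric] insert_commute)
    ultimately show "(p i - p a) * g (p i) / (\<Prod>j\<in>I - {i}. p i - p j)
        = g (p i) / (\<Prod>j\<in>I - {a} - {i}. p i - p j)" by simp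
  qed
  finally show ?thesis .
qed

lemma divdiff_const:
  assumes "finite I" "card I \<ge> 2" "inj_on p I"
  shows "divdiff I p (\<lambda>x. 1) = 0"
  using assms
proof (induction "card I" arbitrary: I rule: less_induct)
  case less
  from less.prems(2) obtain a b where ab: "a \<in> I" "b \<in> I" "a \<noteq> b"
    by (metis One_nat_def card_le_Suc0_iff_eq less.prems(1) not_less_eq_eq numeral_2_eq_2)
  have neq: "p b - p a \<noteq> 0" using less.prems(3) ab by (auto dest: inj_onD)
  have 1: "divdiff (I - {a}) p (\<lambda>x. 1) = divdiff I p (\<lambda>x. x - p a)"
    using divdiff_cancel_root[of I a p "\<lambda>_. 1"] less.prems ab by simp
  have 2: "divdiff (I - {b}) p (\<lambda>x. 1) = divdiff I p (\<lambda>x. x - p b)"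
    using divdiff_cancel_root[of I b p "\<lambda>_. 1"] less.prems ab by simp
  have 3: "divdiff (I - {a}) p (\<lambda>x. 1) = divdiff (I - {b}) p (\<lambda>x. 1)"
  proof (cases "card I = 2")
    case True
    then have "card (I - {a}) = 1" "card (I - {b}) = 1" using ab by auto
    then obtain a' b' where "I - {a} = {a'}" "I - {b} = {b'}" by (meson card_1_singletonE)
    then show ?thesis by (simp add: divdiff_def)
  next
    case False
    then have "card (I - {a}) \<ge> 2" "card (I - {b}) \<ge> 2" "card (I - {a}) < card I"
      "card (I - {b}) < card I" using ab less.prems by (auto simp: card_gt_0_iff)
    then show ?thesis using less.hyps[of "I - {a}"] less.hyps[of "I - {b}"] less.prems
      by (metis finite_Diff inj_on_diff)
  qed
  have "(p b - p a) * divdiff I p (\<lambda>x. 1)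
      = divdiff I p (\<lambda>x. (x - p a) + (-1) * (x - p b))"
    by (subst divdiff_cmult[symmetric]) simp
  also have "\<dots> = 0"
    unfolding divdiff_add divdiff_cmult using 1 2 3 by simp
  finally show ?case using neq by simp
qed

lemma divdiff_monic_Cons:
  assumes "finite I" "a \<in> I" "inj_on p I"
  shows "divdiff I p (monic_roots (z # zs))
       = divdiff (I - {a}) p (monic_roots zs) + (p a - z) * divdiff I p (monic_roots zs)"
proof -
  have "monic_roots (z # zs)
      = (\<lambda>x. (x - p a) * monic_roots zs x + (p a - z) * monic_roots zs x)"
    by (auto simp: monic_roots_def algebra_simps)
  then show ?thesis
    by (simp add: divdiff_add divdiff_cmult divdiff_cancel_root[OF assms])
qed

text \<open>The next four lemmas are the expansion at infinity of \<open>\<Prod>(x - z) / \<Prod>(x - p i)\<close>: the numerator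
has degree at most \<open>N - 2\<close>, or equal to \<open>N - 1\<close>, \<open>N\<close>, \<open>N + 1\<close>, where \<open>N\<close> is the number of nodes, and the
coefficient of \<open>1/x\<close> is computed.\<close>

lemma divdiff_monic_low:
  assumes "finite I" "inj_on p I" "length zs + 1 < card I"
  shows "divdiff I p (monic_roots zs) = 0"
  using assms
proof (induction zs arbitrary: I)
  case Nil
  then show ?case using divdiff_const[of I p] by (simp add: monic_roots_def)
next
  case (Cons z zs)
  then obtain a where a: "a \<in> I" by fastforce
  show ?case
    using Cons.IH[of I] Cons.IH[of "I - {a}"] Cons.prems a
    by (subst divdiff_monic_Cons[OF _ a]) (auto simp: inj_on_diff)
qed

lemma divdiff_monic_eq1:
  assumes "finite I" "inj_on p I" "length zs + 1 = card I"
  shows "divdiff I p (monic_roots zs) = 1"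
  using assms
proof (induction zs arbitrary: I)
  case Nil
  then obtain a where "I = {a}" by (metis add_0 card_1_singletonE list.size(3))
  then show ?case by (simp add: monic_roots_def divdiff_def)
next
  case (Cons z zs)
  then obtain a where a: "a \<in> I" by fastforce
  show ?case
    using Cons.IH[of "I - {a}"] Cons.prems a divdiff_monic_low[of I p zs]
    by (subst divdiff_monic_Cons[OF _ a]) (auto simp: inj_on_diff)
qed

lemma divdiff_monic_linear:
  assumes "finite I" "inj_on p I" "length zs = card I"
  shows "divdiff I p (monic_roots zs) = sum p I - sum_list zs"
  using assms
proof (induction zs arbitrary: I)
  case Nil
  then show ?case by (simp add: divdiff_def)
next
  case (Cons z zs)
  then obtain a where a: "a \<in> I" by fastforce
  have "sum p I = p a + sum p (I - {a})" using Cons.prems a by (simp add: sum.remove)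
  then show ?case
    using Cons.IH[of "I - {a}"] Cons.prems a divdiff_monic_eq1[of I p zs]
    by (subst divdiff_monic_Cons[OF _ a]) (auto simp: inj_on_diff)
qed

lemma divdiff_monic_quadratic:
  assumes "finite I" "inj_on p I" "length zs = card I + 1"
  shows "2 * divdiff I p (monic_roots zs)
       = (sum p I - sum_list zs)\<^sup>2 + (\<Sum>i\<in>I. (p i)\<^sup>2) - (\<Sum>z\<leftarrow>zs. z\<^sup>2)"
  using assms
proof (induction zs arbitrary: I)
  case Nil
  then show ?case by simp
next
  case (Cons z zs)
  show ?case
  proof (cases "I = {}")
    case True
    then show ?thesis using Cons.prems by (simp add: divdiff_def)
  next
    case False
    then obtain a where a: "a \<in> I" by auto
    have s: "sum p (I - {a}) = sum p I - p a" "(\<Sum>i\<in>I - {a}. (p i)\<^sup>2) = (\<Sum>i\<in>I. (p i)\<^sup>2) - (p a)\<^sup>2"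
      using Cons.prems a by (simp_all add: sum.remove)
    have IH: "2 * divdiff (I - {a}) p (monic_roots zs)
       = (sum p (I - {a}) - sum_list zs)\<^sup>2 + (\<Sum>i\<in>I - {a}. (p i)\<^sup>2) - (\<Sum>z\<leftarrow>zs. z\<^sup>2)"
    proof (rule Cons.IH)
      show "length zs = card (I - {a}) + 1"
        using Cons.prems(3)[unfolded list.size] card.remove[OF Cons.prems(1) a] by linarith
    qed (use Cons.prems in \<open>auto simp: inj_on_diff\<close>)
    have "2 * divdiff I p (monic_roots (z # zs)) = 2 * divdiff (I - {a}) p (monic_roots zs)
        + 2 * (p a - z) * (sum p I - sum_list zs)"
    proof -
      have lin: "divdiff I p (monic_roots zs) = sum p I - sum_list zs"
        using Cons.prems by (intro divdiff_monic_linear) auto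
      show ?thesis
        unfolding divdiff_monic_Cons[OF Cons.prems(1) a Cons.prems(2)] lin
        by (simp add: algebra_simps)
    qed
    then show ?thesis
      unfolding IH s by (simp add: power2_eq_square algebra_simps)
  qed
qed

text \<open>Here \<open>w\<close>, \<open>b\<close>, \<open>c\<close> are the rows \<open>m\<close>, \<open>m + 1\<close>, \<open>m - 1\<close> of a tableau, \<open>A q\<close> is the coefficient of raising and
then lowering the entry \<open>w q\<close>, and \<open>B q\<close> that of lowering and then raising it. Up to sign both are
residues of one rational function with \<open>2m\<close> simple poles, at \<open>w q\<close> and at \<open>w q - 1\<close>, and \<open>2m\<close> zeros, at \<open>b u\<close>
and \<open>c u - 1\<close>. The two claims are therefore divided differences of degree \<open>2m\<close> and \<open>2m + 1\<close>.\<close>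

lemma shifted_row_residues:
  fixes w b c :: "nat \<Rightarrow> 'a::field" and m :: nat
  assumes m: "1 \<le> m"
    and generic: "\<And>q u. q \<in> {1..m} \<Longrightarrow> u \<in> {1..m} \<Longrightarrow> q \<noteq> u \<Longrightarrow> w q - w u \<notin> \<int>"
  defines "P \<equiv> \<lambda>q x. (\<Prod>u\<in>{1..m} - {q}. x - w u)"
  defines "A \<equiv> \<lambda>q. - ((\<Prod>u=1..m+1. w q - b u) * (\<Prod>u=1..m-1. w q + 1 - c u) / (P q (w q) * P q (w q + 1)))"
    and "B \<equiv> \<lambda>q. - ((\<Prod>u=1..m-1. w q - c u) * (\<Prod>u=1..m+1. w q - 1 - b u) / (P q (w q) * P q (w q - 1)))"
  defines "r \<equiv> (\<Sum>u=1..m. w u) + (\<Sum>u=1..m. w u - 1) - (\<Sum>u=1..m+1. b u) - (\<Sum>u=1..m-1. c u - 1)"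
  shows "(\<Sum>q=1..m. B q) - (\<Sum>q=1..m. A q) = r" (is ?linear)
    and "(\<Sum>q=1..m. A q * (2 * w q + 1)) - (\<Sum>q=1..m. B q * (2 * w q - 1))
       = - (r\<^sup>2 + r + (\<Sum>u=1..m. (w u)\<^sup>2) + (\<Sum>u=1..m. (w u - 1)\<^sup>2)
            - (\<Sum>u=1..m+1. (b u)\<^sup>2) - (\<Sum>u=1..m-1. (c u - 1)\<^sup>2))" (is ?quadratic)
proof -
  define I where "I = {1..m} \<times> (UNIV :: bool set)"
  define p where "p = (\<lambda>(q, s). w q - (if s then 1 else 0))"
  define zs where "zs = map b [1..<m+2] @ map (\<lambda>u. c u - 1) [1..<m]"
  have I: "I = (\<lambda>q. (q, False)) ` {1..m} \<union> (\<lambda>q. (q, True)) ` {1..m}"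
    by (auto simp: I_def image_iff)
  have finI: "finite I" by (simp add: I_def)
  have cardI: "card I = 2 * m" by (simp add: I_def)
  have len: "length zs = card I" using m by (simp add: zs_def cardI)
  have inj: "inj_on p I"
  proof (rule inj_onI)
    fix x y assume xy: "x \<in> I" "y \<in> I" "p x = p y"
    obtain q s u t where x: "x = (q, s)" and y: "y = (u, t)" by (metis surj_pair)
    have "w q - w u = of_bool s - of_bool t"
      using xy by (auto simp: x y p_def algebra_simps split: if_splits)
    then have "w q - w u \<in> \<int>" by simp
    then have "q = u" using generic[of q u] xy by (auto simp: x y I_def)
    then show "x = y" using xy by (auto simp: x y p_def split: if_splits)
  qed
  have sum_I: "sum f I = (\<Sum>q=1..m. f (q, False)) + (\<Sum>q=1..m. f (q, True))" for f :: "nat \<times> bool \<Rightarrow> 'a"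
    unfolding I by (subst sum.union_disjoint) (auto simp: sum.reindex inj_on_def)
  have prod_I: "(\<Prod>j\<in>I - {(q, s)}. f j)
      = f (q, \<not> s) * ((\<Prod>u\<in>{1..m} - {q}. f (u, False)) * (\<Prod>u\<in>{1..m} - {q}. f (u, True)))"
    if "q \<in> {1..m}" for f :: "nat \<times> bool \<Rightarrow> 'a" and q s
  proof -
    let ?J = "(\<lambda>q. (q, False)) ` ({1..m} - {q}) \<union> (\<lambda>q. (q, True)) ` ({1..m} - {q})"
    have 1: "I - {(q, s)} = insert (q, \<not> s) ?J"
    proof (rule set_eqI)
      fix x :: "nat \<times> bool"
      obtain u t where x: "x = (u, t)" by (cases x)
      show "x \<in> I - {(q, s)} \<longleftrightarrow> x \<in> insert (q, \<not> s) ?J"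
        using that by (cases t; cases s) (auto simp: I_def x)
    qed
    have 2: "(\<Prod>j\<in>?J. f j)
      = (\<Prod>u\<in>{1..m} - {q}. f (u, False)) * (\<Prod>u\<in>{1..m} - {q}. f (u, True))"
      by (subst prod.union_disjoint) (auto simp: prod.reindex inj_on_def)
    have "(q, \<not> s) \<notin> ?J" by auto
    then show ?thesis unfolding 1 by (subst prod.insert) (simp_all only: 2, auto)
  qed
  have G: "monic_roots zs x = (\<Prod>u=1..m+1. x - b u) * (\<Prod>u=1..m-1. x + 1 - c u)" for x
  proof -
    have 1: "(\<Prod>z\<leftarrow>map b [1..<m+2]. x - z) = (\<Prod>u=1..m+1. x - b u)"
      using prod.distinct_set_conv_list[of "[1..<m+2]" "\<lambda>u. x - b u"]
      by (simp add: o_def atLeastLessThanSuc_atLeastAtMost del: upt_Suc)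
    have 2: "(\<Prod>z\<leftarrow>map (\<lambda>u. c u - 1) [1..<m]. x - z) = (\<Prod>u=1..m-1. x + 1 - c u)"
      using prod.distinct_set_conv_list[of "[1..<m]" "\<lambda>u. x + 1 - c u"] m
      by (cases m) (simp_all add: o_def algebra_simps atLeastLessThanSuc_atLeastAtMost del: upt_Suc)
    show ?thesis using 1 2 by (simp add: monic_roots_def zs_def del: upt_Suc)
  qed
  have sum_zs: "(\<Sum>z\<leftarrow>zs. f z) = (\<Sum>u=1..m+1. f (b u)) + (\<Sum>u=1..m-1. f (c u - 1))" for f :: "'a \<Rightarrow> 'a"
  proof -
    have 1: "(\<Sum>z\<leftarrow>map b [1..<m+2]. f z) = (\<Sum>u=1..m+1. f (b u))"
      using sum.distinct_set_conv_list[of "[1..<m+2]" "\<lambda>u. f (b u)"]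
      by (simp add: o_def atLeastLessThanSuc_atLeastAtMost del: upt_Suc)
    have 2: "(\<Sum>z\<leftarrow>map (\<lambda>u. c u - 1) [1..<m]. f z) = (\<Sum>u=1..m-1. f (c u - 1))"
      using sum.distinct_set_conv_list[of "[1..<m]" "\<lambda>u. f (c u - 1)"] m
      by (cases m) (simp_all add: o_def atLeastLessThanSuc_atLeastAtMost del: upt_Suc)
    show ?thesis using 1 2 by (simp add: zs_def del: upt_Suc)
  qed
  have dd: "divdiff I p g = (\<Sum>q=1..m. g (w q) / (P q (w q) * P q (w q + 1)))
      - (\<Sum>q=1..m. g (w q - 1) / (P q (w q) * P q (w q - 1)))" for g
  proof -
    have F: "(\<Prod>j\<in>I - {(q, False)}. p (q, False) - p j) = P q (w q) * P q (w q + 1)"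
      if "q \<in> {1..m}" for q
      by (subst prod_I[OF that]) (simp add: p_def P_def algebra_simps)
    have T: "(\<Prod>j\<in>I - {(q, True)}. p (q, True) - p j) = - (P q (w q) * P q (w q - 1))"
      if "q \<in> {1..m}" for q
      by (subst prod_I[OF that]) (simp add: p_def P_def algebra_simps)
    show ?thesis
      unfolding divdiff_def sum_I using F T by (simp add: p_def sum_negf)
  qed
  have A: "A q = - (monic_roots zs (w q) / (P q (w q) * P q (w q + 1)))" for q
    by (simp add: A_def G)
  have B: "B q = - (monic_roots zs (w q - 1) / (P q (w q) * P q (w q - 1)))" for q
    by (simp add: B_def G mult.commute)
  have r: "r = sum p I - sum_list zs"
    using sum_zs[of "\<lambda>z. z"] unfolding sum_I r_def by (simp add: p_def)
  have res: "divdiff I p (monic_roots zs) = r"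
    using divdiff_monic_linear[OF finI inj len] r by simp
  show ?linear
    using res unfolding dd A B by (simp add: sum_negf)
  \<comment> \<open>Multiplying by \<open>x\<close> adds the zero \<open>0\<close>; the factor \<open>2 x + 1\<close> is \<open>2 w q + 1\<close> at \<open>w q\<close>
    and \<open>2 w q - 1\<close> at \<open>w q - 1\<close>.\<close>
  have "divdiff I p (\<lambda>x. 2 * (x * monic_roots zs x) + monic_roots zs x)
      = 2 * divdiff I p (monic_roots (0 # zs)) + r"
  proof -
    have "monic_roots (0 # zs) = (\<lambda>x. x * monic_roots zs x)"
      by (simp add: monic_roots_def fun_eq_iff)
    then show ?thesis
      using divdiff_add[of I p "\<lambda>x. 2 * (x * monic_roots zs x)" "monic_roots zs"]
        divdiff_cmult[of I p 2 "\<lambda>x. x * monic_roots zs x"] res by simp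
  qed
  also have "\<dots> = r\<^sup>2 + r + (\<Sum>i\<in>I. (p i)\<^sup>2) - (\<Sum>z\<leftarrow>zs. z\<^sup>2)"
    by (subst divdiff_monic_quadratic[OF finI inj]) (simp_all add: len r algebra_simps)
  also have "\<dots> = r\<^sup>2 + r + (\<Sum>u=1..m. (w u)\<^sup>2) + (\<Sum>u=1..m. (w u - 1)\<^sup>2)
            - (\<Sum>u=1..m+1. (b u)\<^sup>2) - (\<Sum>u=1..m-1. (c u - 1)\<^sup>2)"
    unfolding sum_zs sum_I by (simp add: p_def)
  finally show ?quadratic
    unfolding dd A B by (simp add: sum_negf algebra_simps)
qed

section \<open>Raising and lowering operators over a field\<close>

definition move :: "int \<Rightarrow> nat \<Rightarrow> nat \<Rightarrow> shift \<Rightarrow> shift" where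
  "move s p q z = upd z p q (z p q + s)"

lemma move_apply: "move s p q z r t = z r t + (if r = p \<and> t = q then s else 0)"
  by (simp add: move_def upd_def)

lemma move_commute: "move s p q (move t p u z) = move t p u (move s p q z)"
  by (intro ext) (simp add: move_apply)

lemma move_inverse [simp]: "move (- s) p q (move s p q z) = z" "move s p q (move (- s) p q z) = z"
  by (intro ext; simp add: move_apply)+

locale tableaux =
  fixes n :: nat and top :: "nat \<Rightarrow> 'a::field" and v :: "nat \<Rightarrow> nat \<Rightarrow> 'a"
begin

definition entry :: "shift \<Rightarrow> nat \<Rightarrow> nat \<Rightarrow> 'a" where
  "entry z p q = (if p = n then top q else v p q + of_int (z p q))"

definition coef :: "int \<Rightarrow> nat \<Rightarrow> nat \<Rightarrow> shift \<Rightarrow> 'a" where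
  "coef s p q z =
     (if s = 1 then - (\<Prod>u=1..p+1. entry z p q - entry z (p+1) u)
      else (\<Prod>u=1..p-1. entry z p q - entry z (p-1) u))
     / (\<Prod>u\<in>{1..p} - {q}. entry z p q - entry z p u)"

text \<open>The action of \<open>E\<^sub>p\<^sub>,\<^sub>p\<^sub>+\<^sub>1\<close> (for \<open>s = 1\<close>) or \<open>E\<^sub>p\<^sub>+\<^sub>1\<^sub>,\<^sub>p\<close> (for \<open>s = -1\<close>), written on coefficient functions:
\<open>h\<close> stands for the combination of the \<open>T(v + z)\<close> with coefficients \<open>h z\<close>. Each tableau collects from
the tableaux that reach it, so the formula makes sense for functions with infinite support too.\<close>

definition ladder :: "int \<Rightarrow> nat \<Rightarrow> (shift \<Rightarrow> 'a) \<Rightarrow> shift \<Rightarrow> 'a" where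
  "ladder s p h z = (\<Sum>q=1..p. coef s p q (move (- s) p q z) * h (move (- s) p q z))"

definition row_sum :: "nat \<Rightarrow> shift \<Rightarrow> 'a" where
  "row_sum p z = (\<Sum>q=1..p. entry z p q)"

definition row_square :: "nat \<Rightarrow> shift \<Rightarrow> 'a" where
  "row_square p z = (\<Sum>q=1..p. (entry z p q)\<^sup>2)"

lemma entry_move:
  "p < n \<Longrightarrow> entry (move s p q z) r u = entry z r u + (if r = p \<and> u = q then of_int s else 0)"
  by (simp add: entry_def move_apply)

lemma row_square_move:
  assumes "p < n" "q \<in> {1..p}"
  shows "row_square p (move s p q z) = row_square p z + (2 * of_int s * entry z p q + (of_int s)\<^sup>2)"
proof -
  have "(\<Sum>u\<in>{1..p} - {q}. (entry (move s p q z) p u)\<^sup>2) = (\<Sum>u\<in>{1..p} - {q}. (entry z p u)\<^sup>2)"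
    using assms by (intro sum.cong) (auto simp: entry_move)
  moreover have "(entry (move s p q z) p q)\<^sup>2
      = (entry z p q)\<^sup>2 + (2 * of_int s * entry z p q + (of_int s)\<^sup>2)"
    using assms by (simp add: entry_move power2_sum)
  ultimately show ?thesis
    using assms unfolding row_square_def
    by (simp only: sum.remove[OF finite_atLeastAtMost, of q] add.assoc add.commute add.left_commute)
qed

text \<open>Raising one entry of a row commutes with lowering another: the only factors that change
are \<open>x q - x q'\<close> and its negative, and \<open>(-d) (d - 1) = (1 - d) d\<close> with \<open>d = x q' - x q\<close>. This is the
off-diagonal part of the relation for \<open>[E\<^sub>p\<^sub>,\<^sub>p\<^sub>+\<^sub>1, E\<^sub>p\<^sub>+\<^sub>1\<^sub>,\<^sub>p]\<close>.\<close>

lemma coef_commute: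
  assumes m: "m < n" and q: "q \<in> {1..m}" "q' \<in> {1..m}" "q \<noteq> q'"
  shows "coef (-1) m q' (move 1 m q z) * coef 1 m q z
       = coef 1 m q (move (-1) m q' z) * coef (-1) m q' z"
proof -
  let ?x = "entry z m"
  define R where "R = (\<Prod>u\<in>{1..m} - {q} - {q'}. ?x q - ?x u)"
  define R' where "R' = (\<Prod>u\<in>{1..m} - {q'} - {q}. ?x q' - ?x u)"
  define U where "U = (\<Prod>u=1..m+1. ?x q - entry z (m+1) u)"
  define V where "V = (\<Prod>u=1..m-1. ?x q' - entry z (m-1) u)"
  have 1: "coef 1 m q z = - U / ((?x q - ?x q') * R)"
    unfolding coef_def U_def R_def using q
    by (subst prod.remove[of "{1..m} - {q}" q']) auto
  have 2: "coef 1 m q (move (-1) m q' z) = - U / ((?x q - ?x q' + 1) * R)"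
    unfolding coef_def U_def R_def using q m
    by (subst prod.remove[of "{1..m} - {q}" q']) (auto simp: entry_move intro!: prod.cong)
  have m1: "m - 1 \<noteq> m" using q by auto
  have 3: "coef (-1) m q' z = V / ((?x q' - ?x q) * R')"
    unfolding coef_def V_def R'_def using q
    by (subst prod.remove[of "{1..m} - {q'}" q]) auto
  have 4: "coef (-1) m q' (move 1 m q z) = V / ((?x q' - ?x q - 1) * R')"
    unfolding coef_def V_def R'_def using q m m1
    by (subst prod.remove[of "{1..m} - {q'}" q]) (auto simp: entry_move intro!: prod.cong)
  have "(?x q' - ?x q - 1) * (?x q - ?x q') = (?x q - ?x q' + 1) * (?x q' - ?x q)"
    by (simp add: algebra_simps)
  then have "((?x q' - ?x q - 1) * (?x q - ?x q')) * (R * R')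
      = ((?x q - ?x q' + 1) * (?x q' - ?x q)) * (R * R')" by (rule arg_cong)
  then have e: "((?x q' - ?x q - 1) * R') * ((?x q - ?x q') * R)
      = ((?x q - ?x q' + 1) * R) * ((?x q' - ?x q) * R')"
    by (simp only: mult_ac)
  show ?thesis unfolding 1 2 3 4 times_divide_times_eq e by (simp only: mult_ac)
qed

text \<open>The combination on the left is chosen so that a raise at \<open>q\<close> followed by a lowering at \<open>q' \<noteq> q\<close>, in
either order, contributes \<open>D(z + \<delta>\<^sup>q) + D(z - \<delta>\<^sup>q') - D(z) - D(z + \<delta>\<^sup>q - \<delta>\<^sup>q')\<close> (taken at the source), which
vanishes because \<open>D\<close> is a sum of functions of single entries. The diagonal terms are summed by
\<open>shifted_row_residues\<close>. It plays the role of the recursion that expresses the quadratic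
Casimir element of \<open>\<gg>\<ll>(m + 1)\<close> through that of \<open>\<gg>\<ll>(m)\<close> and the simple root vectors.\<close>

lemma quadratic_recursion:
  fixes h :: "shift \<Rightarrow> 'a"
  assumes m: "1 \<le> m" "m < n"
    and generic: "\<And>q u. q \<in> {1..m} \<Longrightarrow> u \<in> {1..m} \<Longrightarrow> q \<noteq> u \<Longrightarrow> v m q - v m u \<notin> \<int>"
  defines "D \<equiv> row_square m"
  defines "r \<equiv> \<lambda>z. 2 * row_sum m z - row_sum (m+1) z - row_sum (m-1) z - 1"
  shows "ladder (-1) m (\<lambda>y. D y * ladder 1 m h y) z + ladder 1 m (\<lambda>y. D y * ladder (-1) m h y) z
       - D z * ladder (-1) m (ladder 1 m h) z - ladder (-1) m (ladder 1 m (\<lambda>y. D y * h y)) z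
       = (D z * r z - ((r z)\<^sup>2 + r z + 2 * D z - 2 * row_sum m z + of_nat m - row_square (m+1) z
            - row_square (m-1) z + 2 * row_sum (m-1) z - of_nat (m-1))) * h z"
proof -
  let ?I = "{1..m}"
  let ?u = "\<lambda>q. move 1 m q z" and ?d = "\<lambda>q. move (-1) m q z"
  let ?zz = "\<lambda>q' q. move (-1) m q (move 1 m q' z)"
  define T where "T = (\<lambda>q' q. (coef (-1) m q' (?u q') * coef 1 m q (?zz q' q) * (D (?u q') - D z - D (?zz q' q))
      + coef 1 m q (?d q) * coef (-1) m q' (?zz q' q) * D (?d q)) * h (?zz q' q))"
  have zz: "move 1 m q' (?d q) = ?zz q' q" for q q' by (rule move_commute)
  have z1: "move 1 m q (?zz q' q) = ?u q'" for q q' using move_inverse(2)[of 1] by simp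
  have z2: "move (-1) m q' (?zz q' q) = ?d q" for q q'
    unfolding zz[symmetric] using move_inverse(1)[of 1] by simp
  have "ladder (-1) m (\<lambda>y. D y * ladder 1 m h y) z + ladder 1 m (\<lambda>y. D y * ladder (-1) m h y) z
       - D z * ladder (-1) m (ladder 1 m h) z - ladder (-1) m (ladder 1 m (\<lambda>y. D y * h y)) z
      = (\<Sum>q'\<in>?I. \<Sum>q\<in>?I. T q' q)"
  proof -
    have 1: "ladder (-1) m (\<lambda>y. D y * ladder 1 m h y) z
        = (\<Sum>q'\<in>?I. \<Sum>q\<in>?I. coef (-1) m q' (?u q') * coef 1 m q (?zz q' q) * D (?u q') * h (?zz q' q))"
      unfolding ladder_def by (simp add: sum_distrib_left mult_ac)
    have 2: "ladder 1 m (\<lambda>y. D y * ladder (-1) m h y) z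
        = (\<Sum>q'\<in>?I. \<Sum>q\<in>?I. coef 1 m q (?d q) * coef (-1) m q' (?zz q' q) * D (?d q) * h (?zz q' q))"
      unfolding ladder_def by (subst sum.swap) (simp add: sum_distrib_left zz mult_ac)
    have 3: "D z * ladder (-1) m (ladder 1 m h) z
        = (\<Sum>q'\<in>?I. \<Sum>q\<in>?I. coef (-1) m q' (?u q') * coef 1 m q (?zz q' q) * D z * h (?zz q' q))"
      unfolding ladder_def by (simp add: sum_distrib_left mult_ac)
    have 4: "ladder (-1) m (ladder 1 m (\<lambda>y. D y * h y)) z
        = (\<Sum>q'\<in>?I. \<Sum>q\<in>?I. coef (-1) m q' (?u q') * coef 1 m q (?zz q' q) * D (?zz q' q) * h (?zz q' q))"
      unfolding ladder_def by (simp add: sum_distrib_left mult_ac)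
    show ?thesis
      unfolding 1 2 3 4 T_def sum.distrib[symmetric] sum_subtractf[symmetric]
      by (intro sum.cong refl) (simp add: algebra_simps)
  qed
  also have "\<dots> = (\<Sum>q'\<in>?I. T q' q')"
  proof (rule sum.cong[OF refl])
    fix q' assume q': "q' \<in> ?I"
    have "T q' q = 0" if q: "q \<in> ?I - {q'}" for q
    proof -
      have c: "coef (-1) m q' (?u q') * coef 1 m q (?zz q' q)
          = coef 1 m q (?d q) * coef (-1) m q' (?zz q' q)"
        using coef_commute[of m q q' "?zz q' q"] q q' m unfolding z1 z2 by auto
      have "D (?u q') - D z - D (?zz q' q) + D (?d q) = 0"
        unfolding D_def using q q' m by (auto simp: row_square_move entry_move algebra_simps)
      then show ?thesis unfolding T_def c by (simp add: distrib_left[symmetric])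
    qed
    then show "(\<Sum>q\<in>?I. T q' q) = T q' q'"
      using q' sum.remove[of ?I q' "T q'"] by simp
  qed
  also have "\<dots> = (\<Sum>q\<in>?I. (coef (-1) m q (?u q) * coef 1 m q z * (2 * entry z m q + 1)
       - coef 1 m q (?d q) * coef (-1) m q z * (2 * entry z m q - 1)
       + D z * (coef 1 m q (?d q) * coef (-1) m q z - coef (-1) m q (?u q) * coef 1 m q z)) * h z)"
    by (rule sum.cong[OF refl])
       (use m in \<open>simp add: T_def D_def row_square_move move_inverse[of 1, simplified] algebra_simps\<close>)
  also have "\<dots> = ((\<Sum>q=1..m. coef (-1) m q (?u q) * coef 1 m q z * (2 * entry z m q + 1))
       - (\<Sum>q=1..m. coef 1 m q (?d q) * coef (-1) m q z * (2 * entry z m q - 1))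
       + D z * ((\<Sum>q=1..m. coef 1 m q (?d q) * coef (-1) m q z) - (\<Sum>q=1..m. coef (-1) m q (?u q) * coef 1 m q z))) * h z"
    by (simp add: sum_distrib_right sum_distrib_left sum.distrib sum_subtractf algebra_simps)
  finally have main: "ladder (-1) m (\<lambda>y. D y * ladder 1 m h y) z + ladder 1 m (\<lambda>y. D y * ladder (-1) m h y) z
       - D z * ladder (-1) m (ladder 1 m h) z - ladder (-1) m (ladder 1 m (\<lambda>y. D y * h y)) z = \<dots>" .
  let ?w = "entry z m" and ?b = "entry z (m+1)" and ?c = "entry z (m-1)"
  have gen: "?w q - ?w u \<notin> \<int>" if "q \<in> ?I" "u \<in> ?I" "q \<noteq> u" for q u
  proof
    assume "?w q - ?w u \<in> \<int>"
    then have "(?w q - ?w u) - of_int (z m q - z m u) \<in> \<int>" by (rule Ints_diff) simp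
    moreover have "(?w q - ?w u) - of_int (z m q - z m u) = v m q - v m u"
      using m by (simp add: entry_def)
    ultimately show False using generic[OF that] by metis
  qed
  have m1: "m - 1 \<noteq> m" "m - 1 \<noteq> n" "m + 1 \<noteq> m" using m by auto
  have A: "coef (-1) m q (?u q) * coef 1 m q z =
      - ((\<Prod>u=1..m+1. ?w q - ?b u) * (\<Prod>u=1..m-1. ?w q + 1 - ?c u)
        / ((\<Prod>u\<in>?I - {q}. ?w q - ?w u) * (\<Prod>u\<in>?I - {q}. ?w q + 1 - ?w u)))" for q
    using m m1 by (simp add: coef_def entry_move mult.commute)
  have B: "coef 1 m q (?d q) * coef (-1) m q z =
      - ((\<Prod>u=1..m-1. ?w q - ?c u) * (\<Prod>u=1..m+1. ?w q - 1 - ?b u)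
        / ((\<Prod>u\<in>?I - {q}. ?w q - ?w u) * (\<Prod>u\<in>?I - {q}. ?w q - 1 - ?w u)))" for q
    using m m1 by (simp add: coef_def entry_move mult.commute)
  have r: "r z = (\<Sum>u=1..m. ?w u) + (\<Sum>u=1..m. ?w u - 1) - (\<Sum>u=1..m+1. ?b u) - (\<Sum>u=1..m-1. ?c u - 1)"
    using m unfolding r_def row_sum_def sum_subtractf by (cases m) simp_all
  have sq: "(\<Sum>u=1..m. (?w u - 1)\<^sup>2) = row_square m z - 2 * row_sum m z + of_nat m"
     "(\<Sum>u=1..m-1. (?c u - 1)\<^sup>2) = row_square (m-1) z - 2 * row_sum (m-1) z + of_nat (m-1)"
    unfolding row_square_def row_sum_def
    by (simp_all add: power2_diff sum.distrib sum_subtractf sum_distrib_left)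
  have 1: "(\<Sum>q=1..m. coef 1 m q (?d q) * coef (-1) m q z) - (\<Sum>q=1..m. coef (-1) m q (?u q) * coef 1 m q z) = r z"
    unfolding A B r by (rule shifted_row_residues(1)[where w = ?w and b = ?b and c = ?c]) (rule m(1), rule gen)
  have 2: "(\<Sum>q=1..m. coef (-1) m q (?u q) * coef 1 m q z * (2 * entry z m q + 1))
       - (\<Sum>q=1..m. coef 1 m q (?d q) * coef (-1) m q z * (2 * entry z m q - 1))
       = - ((r z)\<^sup>2 + r z + row_square m z + (\<Sum>u=1..m. (?w u - 1)\<^sup>2)
            - row_square (m+1) z - (\<Sum>u=1..m-1. (?c u - 1)\<^sup>2))"
    unfolding A B r row_square_def
    by (rule shifted_row_residues(2)[where w = ?w and b = ?b and c = ?c]) (rule m(1), rule gen)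
  show ?thesis
    unfolding main 1 2 sq by (simp add: D_def algebra_simps)
qed

end

section \<open>Orders of Laurent series\<close>

definition order_ge :: "int \<Rightarrow> complex fls \<Rightarrow> bool" where
  "order_ge d x \<longleftrightarrow> (\<forall>m<d. x $$ m = 0)"

lemma order_ge_subdegree: "order_ge d x \<longleftrightarrow> x = 0 \<or> d \<le> fls_subdegree x"
  unfolding order_ge_def by (metis fls_eq0_below_subdegree fls_subdegree_geI fls_zero_nth order_less_le_trans)

lemma order_ge_simps [simp]: "order_ge d 0" "order_ge d (- x) = order_ge d x"
  by (auto simp: order_ge_def)

lemma order_ge_const [simp]: "d \<le> 0 \<Longrightarrow> order_ge d (fls_const c)"
  by (simp add: order_ge_def)

lemma order_ge_add: "order_ge d x \<Longrightarrow> order_ge d y \<Longrightarrow> order_ge d (x + y)"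
  and order_ge_diff: "order_ge d x \<Longrightarrow> order_ge d y \<Longrightarrow> order_ge d (x - y)"
  by (auto simp: order_ge_def)

lemma order_ge_mono: "order_ge d x \<Longrightarrow> e \<le> d \<Longrightarrow> order_ge e x"
  by (auto simp: order_ge_def)

lemma order_ge_sum: "(\<And>q. q \<in> A \<Longrightarrow> order_ge d (f q)) \<Longrightarrow> order_ge d (sum f A)"
  by (induction A rule: infinite_finite_induct) (auto intro: order_ge_add)

lemma order_ge_mult: "order_ge d x \<Longrightarrow> order_ge e y \<Longrightarrow> order_ge (d + e) (x * y)"
  by (cases "x = 0 \<or> y = 0") (auto simp: order_ge_subdegree simp del: mult_eq_0_iff)

lemma order_ge_mult_eq: "order_ge d x \<Longrightarrow> order_ge e y \<Longrightarrow> f = d + e \<Longrightarrow> order_ge f (x * y)"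
  using order_ge_mult by blast

lemma leading_mult:
  assumes "order_ge d x" "order_ge e y" "f = d + e"
  shows "(x * y) $$ f = x $$ d * y $$ e"
proof (cases "x = 0 \<or> y = 0")
  case False
  then have le: "d \<le> fls_subdegree x" "e \<le> fls_subdegree y"
    using assms by (auto simp: order_ge_subdegree)
  show ?thesis
  proof (cases "d = fls_subdegree x \<and> e = fls_subdegree y")
    case True
    then show ?thesis using assms by simp
  next
    case no: False
    then have "d + e < fls_subdegree x + fls_subdegree y" using le by linarith
    moreover have "x $$ d = 0 \<or> y $$ e = 0" using le no by (metis fls_eq0_below_subdegree order_less_le)
    ultimately show ?thesis using assms fls_times_nth_eq0[of "d + e" x y] by auto
  qed
qed auto

lemma order_ge_Suc: "order_ge (d + 1) x \<longleftrightarrow> order_ge d x \<and> x $$ d = 0"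
proof -
  have "m < d + 1 \<longleftrightarrow> m < d \<or> m = d" for m by linarith
  then show ?thesis by (auto simp: order_ge_def)
qed

lemma order_ge_1_iff: "order_ge 1 x \<longleftrightarrow> order_ge 0 x \<and> x $$ 0 = 0"
  and order_ge_0_iff: "order_ge 0 x \<longleftrightarrow> order_ge (-1) x \<and> x $$ (-1) = 0"
  using order_ge_Suc[of 0 x] order_ge_Suc[of "-1" x] by simp_all

lemma leading_inverse:
  assumes "order_ge d x" "x $$ d \<noteq> 0"
  shows "order_ge (- d) (inverse x)" "inverse x $$ (- d) = inverse (x $$ d)"
proof -
  have x: "x \<noteq> 0" using assms by auto
  then have "fls_subdegree x = d"
    using assms by (meson fls_subdegree_leI order_antisym order_ge_subdegree)
  moreover have "fls_subdegree (x * inverse x) = fls_subdegree x + fls_subdegree (inverse x)"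
    using x by (intro fls_subdegree_mult) auto
  ultimately show o: "order_ge (- d) (inverse x)" using x by (simp add: order_ge_subdegree)
  have "(x * inverse x) $$ 0 = x $$ d * inverse x $$ (- d)"
    using leading_mult[OF assms(1) o] by simp
  then show "inverse x $$ (- d) = inverse (x $$ d)" using x assms(2) by (simp add: field_simps)
qed

lemma order_ge_prod:
  assumes "\<And>u. u \<in> A \<Longrightarrow> order_ge 0 (f u)"
  shows "order_ge 0 (prod f A) \<and> prod f A $$ 0 = (\<Prod>u\<in>A. f u $$ 0)"
  using assms
  by (induction A rule: infinite_finite_induct)
    (auto simp: order_ge_def[of 0 1] leading_mult[of 0 _ 0] intro: order_ge_mult_eq[of 0 _ 0])

text \<open>The automorphism \<open>t \<mapsto> -t\<close> of the field of Laurent series.\<close>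

definition flip :: "complex fls \<Rightarrow> complex fls" where
  "flip x = fls_compose_fps x (fps_const (-1) * fps_X)"

lemma flip_nth: "flip x $$ m = (-1) powi m * x $$ m"
  unfolding flip_def by (subst fls_nth_fls_compose_fps_linear) auto

lemma flip_nth_simps [simp]: "flip x $$ 0 = x $$ 0" "flip x $$ (-1) = - x $$ (-1)"
  by (simp_all add: flip_nth power_int_minus)

lemma flip_order_ge [simp]: "order_ge d (flip x) = order_ge d x"
  by (simp add: order_ge_def flip_nth)

lemma flip_compose_aux: "fps_const (-1) * fps_X \<noteq> (0 :: complex fps)"
  "fps_nth (fps_const (-1) * fps_X :: complex fps) 0 = 0"
  by auto

lemma flip_simps [simp]:
  "flip 0 = 0" "flip 1 = 1" "flip (fls_const c) = fls_const c" "flip (of_int m) = of_int m"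
  "flip (of_nat l) = of_nat l" "flip (- x) = - flip x" "flip (x + y) = flip x + flip y"
  "flip (x - y) = flip x - flip y"
  by (simp_all add: fls_eq_iff flip_nth algebra_simps fls_of_int_nth fls_of_nat_nth)

lemma flip_mult [simp]: "flip (x * y) = flip x * flip y"
  and flip_divide [simp]: "flip (x / y) = flip x / flip y"
  unfolding flip_def
  by (rule fls_compose_fps_mult[OF flip_compose_aux] fls_compose_fps_divide[OF flip_compose_aux])+

lemma flip_flip [simp]: "flip (flip x) = x"
  by (simp add: fls_eq_iff flip_nth power_int_mult_distrib[symmetric] mult.assoc[symmetric])

lemma flip_X [simp]: "flip fls_X = - fls_X"
  by (simp add: fls_eq_iff flip_nth)

lemma flip_sum [simp]: "flip (sum f A) = (\<Sum>q\<in>A. flip (f q))"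
  by (induction A rule: infinite_finite_induct) auto

lemma flip_prod [simp]: "flip (prod f A) = (\<Prod>q\<in>A. flip (f q))"
  by (induction A rule: infinite_finite_induct) auto

lemma flip_power [simp]: "flip (x ^ m) = flip x ^ m"
  by (induction m) auto

section \<open>The line through the singular array\<close>

lemma leading_prod:
  assumes "finite A" "\<And>u. u \<in> A \<Longrightarrow> order_ge 0 (f u)" "\<And>u. u \<in> A \<Longrightarrow> f u $$ 0 \<noteq> 0"
  shows "prod f A $$ 0 \<noteq> 0"
  using order_ge_prod[of A f] assms by simp

locale singular_tableau =
  fixes n i j k :: nat and a :: "nat \<Rightarrow> complex" and vb :: arr
  assumes ij: "1 \<le> i" "i < j" "j \<le> k" "k \<le> n - 1"
    and singular: "vb k i = vb k j"
    and other_generic: "\<And>r s u. \<lbrakk>1 \<le> s; s < u; u \<le> r; r \<le> n - 1; (r, s, u) \<noteq> (k, i, j)\<rbrakk>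
           \<Longrightarrow> vb r s - vb r u \<notin> \<int>"
    and nonresonant: "\<And>r s t. \<lbrakk>1 \<le> t; t < r; r \<le> n; 1 \<le> s; s \<le> r\<rbrakk>
           \<Longrightarrow> ext n a vb r s - ext n a vb (r - 1) t \<notin> \<int>"
begin

text \<open>The array \<open>v\<^sub>t = vb + t (\<delta>\<^sup>k\<^sup>i - \<delta>\<^sup>k\<^sup>j)\<close>, with the variable \<open>t\<close> of the Laurent series.\<close>

definition line :: "nat \<Rightarrow> nat \<Rightarrow> complex fls" where
  "line p q = fls_const (vb p q) + (if p = k \<and> q = i then fls_X else if p = k \<and> q = j then - fls_X else 0)"

sublocale tableaux n "\<lambda>q. fls_const (a q)" line .

text \<open>The transposition of \<open>i\<close> and \<open>j\<close> is used as a permutation of the positions of row \<open>k\<close> only, so that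
\<open>\<tau>\<close> acts on row \<open>p\<close> through \<open>perm p\<close>; sums and products over any row can then be reindexed uniformly.\<close>

definition perm :: "nat \<Rightarrow> nat \<Rightarrow> nat" where
  "perm p q = (if p = k then Transposition.transpose i j q else q)"

definition \<tau> :: "shift \<Rightarrow> shift" where
  "\<tau> = swap k i j"

lemma perm_perm [simp]: "perm p (perm p q) = q"
  by (simp add: perm_def)

lemma perm_eq_iff [simp]: "perm p q = perm p u \<longleftrightarrow> q = u"
  by (metis perm_perm)

lemma inj_perm: "inj (perm p)"
  by (simp add: inj_def)

lemma perm_atMost: "perm p ` {1..r} = {1..r}" if "p = k \<longrightarrow> k \<le> r"
  using that ij by (auto simp: perm_def image_iff Transposition.transpose_def)

lemma perm_in [simp]: "perm p q \<in> {1..p} \<longleftrightarrow> q \<in> {1..p}"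
  using ij by (auto simp: perm_def Transposition.transpose_def)

lemma bij_perm: "bij_betw (perm p) {1..p} {1..p}"
  unfolding bij_betw_def using perm_atMost[of p p] by (auto simp: inj_on_def)

lemma tau_apply: "\<tau> z p q = z p (perm p q)"
  using ij by (auto simp: \<tau>_def swap_def upd_def perm_def Transposition.transpose_def)

lemma tau_tau [simp]: "\<tau> (\<tau> z) = z"
  by (intro ext) (simp add: tau_apply)

lemma tau_eq_iff: "\<tau> z = z \<longleftrightarrow> z k i = z k j"
proof
  assume "\<tau> z = z"
  then show "z k i = z k j" using tau_apply[of z k i] by (simp add: perm_def)
qed (auto simp: tau_apply perm_def Transposition.transpose_def fun_eq_iff)

lemma tau_shifts [simp]: "\<tau> z \<in> shifts n \<longleftrightarrow> z \<in> shifts n"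
proof -
  have "\<tau> z \<in> shifts n" if z: "z \<in> shifts n" for z
    unfolding shifts_def
  proof (clarify)
    fix r s assume rs: "\<not> (1 \<le> s \<and> s \<le> r \<and> r \<le> n - 1)"
    then have "\<not> (1 \<le> perm r s \<and> perm r s \<le> r \<and> r \<le> n - 1)" using perm_in[of r s] unfolding atLeastAtMost_iff by blast
    then show "\<tau> z r s = 0" using z by (simp add: shifts_def tau_apply)
  qed
  from this[of z] this[of "\<tau> z"] show ?thesis by auto
qed

lemma move_shifts [simp]:
  assumes "1 \<le> q" "q \<le> p" "p \<le> n - 1"
  shows "move s p q z \<in> shifts n \<longleftrightarrow> z \<in> shifts n"
proof -
  have "move s p q z r t = z r t" if "\<not> (1 \<le> t \<and> t \<le> r \<and> r \<le> n - 1)" for r t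
    using that assms by (auto simp: move_apply)
  then show ?thesis unfolding shifts_def mem_Collect_eq by metis
qed

lemma move_tau: "move s p q (\<tau> z) = \<tau> (move s p (perm p q) z)"
  by (intro ext) (auto simp: move_apply tau_apply)

lemma entry_tau: "entry (\<tau> z) p q = flip (entry z p (perm p q))"
  using ij by (auto simp: entry_def line_def tau_apply perm_def Transposition.transpose_def singular)

lemma sum_row_perm: "(\<Sum>q=1..p. f (perm p q)) = (\<Sum>q=1..p. f q)"
  using bij_perm by (rule sum.reindex_bij_betw)

lemma prod_row_perm: "(\<Prod>q=1..p. f (perm p q)) = (\<Prod>q=1..p. f q)"
  using bij_perm by (rule prod.reindex_bij_betw)

lemma row_sum_tau: "row_sum p (\<tau> z) = flip (row_sum p z)"
  and row_square_tau: "row_square p (\<tau> z) = flip (row_square p z)"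
  unfolding row_sum_def row_square_def entry_tau flip_sum[symmetric] flip_power[symmetric]
  using sum_row_perm[of "entry z p" p] sum_row_perm[of "\<lambda>q. (entry z p q)\<^sup>2" p] by simp_all

lemma coef_tau:
  assumes q: "q \<in> {1..p}"
  shows "coef s p q (\<tau> z) = flip (coef s p (perm p q) z)"
proof -
  let ?f = "\<lambda>r u. flip (entry z p (perm p q) - entry z r u)"
  have "bij_betw (perm p) ({1..p} - {q}) ({1..p} - {perm p q})"
    unfolding bij_betw_def using perm_atMost[of p p] by (auto simp: inj_on_def image_set_diff[OF inj_perm])
  then have 1: "(\<Prod>u\<in>{1..p} - {q}. ?f p (perm p u)) = (\<Prod>u\<in>{1..p} - {perm p q}. ?f p u)"
    by (rule prod.reindex_bij_betw)
  have 2: "(\<Prod>u=1..r. ?f r (perm r u)) = (\<Prod>u=1..r. ?f r u)" for r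
    by (rule prod_row_perm)
  have "coef s p q (\<tau> z)
      = (if s = 1 then - (\<Prod>u=1..p+1. ?f (p+1) (perm (p+1) u))
         else (\<Prod>u=1..p-1. ?f (p-1) (perm (p-1) u))) / (\<Prod>u\<in>{1..p} - {q}. ?f p (perm p u))"
    by (simp only: coef_def entry_tau flip_simps)
  also have "\<dots> = flip (coef s p (perm p q) z)"
    unfolding 1 2 coef_def by (simp only: flip_divide flip_prod flip_simps if_distrib[of flip])
  finally show ?thesis .
qed

text \<open>The positions at which the coefficients of the ladder operators have a pole at \<open>t = 0\<close>.\<close>

definition sing :: "nat \<Rightarrow> nat \<Rightarrow> shift \<Rightarrow> bool" where
  "sing p q z \<longleftrightarrow> p = k \<and> (q = i \<or> q = j) \<and> \<tau> z = z"

lemma entry_regular: "order_ge 0 (entry z p q)"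
  by (auto simp: entry_def line_def fls_of_int intro!: order_ge_add)
     (auto simp: order_ge_def)

lemma entry_0: "entry z p q $$ 0 = ext n a vb p q + (if p = n then 0 else of_int (z p q))"
  by (auto simp: entry_def line_def ext_def fls_of_int_nth)

lemma not_int_add: "x \<notin> \<int> \<Longrightarrow> x + of_int m \<notin> \<int>" for x :: complex
  by (metis Ints_diff Ints_of_int add_diff_cancel_right')

lemma entry_diff_adjacent:
  assumes "1 \<le> t" "t < r" "r \<le> n" "1 \<le> s" "s \<le> r"
  shows "(entry z r s - entry z (r - 1) t) $$ 0 \<noteq> 0"
proof -
  have "(entry z r s - entry z (r - 1) t) $$ 0
      = (ext n a vb r s - ext n a vb (r - 1) t) + of_int ((if r = n then 0 else z r s) - (if r - 1 = n then 0 else z (r - 1) t))"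
    by (auto simp: entry_0)
  then show ?thesis using not_int_add[OF nonresonant[OF assms]] by (metis Ints_0)
qed

lemma entry_diff_row_not_int:
  assumes "p \<le> n - 1" "q \<in> {1..p}" "u \<in> {1..p}" "q \<noteq> u" "\<not> (p = k \<and> {q, u} = {i, j})"
  shows "(entry z p q - entry z' p u) $$ 0 \<notin> \<int>"
proof -
  have pn: "p \<noteq> n" using assms ij by auto
  have lt: "vb p q - vb p u \<notin> \<int>" if "q < u" "q \<in> {1..p}" "u \<in> {1..p}" "(p, q, u) \<noteq> (k, i, j)" for q u
    using that assms(1) by (intro other_generic) auto
  have "vb p q - vb p u \<notin> \<int>"
  proof (cases "q < u")
    case True
    then show ?thesis using lt[of q u] assms by auto
  next
    case False
    then have "vb p u - vb p q \<notin> \<int>" using lt[of u q] assms by auto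
    then show ?thesis by (metis Ints_minus minus_diff_eq)
  qed
  moreover have "(entry z p q - entry z' p u) $$ 0 = (vb p q - vb p u) + of_int (z p q - z' p u)"
    using pn by (simp add: entry_0 ext_def)
  ultimately show ?thesis using not_int_add by metis
qed

lemma entry_diff_pair:
  "entry z k i - entry z k j = fls_const (of_int (z k i - z k j)) + 2 * fls_X"
  using ij by (auto simp: entry_def line_def singular fls_of_int fls_eq_iff)

lemma entry_diff_pair_nth:
  "(entry z k i - entry z k j) $$ m = (if m = 0 then of_int (z k i - z k j) else if m = 1 then 2 else 0)"
  unfolding entry_diff_pair by auto

lemma line_not_int:
  assumes "p \<le> n - 1" "q \<in> {1..p}" "u \<in> {1..p}" "q \<noteq> u"
  shows "line p q - line p u \<notin> \<int>"
proof
  assume "line p q - line p u \<in> \<int>"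
  then obtain m where m: "line p q - line p u = fls_const (of_int m)"
    by (auto elim!: Ints_cases simp: fls_of_int)
  have pn: "p \<noteq> n" using assms ij by auto
  show False
  proof (cases "p = k \<and> {q, u} = {i, j}")
    case True
    then have "(line p q - line p u) $$ 1 \<noteq> 0"
      using ij by (auto simp: line_def doubleton_eq_iff)
    then show False by (simp add: m)
  next
    case False
    then have "(entry (\<lambda>_ _. 0) p q - entry (\<lambda>_ _. 0) p u) $$ 0 \<notin> \<int>"
      using entry_diff_row_not_int assms by blast
    then show False using m pn by (simp add: entry_def)
  qed
qed

text \<open>All factors of the numerator and all but at most one of the denominator are nonzero at
\<open>t = 0\<close>: the numerator by nonresonance of adjacent rows, the denominator because only the
entries \<open>(k,i)\<close> and \<open>(k,j)\<close> can differ by an integer. Their difference is \<open>z k i - z k j + 2 t\<close>.\<close>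

lemma coef_leading:
  fixes z :: shift
  assumes p: "1 \<le> p" "p \<le> n - 1" and q: "q \<in> {1..p}"
  defines "d \<equiv> (if sing p q z then -1 else 0)"
  shows "order_ge d (coef s p q z)" "coef s p q z $$ d \<noteq> 0"
proof -
  let ?e = "entry z"
  define num where "num = (if s = 1 then - (\<Prod>u=1..p+1. ?e p q - ?e (p+1) u)
      else (\<Prod>u=1..p-1. ?e p q - ?e (p-1) u))"
  define den where "den = (\<Prod>u\<in>{1..p} - {q}. ?e p q - ?e p u)"
  have pn: "p + 1 \<le> n" using p by linarith
  have up: "(?e p q - ?e (p+1) u) $$ 0 \<noteq> 0" if "u \<in> {1..p+1}" for u
    using entry_diff_adjacent[of q "p+1" u z] p q that pn by auto
  have down: "(?e p q - ?e (p-1) u) $$ 0 \<noteq> 0" if "u \<in> {1..p-1}" for u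
  proof -
    have "1 \<le> u" "u < p" "p \<le> n" "1 \<le> q" "q \<le> p" using p q that by auto
    then show ?thesis by (rule entry_diff_adjacent)
  qed
  have reg: "order_ge 0 (?e p q - ?e r u)" for r u
    by (intro order_ge_diff entry_regular)
  define U where "U = (\<Prod>u=1..p+1. ?e p q - ?e (p+1) u)"
  define V where "V = (\<Prod>u=1..p-1. ?e p q - ?e (p-1) u)"
  have UV: "order_ge 0 U" "order_ge 0 V"
    unfolding U_def V_def by (rule conjunct1[OF order_ge_prod[OF reg]])+
  moreover have "U $$ 0 \<noteq> 0"
    unfolding U_def by (rule leading_prod[OF _ reg up]) simp
  moreover have "V $$ 0 \<noteq> 0"
    unfolding V_def by (rule leading_prod[OF _ reg down]) simp
  ultimately have num: "order_ge 0 num" "num $$ 0 \<noteq> 0"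
    unfolding num_def U_def[symmetric] V_def[symmetric] by auto
  have den: "order_ge (- d) den" "den $$ (- d) \<noteq> 0"
  proof -
    have *: "order_ge (- d) den \<and> den $$ (- d) \<noteq> 0"
    proof (cases "p = k \<and> (q = i \<or> q = j)")
      case False
      then have "d = 0" by (auto simp: d_def sing_def)
      moreover have "(?e p q - ?e p u) $$ 0 \<noteq> 0" if "u \<in> {1..p} - {q}" for u
        using entry_diff_row_not_int[of p q u z z] p q that False by (auto simp: doubleton_eq_iff)
      ultimately show ?thesis
        using order_ge_prod[of "{1..p} - {q}" "\<lambda>u. ?e p q - ?e p u", OF reg] by (auto simp: den_def)
    next
      case True
      define q' where "q' = perm p q"
      have q': "q' \<in> {1..p} - {q}" "{q, q'} = {i, j}"
        using True q ij by (auto simp: q'_def perm_def Transposition.transpose_def)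
      have pair: "order_ge (- d) (?e p q - ?e p q')" "(?e p q - ?e p q') $$ (- d) \<noteq> 0"
      proof -
        have base: "order_ge (- d) (?e k i - ?e k j) \<and> (?e k i - ?e k j) $$ (- d) \<noteq> 0"
        proof (cases "\<tau> z = z")
          case t: True
          then have "d = -1" using True by (simp add: d_def sing_def)
          then show ?thesis using t unfolding order_ge_def entry_diff_pair_nth by (simp add: tau_eq_iff)
        next
          case t: False
          then have "d = 0" by (simp add: d_def sing_def)
          then show ?thesis using t unfolding order_ge_def entry_diff_pair_nth by (simp add: tau_eq_iff)
        qed
        have "?e p q - ?e p q' = ?e k i - ?e k j \<or> ?e p q - ?e p q' = - (?e k i - ?e k j)"
          using q'(2) True unfolding doubleton_eq_iff by force
        then have "order_ge (- d) (?e p q - ?e p q') \<and> (?e p q - ?e p q') $$ (- d) \<noteq> 0"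
        proof
          assume e: "?e p q - ?e p q' = ?e k i - ?e k j"
          show ?thesis unfolding e by (rule base)
        next
          assume e: "?e p q - ?e p q' = - (?e k i - ?e k j)"
          show ?thesis
            unfolding e order_ge_simps fls_uminus_nth neg_equal_0_iff_equal by (rule base)
        qed
        then show "order_ge (- d) (?e p q - ?e p q')" "(?e p q - ?e p q') $$ (- d) \<noteq> 0"
          by (rule conjunct1, rule conjunct2)
      qed
      define rest where "rest = (\<Prod>u\<in>{1..p} - {q} - {q'}. ?e p q - ?e p u)"
      have "(?e p q - ?e p u) $$ 0 \<noteq> 0" if "u \<in> {1..p} - {q} - {q'}" for u
      proof -
        have "{q, u} \<noteq> {i, j}" using that q' by (metis DiffE doubleton_eq_iff insertI1)
        then show ?thesis
          using entry_diff_row_not_int[of p q u z z] p q that by (metis Diff_iff Ints_0 insertI1)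
      qed
      then have rest: "order_ge 0 rest" "rest $$ 0 \<noteq> 0"
        using order_ge_prod[of "{1..p} - {q} - {q'}" "\<lambda>u. ?e p q - ?e p u", OF reg] by (auto simp: rest_def)
      have "den = (?e p q - ?e p q') * rest"
        unfolding den_def rest_def using q' by (intro prod.remove) auto
      then show ?thesis
        using pair rest leading_mult[of "- d" _ 0 rest "- d"] order_ge_mult[of "- d" _ 0 rest] by auto
    qed
    then show "order_ge (- d) den" "den $$ (- d) \<noteq> 0" by auto
  qed
  have eq: "coef s p q z = num * inverse den"
    unfolding coef_def num_def den_def by (rule divide_inverse)
  show "order_ge d (coef s p q z)"
    unfolding eq using order_ge_mult[OF num(1) leading_inverse(1)[OF den]] by simp
  show "coef s p q z $$ d \<noteq> 0"
    unfolding eq using leading_mult[OF num(1) leading_inverse(1)[OF den], of d] num(2) den(2)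
      leading_inverse(2)[OF den] by simp
qed

end

section \<open>The lattice of the singular module\<close>

lemma const_minus_one: "fls_const (-1) * x = - (x :: complex fls)"
  by (simp add: fls_eq_iff)

context singular_tableau
begin

text \<open>The invariants of \<open>t \<mapsto> -t\<close> combined with \<open>\<tau>\<close>, with poles of order at most one; this is the set
\<open>L\<close> described at the beginning.\<close>

definition lattice :: "(shift \<Rightarrow> complex fls) set" where
  "lattice = {h. finite {z. h z \<noteq> 0} \<and> (\<forall>z. h z \<noteq> 0 \<longrightarrow> z \<in> shifts n)
     \<and> (\<forall>z. h (\<tau> z) = flip (h z)) \<and> (\<forall>z. order_ge (-1) (h z))}"

text \<open>The subspace \<open>t\<^sup>2 L\<close>, modulo which the lattice is the singular module.\<close>

definition small :: "(shift \<Rightarrow> complex fls) set" where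
  "small = {h \<in> lattice. \<forall>z. order_ge 1 (h z)}"

lemma latticeD:
  assumes "h \<in> lattice"
  shows "finite {z. h z \<noteq> 0}" "h z \<noteq> 0 \<Longrightarrow> z \<in> shifts n" "h (\<tau> z) = flip (h z)" "order_ge (-1) (h z)"
  using assms by (auto simp: lattice_def)

lemma latticeI:
  assumes "finite S" "\<And>z. h z \<noteq> 0 \<Longrightarrow> z \<in> S" "\<And>z. h z \<noteq> 0 \<Longrightarrow> z \<in> shifts n"
    "\<And>z. h (\<tau> z) = flip (h z)" "\<And>z. order_ge (-1) (h z)"
  shows "h \<in> lattice"
proof -
  have "finite {z. h z \<noteq> 0}" by (rule finite_subset[OF _ assms(1)]) (use assms(2) in auto)
  then show ?thesis using assms by (auto simp: lattice_def)
qed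

lemma lattice_zero [simp]: "(\<lambda>z. 0) \<in> lattice" and small_zero [simp]: "(\<lambda>z. 0) \<in> small"
  by (auto simp: lattice_def small_def)

lemma lattice_add: "g \<in> lattice \<Longrightarrow> h \<in> lattice \<Longrightarrow> (\<lambda>z. g z + h z) \<in> lattice"
  by (rule latticeI[of "{z. g z \<noteq> 0} \<union> {z. h z \<noteq> 0}"])
    (use latticeD in \<open>auto intro!: order_ge_add\<close>, (metis add_0_left latticeD(2))+)

lemma lattice_mult:
  assumes h: "h \<in> lattice" and "\<And>z. D (\<tau> z) = flip (D z)" "\<And>z. order_ge 0 (D z)"
  shows "(\<lambda>z. D z * h z) \<in> lattice"
  by (rule latticeI[of "{z. h z \<noteq> 0}"])
    (use latticeD[OF h] assms in \<open>auto intro!: order_ge_mult_eq[of 0 _ "-1"]\<close>)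

lemma lattice_scale: "h \<in> lattice \<Longrightarrow> (\<lambda>z. fls_const c * h z) \<in> lattice"
  by (rule lattice_mult) auto

lemma lattice_diff: "g \<in> lattice \<Longrightarrow> h \<in> lattice \<Longrightarrow> (\<lambda>z. g z - h z) \<in> lattice"
  using lattice_add[of g "\<lambda>z. fls_const (-1) * h z"] lattice_scale[of h "-1"]
  by (simp add: const_minus_one)

lemma lattice_restrict:
  assumes h: "h \<in> lattice" and S: "\<And>z. \<tau> z \<in> S \<longleftrightarrow> z \<in> S"
  shows "(\<lambda>z. if z \<in> S then h z else 0) \<in> lattice"
  by (rule latticeI[of "{z. h z \<noteq> 0}"]) (use latticeD[OF h] S in \<open>auto split: if_splits\<close>)

text \<open>At a fixed tableau the coefficient is an even Laurent series, so it has no term in \<open>1/t\<close>; an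
element of \<open>t\<^sup>2 L\<close> has no term in \<open>t\<close> there.\<close>

lemma lattice_fixed:
  assumes "h \<in> lattice" "\<tau> z = z"
  shows "order_ge 0 (h z)"
  using latticeD(3)[OF assms(1), of z] latticeD(4)[OF assms(1), of z] assms(2)
  by (auto simp: order_ge_0_iff dest!: arg_cong[of _ _ "\<lambda>x. x $$ (-1)"])

lemma small_fixed:
  assumes "h \<in> small" "\<tau> z = z"
  shows "order_ge 2 (h z)"
proof -
  have "h z = flip (h z)" "order_ge 1 (h z)"
    using assms latticeD(3)[of h z] by (auto simp: small_def)
  moreover have "flip (h z) $$ 1 = - h z $$ 1" by (simp add: flip_nth)
  ultimately have "h z $$ 1 = - h z $$ 1" by metis
  then have "h z $$ 1 = 0" by simp
  then show ?thesis using order_ge_Suc[of 1 "h z"] \<open>order_ge 1 (h z)\<close> by simp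
qed

lemma ladder_tau:
  assumes "\<And>z. h (\<tau> z) = flip (h z)"
  shows "ladder s p h (\<tau> z) = flip (ladder s p h z)"
proof -
  let ?t = "\<lambda>q. flip (coef s p q (move (- s) p q z) * h (move (- s) p q z))"
  have "ladder s p h (\<tau> z) = (\<Sum>q=1..p. ?t (perm p q))"
    unfolding ladder_def by (intro sum.cong refl) (simp add: move_tau coef_tau assms)
  also have "\<dots> = (\<Sum>q=1..p. ?t q)" by (rule sum_row_perm)
  finally show ?thesis by (simp add: ladder_def)
qed

text \<open>The pole of a ladder coefficient occurs only at fixed tableaux, where parity provides one
additional order of vanishing.\<close>

lemma coef_times_order:
  assumes p: "1 \<le> p" "p \<le> n - 1" "q \<in> {1..p}"
    and "order_ge d (h z)" "\<tau> z = z \<Longrightarrow> order_ge (d + 1) (h z)"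
  shows "order_ge d (coef s p q z * h z)"
proof (cases "sing p q z")
  case True
  then show ?thesis using coef_leading(1)[OF p, of z s] assms(5)
    by (intro order_ge_mult_eq[of "-1" _ "d + 1"]) (auto simp: sing_def)
next
  case False
  then show ?thesis using coef_leading(1)[OF p, of z s] assms(4)
    by (intro order_ge_mult_eq[of 0 _ d]) auto
qed

lemma ladder_lattice:
  assumes p: "1 \<le> p" "p \<le> n - 1" and h: "h \<in> lattice"
  shows "ladder s p h \<in> lattice"
proof (rule latticeI)
  let ?S = "\<Union>q\<in>{1..p}. move s p q ` {z. h z \<noteq> 0}"
  show "finite ?S" using latticeD(1)[OF h] by auto
  fix z
  {
    assume "ladder s p h z \<noteq> 0"
    then obtain q where q: "q \<in> {1..p}" "h (move (- s) p q z) \<noteq> 0"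
      unfolding ladder_def by (metis (no_types, lifting) mult_zero_right sum.neutral)
    then show "z \<in> ?S"
      by (intro UN_I[of q] image_eqI[of _ _ "move (- s) p q z"]) auto
    show "z \<in> shifts n" using latticeD(2)[OF h q(2)] q(1) p(2) by simp
  }
  show "ladder s p h (\<tau> z) = flip (ladder s p h z)"
    by (rule ladder_tau) (rule latticeD(3)[OF h])
  show "order_ge (-1) (ladder s p h z)"
    unfolding ladder_def
    by (intro order_ge_sum coef_times_order p) (use latticeD(4)[OF h] lattice_fixed[OF h] in auto)
qed

lemma ladder_small:
  assumes p: "1 \<le> p" "p \<le> n - 1" and h: "h \<in> small"
  shows "ladder s p h \<in> small"
proof -
  have "order_ge 1 (ladder s p h z)" for z
    unfolding ladder_def
    by (intro order_ge_sum coef_times_order p) (use small_fixed[OF h] h in \<open>auto simp: small_def\<close>)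
  then show ?thesis using ladder_lattice[OF p] h by (auto simp: small_def)
qed

text \<open>The eigenvalue of \<open>E\<^sub>p\<^sub>p\<close> on \<open>T(v\<^sub>t + z)\<close>.\<close>

definition weight :: "nat \<Rightarrow> shift \<Rightarrow> complex fls" where
  "weight p z = (\<Sum>q=1..p. entry z p q + of_nat q - 1) - (\<Sum>q=1..p-1. entry z (p-1) q + of_nat q - 1)"

lemma row_order: "order_ge 0 (row_sum p z)" "order_ge 0 (row_square p z)"
  unfolding row_sum_def row_square_def power2_eq_square
  by (auto intro!: order_ge_sum entry_regular order_ge_mult_eq[of 0 _ 0])

text \<open>The elements of the lattice that correspond to \<open>T(vb + z)\<close> and \<open>DT(vb + z)\<close>. The former is twice
the indicator function if \<open>\<tau> z = z\<close>; the latter is then zero, in accordance with the relation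
\<open>DT(vb + z) = - DT(vb + \<tau> z)\<close>.\<close>

definition Tvec :: "shift \<Rightarrow> shift \<Rightarrow> complex fls" where
  "Tvec z y = (if y = z then 1 else 0) + (if y = \<tau> z then 1 else 0)"

definition Dvec :: "shift \<Rightarrow> shift \<Rightarrow> complex fls" where
  "Dvec z y = (if y = z then fls_const (1/2) * fls_X_inv else 0) - (if y = \<tau> z then fls_const (1/2) * fls_X_inv else 0)"

lemma flip_X_inv: "flip fls_X_inv = - fls_X_inv"
  by (simp add: fls_eq_iff flip_nth power_int_minus)

lemma order_X_inv [simp]: "order_ge (-1) fls_X_inv"
  by (simp add: order_ge_def)

lemma Dvec_tau: "Dvec (\<tau> z) y = - Dvec z y"
  by (simp add: Dvec_def)

lemma Tvec_lattice: "z \<in> shifts n \<Longrightarrow> Tvec z \<in> lattice"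
proof (rule latticeI[of "{z, \<tau> z}"])
  fix y
  show "Tvec z (\<tau> y) = flip (Tvec z y)" by (auto simp: Tvec_def) (metis tau_tau)+
  show "order_ge (-1) (Tvec z y)" by (auto simp: Tvec_def order_ge_def)
qed (auto simp: Tvec_def split: if_splits)

lemma Dvec_lattice: "z \<in> shifts n \<Longrightarrow> Dvec z \<in> lattice"
proof (rule latticeI[of "{z, \<tau> z}"])
  fix y
  show "Dvec z (\<tau> y) = flip (Dvec z y)" by (auto simp: Dvec_def flip_X_inv) (metis tau_tau)+
  show "order_ge (-1) (Dvec z y)" by (auto simp: Dvec_def order_ge_def)
qed (auto simp: Dvec_def split: if_splits)

end

text \<open>A submodule of the singular module, lifted to the lattice. Only complex scalars are
available: multiplication by \<open>t\<close> does not preserve the lattice.\<close>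

locale invariant_subspace = singular_tableau +
  fixes W :: "(shift \<Rightarrow> complex fls) set"
  assumes W_lattice: "W \<subseteq> lattice" and small_W: "small \<subseteq> W"
    and W_add: "g \<in> W \<Longrightarrow> h \<in> W \<Longrightarrow> (\<lambda>z. g z + h z) \<in> W"
    and W_scale: "h \<in> W \<Longrightarrow> (\<lambda>z. fls_const c * h z) \<in> W"
    and W_ladder: "h \<in> W \<Longrightarrow> 1 \<le> p \<Longrightarrow> p \<le> n - 1 \<Longrightarrow> s = 1 \<or> s = -1 \<Longrightarrow> ladder s p h \<in> W"
    and W_weight: "h \<in> W \<Longrightarrow> 1 \<le> p \<Longrightarrow> p \<le> n - 1 \<Longrightarrow> (\<lambda>z. weight p z * h z) \<in> W"
begin

lemma W_zero [simp]: "(\<lambda>z. 0) \<in> W"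
  using small_W by auto

lemma W_diff: "g \<in> W \<Longrightarrow> h \<in> W \<Longrightarrow> (\<lambda>z. g z - h z) \<in> W"
  using W_add[of g "\<lambda>z. fls_const (-1) * h z"] W_scale[of h "-1"]
  by (simp add: const_minus_one)

lemma W_small_cong:
  assumes "g \<in> W" "(\<lambda>z. h z - g z) \<in> small"
  shows "h \<in> W"
  using W_add[OF assms(1), of "\<lambda>z. h z - g z"] assms small_W by auto

definition preserves :: "(shift \<Rightarrow> complex fls) \<Rightarrow> bool" where
  "preserves D \<longleftrightarrow> (\<forall>h\<in>W. (\<lambda>z. D z * h z) \<in> W)"

lemma preserves_const: "preserves (\<lambda>z. fls_const c)"
  by (simp add: preserves_def W_scale)

lemma preserves_of_nat: "preserves (\<lambda>z. of_nat m)"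
  using preserves_const[of "of_nat m"] by (simp add: fls_of_nat)

lemma preserves_add: "preserves C \<Longrightarrow> preserves D \<Longrightarrow> preserves (\<lambda>z. C z + D z)"
  unfolding preserves_def distrib_right by (auto intro: W_add)

lemma preserves_diff: "preserves C \<Longrightarrow> preserves D \<Longrightarrow> preserves (\<lambda>z. C z - D z)"
  unfolding preserves_def left_diff_distrib by (auto intro: W_diff)

lemma preserves_mult: "preserves C \<Longrightarrow> preserves D \<Longrightarrow> preserves (\<lambda>z. C z * D z)"
  unfolding preserves_def mult.assoc by auto

lemma preserves_row_sum: "p \<le> n - 1 \<Longrightarrow> preserves (row_sum p)"
proof (induction p)
  case 0
  then show ?case using preserves_of_nat[of 0] by (simp add: row_sum_def[abs_def])
next
  case (Suc p)
  have eq: "row_sum (Suc p) = (\<lambda>z. weight (Suc p) z + row_sum p z - of_nat p)"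
  proof
    fix z
    show "row_sum (Suc p) z = weight (Suc p) z + row_sum p z - of_nat p"
      by (simp add: weight_def row_sum_def sum.distrib sum_subtractf)
  qed
  show ?case unfolding eq
    by (intro preserves_add preserves_diff preserves_of_nat Suc.IH)
       (use Suc.prems W_weight in \<open>auto simp: preserves_def\<close>)
qed

text \<open>Since \<open>W\<close> is stable under the ladder operators of row \<open>m\<close>, it is stable under their combination in
\<open>quadratic_recursion\<close>, from which the square sum of row \<open>m + 1\<close> can be isolated: all other
quantities in it belong to rows \<open>m - 1\<close> and \<open>m\<close> or are row sums.\<close>

lemma preserves_row_square: "p \<le> n - 1 \<Longrightarrow> preserves (row_square p)"
proof (induction p rule: less_induct)
  case (less p)
  show ?case
  proof (cases "p \<le> 1")
    case True
    then have "p = 0 \<or> p = 1" by linarith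
    then have "row_square p = (\<lambda>z. row_sum p z * row_sum p z)"
      by (auto simp: row_square_def row_sum_def power2_eq_square fun_eq_iff)
    then show ?thesis using preserves_mult preserves_row_sum less.prems by metis
  next
    case False
    define m where "m = p - 1"
    have p: "p = m + 1" "1 \<le> m" "m < n" "m \<le> n - 1" "m - 1 \<le> n - 1" using False less.prems by (auto simp: m_def)
    have IH: "preserves (row_square m)" "preserves (row_square (m - 1))"
      using less.IH p less.prems by auto
    let ?D = "row_square m"
    define r where "r = (\<lambda>z. 2 * row_sum m z - row_sum (m+1) z - row_sum (m-1) z - 1)"
    define C where "C = (\<lambda>z. ?D z * r z - (r z * r z + r z + 2 * ?D z - 2 * row_sum m z + of_nat m
            - row_square (m-1) z + 2 * row_sum (m-1) z - of_nat (m-1)))"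
    have two: "preserves (\<lambda>z. 2)" and one: "preserves (\<lambda>z. 1)"
      using preserves_of_nat[of 2] preserves_of_nat[of 1] by auto
    have rs: "preserves (row_sum m)" "preserves (row_sum (m+1))" "preserves (row_sum (m-1))"
      using preserves_row_sum p less.prems by auto
    have "preserves r" unfolding r_def
      by (intro preserves_diff preserves_mult two one rs)
    then have C: "preserves C" unfolding C_def
      by (intro preserves_diff preserves_add preserves_mult two rs IH preserves_of_nat)
    show ?thesis
      unfolding preserves_def
    proof
      fix h assume h: "h \<in> W"
      define Y where "Y = (\<lambda>z. ladder (-1) m (\<lambda>y. ?D y * ladder 1 m h y) z + ladder 1 m (\<lambda>y. ?D y * ladder (-1) m h y) z
       - ?D z * ladder (-1) m (ladder 1 m h) z - ladder (-1) m (ladder 1 m (\<lambda>y. ?D y * h y)) z)"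
      have D: "(\<lambda>y. ?D y * g y) \<in> W" if "g \<in> W" for g using IH(1) that by (simp add: preserves_def)
      have lad: "ladder 1 m g \<in> W" "ladder (-1) m g \<in> W" if "g \<in> W" for g
        using W_ladder[OF that p(2,4)] by auto
      have "Y \<in> W" unfolding Y_def
        by (intro W_diff W_add lad D h)
      moreover have "Y z = (C z + row_square p z) * h z" for z
      proof -
        have "line m q - line m u \<notin> \<int>" if "q \<in> {1..m}" "u \<in> {1..m}" "q \<noteq> u" for q u
          using line_not_int[OF p(4) that] .
        then have "Y z = (?D z * r z - ((r z)\<^sup>2 + r z + 2 * ?D z - 2 * row_sum m z + of_nat m - row_square (m+1) z
            - row_square (m-1) z + 2 * row_sum (m-1) z - of_nat (m-1))) * h z"
          unfolding Y_def r_def by (rule quadratic_recursion[OF p(2,3)])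
        then show ?thesis unfolding C_def p(1) by (simp add: power2_eq_square algebra_simps)
      qed
      moreover have "(\<lambda>z. C z * h z) \<in> W" using C h by (simp add: preserves_def)
      ultimately have "(\<lambda>z. Y z - C z * h z) \<in> W" by (intro W_diff)
      moreover have "Y z - C z * h z = row_square p z * h z" for z
        using \<open>Y z = (C z + row_square p z) * h z\<close> by (simp add: algebra_simps)
      ultimately show "(\<lambda>z. row_square p z * h z) \<in> W" by simp
    qed
  qed
qed

end

section \<open>Separating tableaux by the squares of a row\<close>

context invariant_subspace
begin

text \<open>On the part of \<open>h\<close> where \<open>D\<close> has constant term \<open>b\<close>, the square of \<open>D - b\<close> maps into \<open>t\<^sup>2 L\<close>, so this
part is a generalized eigenspace modulo \<open>t\<^sup>2 L\<close>. Applying \<open>(D - b)\<^sup>2\<close> therefore removes the value \<open>b\<close>;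
on the part with value \<open>c\<close> it is inverted modulo \<open>t\<^sup>2 L\<close> by a linear polynomial in \<open>D\<close>.\<close>

lemma W_restrict_eigen:
  assumes D: "preserves D" "\<And>z. D (\<tau> z) = flip (D z)" "\<And>z. order_ge 0 (D z)"
    and h: "h \<in> W"
  shows "(\<lambda>z. if D z $$ 0 = c then h z else 0) \<in> W"
  using h
proof (induction "card ((\<lambda>z. D z $$ 0) ` {z. h z \<noteq> 0} - {c})" arbitrary: h rule: less_induct)
  case less
  let ?V = "\<lambda>h. (\<lambda>z. D z $$ 0) ` {z. h z \<noteq> 0} - {c}"
  have hl: "h \<in> lattice" using less.prems W_lattice by auto
  have finV: "finite (?V h)" using latticeD(1)[OF hl] by auto
  have sym: "{z. P (D z $$ 0)} = {z. P (D (\<tau> z) $$ 0)}" for P by (simp add: D(2))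
  have restr: "(\<lambda>z. if P (D z $$ 0) then g z else 0) \<in> lattice" if "g \<in> lattice" for g P
    using lattice_restrict[OF that, of "{z. P (D z $$ 0)}"] by (simp add: D(2))
  have lin: "preserves (\<lambda>z. D z - fls_const b)" for b
    by (intro preserves_diff D preserves_const)
  have lin_order: "order_ge 1 (D z - fls_const b)" if "D z $$ 0 = b" for z b
    unfolding order_ge_1_iff using D(3) that by (auto intro: order_ge_diff)
  show ?case
  proof (cases "?V h = {}")
    case True
    then have "(\<lambda>z. if D z $$ 0 = c then h z else 0) = h" by fastforce
    then show ?thesis using less.prems by simp
  next
    case False
    then obtain b where b: "b \<in> ?V h" by blast
    define e where "e = c - b"
    have e: "e \<noteq> 0" using b by (auto simp: e_def)
    define g where "g = (\<lambda>z. (D z - fls_const b) * ((D z - fls_const b) * h z))"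
    define g1 where "g1 = (\<lambda>z. if D z $$ 0 \<noteq> b then g z else 0)"
    define g2 where "g2 = (\<lambda>z. if D z $$ 0 = c then g1 z else 0)"
    have gW: "g \<in> W" using lin[of b] less.prems by (simp add: preserves_def g_def)
    then have gl: "g \<in> lattice" using W_lattice by auto
    have "(\<lambda>z. g1 z - g z) \<in> small"
    proof -
      have "order_ge 1 (g1 z - g z)" for z
      proof (cases "D z $$ 0 = b")
        case True
        then have "order_ge (1 + (1 + -1)) (g z)"
          unfolding g_def by (intro order_ge_mult lin_order latticeD(4)[OF hl])
        then show ?thesis using True by (simp add: g1_def)
      qed (simp add: g1_def)
      moreover have "(\<lambda>z. g1 z - g z) \<in> lattice"
        unfolding g1_def by (intro lattice_diff restr gl)
      ultimately show ?thesis by (simp add: small_def)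
    qed
    then have "g1 \<in> W" by (rule W_small_cong[OF gW])
    moreover have "card (?V g1) < card (?V h)"
    proof (rule psubset_card_mono[OF finV])
      have "b \<notin> ?V g1" by (auto simp: g1_def split: if_splits)
      moreover have "?V g1 \<subseteq> ?V h" by (auto simp: g1_def g_def split: if_splits)
      ultimately show "?V g1 \<subset> ?V h" using b by blast
    qed
    ultimately have g2W: "g2 \<in> W" unfolding g2_def by (intro less.hyps)
    \<comment> \<open>Truncated inverse of \<open>(e + \<epsilon>)\<^sup>2\<close>, where \<open>\<epsilon> = D - c\<close> has positive order and \<open>e = c - b\<close>.\<close>
    define f where "f = (\<lambda>z. (fls_const (inverse (e^2)) - fls_const (2 * inverse (e^3)) * (D z - fls_const c)) * g2 z)"
    have "preserves (\<lambda>z. fls_const (inverse (e^2)) - fls_const (2 * inverse (e^3)) * (D z - fls_const c))"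
      by (intro preserves_diff[of "\<lambda>_. fls_const (inverse (e^2))"] preserves_mult preserves_const lin)
    then have fW: "f \<in> W" using g2W by (simp add: preserves_def f_def)
    let ?r = "\<lambda>z. if D z $$ 0 = c then h z else 0"
    have "order_ge 1 (?r z - f z)" for z
    proof (cases "D z $$ 0 = c")
      case True
      define \<epsilon> where "\<epsilon> = D z - fls_const c"
      define E where "E = fls_const e"
      have E: "E \<noteq> 0" using e by (simp add: E_def)
      have Db: "D z - fls_const b = E + \<epsilon>" by (simp add: E_def \<epsilon>_def e_def fls_eq_iff)
      have ci: "fls_const (inverse (e^2)) = inverse (E^2)" "fls_const (2 * inverse (e^3)) = 2 * inverse (E^3)"
        by (simp_all add: E_def fls_const_power fls_inverse_const[symmetric] fls_const_mult_const[symmetric] del: fls_const_mult_const)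
      have "c \<noteq> b" using e by (simp add: e_def)
      then have "?r z - f z = (1 - (inverse (E^2) - 2 * inverse (E^3) * \<epsilon>) * ((E + \<epsilon>) * (E + \<epsilon>))) * h z"
        using True unfolding f_def g2_def g1_def g_def by (simp add: Db ci \<epsilon>_def[symmetric] algebra_simps)
      also have "1 - (inverse (E^2) - 2 * inverse (E^3) * \<epsilon>) * ((E + \<epsilon>) * (E + \<epsilon>))
          = (\<epsilon> * \<epsilon>) * (3 * inverse (E^2) + 2 * inverse (E^3) * \<epsilon>)"
        using E by (simp add: field_simps power2_eq_square power3_eq_cube)
      also have "\<dots> = (\<epsilon> * \<epsilon>) * (fls_const (3 * inverse (e^2)) + fls_const (2 * inverse (e^3)) * \<epsilon>)"
        by (simp add: E_def fls_const_power fls_inverse_const[symmetric] fls_const_mult_const[symmetric] del: fls_const_mult_const)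
      finally have eq: "?r z - f z = (\<epsilon> * \<epsilon>) * (fls_const (3 * inverse (e^2)) + fls_const (2 * inverse (e^3)) * \<epsilon>) * h z" .
      have \<epsilon>: "order_ge 1 \<epsilon>" unfolding \<epsilon>_def by (rule lin_order) (rule True)
      then have "order_ge ((1 + 1) + 0 + -1) ((\<epsilon> * \<epsilon>) * (fls_const (3 * inverse (e^2)) + fls_const (2 * inverse (e^3)) * \<epsilon>) * h z)"
        by (intro order_ge_mult order_ge_add latticeD(4)[OF hl] order_ge_mult_eq[of 0 _ 0])
           (auto intro: order_ge_mono)
      then show ?thesis unfolding eq by simp
    qed (simp add: f_def g2_def)
    moreover have "(\<lambda>z. ?r z - f z) \<in> lattice"
      using fW W_lattice by (intro lattice_diff restr hl) auto
    ultimately have "(\<lambda>z. ?r z - f z) \<in> small" by (simp add: small_def)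
    then show ?thesis by (rule W_small_cong[OF fW])
  qed
qed

lemma W_restrict_row:
  assumes "h \<in> W" "p \<le> n - 1"
  shows "(\<lambda>z. if row_square p z $$ 0 = c then h z else 0) \<in> W"
  by (rule W_restrict_eigen[OF preserves_row_square row_square_tau row_order(2)]) (use assms in auto)

lemma row_square_0_move:
  assumes "p \<le> n - 1" "q \<in> {1..p}"
  shows "row_square p (move s p q z) $$ 0 = row_square p z $$ 0 + (2 * of_int s * (entry z p q $$ 0) + (of_int s)\<^sup>2)"
proof -
  have pn: "p < n" using assms ij by auto
  have "(2 * of_int s * entry z p q :: complex fls) = fls_const (2 * of_int s) * entry z p q"
    by (simp add: fls_of_int fls_const_mult_const[symmetric] del: fls_const_mult_const)
  moreover have "((of_int s)\<^sup>2 :: complex fls) = fls_const ((of_int s)\<^sup>2)"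
    by (simp add: fls_of_int fls_const_power)
  ultimately have "row_square p (move s p q z)
      = row_square p z + (fls_const (2 * of_int s) * entry z p q + fls_const ((of_int s)\<^sup>2))"
    using row_square_move[OF pn assms(2), of s z] by (simp only:)
  then show ?thesis by simp
qed

text \<open>Entries in different columns of one row, even of two different tableaux, are never equal at
\<open>t = 0\<close>, apart from the columns \<open>i\<close> and \<open>j\<close> of row \<open>k\<close>. So an entry determines its column up to this pair.\<close>

lemma entry_0_eqD:
  assumes p: "p \<le> n - 1" "q \<in> {1..p}" "u \<in> {1..p}" and eq: "entry z p u $$ 0 = entry z' p q $$ 0"
  shows "u = q \<or> u = perm p q" "z p u = z' p q"
proof -
  have pn: "p \<noteq> n" using p ij by auto
  show u: "u = q \<or> u = perm p q"
  proof (rule disjCI)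
    assume "u \<noteq> perm p q"
    then have "u \<noteq> q \<Longrightarrow> \<not> (p = k \<and> {u, q} = {i, j})"
      using ij by (auto simp: doubleton_eq_iff perm_def)
    then show "u = q" using entry_diff_row_not_int[OF p(1,3,2), of z z'] eq by auto
  qed
  have "vb p (perm p q) = vb p q"
    by (auto simp: perm_def Transposition.transpose_def singular)
  then show "z p u = z' p q" using u eq pn by (auto simp: entry_0 ext_def)
qed

text \<open>One step of the entry \<open>(p,q)\<close>, cut down to the tableaux whose row \<open>p\<close> has the square sum of
\<open>z0 + s \<delta>\<^sup>p\<^sup>q\<close>.\<close>

definition projected_ladder where
  "projected_ladder s p q z0 h =
     (\<lambda>y. if row_square p y $$ 0 = row_square p (move s p q z0) $$ 0 then ladder s p h y else 0)"

lemma projected_ladder_W: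
  assumes "h \<in> W" "1 \<le> p" "p \<le> n - 1" "s = 1 \<or> s = -1"
  shows "projected_ladder s p q z0 h \<in> W"
  unfolding projected_ladder_def using W_ladder W_restrict_row assms by blast

context
  fixes s :: int and p q :: nat and z0 :: shift and h :: "shift \<Rightarrow> complex fls"
  assumes s: "s = 1 \<or> s = -1" and p: "1 \<le> p" "p \<le> n - 1" and q: "q \<in> {1..p}"
    and same: "\<And>z. h z \<noteq> 0 \<Longrightarrow> row_square p z $$ 0 = row_square p z0 $$ 0"
begin

text \<open>Moving an entry \<open>w\<close> of row \<open>p\<close> by \<open>s\<close> changes the square sum of the row by \<open>2 s w + 1\<close>. As \<open>h\<close> is
supported where the square sum equals that of \<open>z0\<close>, the projection retains only the moves of an
entry with the value that \<open>z0\<close> has at \<open>(p,q)\<close>.\<close>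

lemma projected_source:
  assumes "row_square p y $$ 0 = row_square p (move s p q z0) $$ 0" "u \<in> {1..p}"
    "h (move (- s) p u y) \<noteq> 0"
  shows "u = q \<or> u = perm p q" "move (- s) p u y p u = z0 p q"
proof -
  define z where "z = move (- s) p u y"
  have "row_square p y $$ 0 = row_square p z $$ 0 + (2 * of_int s * (entry z p u $$ 0) + (of_int s)\<^sup>2)"
    using row_square_0_move[OF p(2) assms(2), of s z] by (simp add: z_def)
  moreover have "row_square p z $$ 0 = row_square p z0 $$ 0"
    using same assms(3) by (simp add: z_def)
  ultimately have "2 * of_int s * (entry z p u $$ 0) = 2 * of_int s * (entry z0 p q $$ 0)"
    using assms(1) unfolding row_square_0_move[OF p(2) q] by auto
  then have "entry z p u $$ 0 = entry z0 p q $$ 0" using s by auto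
  then show "u = q \<or> u = perm p q" "move (- s) p u y p u = z0 p q"
    using entry_0_eqD[OF p(2) q assms(2)] unfolding z_def by blast+
qed

lemma projected_support:
  assumes "projected_ladder s p q z0 h y \<noteq> 0"
  shows "\<exists>z u. h z \<noteq> 0 \<and> (u = q \<or> u = perm p q) \<and> y = move s p u z \<and> z p u = z0 p q"
proof -
  have y: "row_square p y $$ 0 = row_square p (move s p q z0) $$ 0" "ladder s p h y \<noteq> 0"
    using assms by (auto simp: projected_ladder_def split: if_splits)
  then obtain u where u: "u \<in> {1..p}" "h (move (- s) p u y) \<noteq> 0"
    unfolding ladder_def by (metis (no_types, lifting) mult_zero_right sum.neutral)
  then show ?thesis
    using projected_source[OF y(1) u] by (intro exI[of _ "move (- s) p u y"] exI[of _ u]) auto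
qed

lemma projected_support_single:
  assumes supp: "\<And>z. h z \<noteq> 0 \<Longrightarrow> z = z0 \<or> z = \<tau> z0" and "projected_ladder s p q z0 h y \<noteq> 0"
  shows "y = move s p q z0 \<or> y = \<tau> (move s p q z0)"
proof -
  obtain z u where z: "h z \<noteq> 0" "u = q \<or> u = perm p q" "y = move s p u z" "z p u = z0 p q"
    using projected_support[OF assms(2)] by blast
  have fixed: "\<tau> z0 = z0" if "z0 p (perm p q) = z0 p q" "perm p q \<noteq> q"
    using that by (auto simp: tau_eq_iff perm_def Transposition.transpose_def split: if_splits)
  from supp[OF z(1)] show ?thesis
  proof
    assume "z = z0"
    then show ?thesis using z fixed move_tau[of s p "perm p q" z0] by force
  next
    assume "z = \<tau> z0"
    then show ?thesis using z fixed move_tau[of s p u z0] by (auto simp: tau_apply) (metis move_tau)+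
  qed
qed

text \<open>The tableau \<open>z0 + s \<delta>\<^sup>p\<^sup>q\<close> can also be reached from \<open>\<tau> z0\<close>, namely when the step makes the two
entries of the singular pair equal; the second contribution is then the mirror image of the
first and doubles its constant term. If \<open>z0\<close> itself is fixed there is no second contribution, and
the pole survives.\<close>

lemma projected_value:
  assumes hl: "h \<in> lattice"
  defines "y \<equiv> move s p q z0" and "c \<equiv> coef s p q z0 * h z0"
  shows "projected_ladder s p q z0 h y = c \<or> projected_ladder s p q z0 h y = c + flip c"
    "\<tau> z0 = z0 \<or> \<tau> y \<noteq> y \<Longrightarrow> projected_ladder s p q z0 h y = c"
proof -
  let ?t = "\<lambda>u. coef s p u (move (- s) p u y) * h (move (- s) p u y)"
  have tq: "?t q = c" by (simp add: y_def c_def)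
  have zero: "?t u = 0" if "u \<in> {1..p}" "u \<noteq> q" "u \<noteq> perm p q" for u
    using projected_source[of y u] that by (auto simp: y_def)
  have "(\<Sum>u=1..p. ?t u) = (\<Sum>u\<in>{q, perm p q}. ?t u)"
  proof (rule sum.mono_neutral_right)
    show "{q, perm p q} \<subseteq> {1..p}" using q perm_in[of p q] by blast
  qed (use zero in auto)
  then have val: "projected_ladder s p q z0 h y = (\<Sum>u\<in>{q, perm p q}. ?t u)"
    by (simp add: projected_ladder_def ladder_def y_def)
  have other: "projected_ladder s p q z0 h y = c \<or>
      (projected_ladder s p q z0 h y = c + flip c \<and> \<tau> y = y \<and> \<tau> z0 \<noteq> z0)"
  proof (cases "perm p q = q")
    case True
    then show ?thesis using val tq by simp
  next
    case False
    define q' where "q' = perm p q"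
    have q': "q' \<noteq> q" "q' \<in> {1..p}" "perm p q' = q" using False q perm_in[of p q] unfolding q'_def by (blast, blast, simp)
    have val2: "projected_ladder s p q z0 h y = c + ?t q'"
      using val tq q' by (simp add: q'_def)
    show ?thesis
    proof (cases "h (move (- s) p q' y) = 0")
      case True
      then show ?thesis using val2 by simp
    next
      case h0: False
      have "move (- s) p q' y p q' = z0 p q"
        using projected_source(2)[of y q'] q' h0 by (simp add: y_def)
      then have eq: "z0 p q' - s = z0 p q"
        using q'(1) by (simp add: y_def move_apply)
      have pk: "p = k" "{q, q'} = {i, j}"
        using False by (auto simp: q'_def perm_def Transposition.transpose_def split: if_splits)
      have zt: "move (- s) p q' y = \<tau> z0"
      proof (intro ext)
        fix r t
        show "move (- s) p q' y r t = \<tau> z0 r t"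
          using eq pk q'(1) by (auto simp: y_def move_apply tau_apply perm_def Transposition.transpose_def doubleton_eq_iff)
      qed
      then have "?t q' = flip c"
        using q' latticeD(3)[OF hl, of z0] by (simp add: coef_tau c_def)
      moreover have "\<tau> y = y"
      proof -
        have "y = move s p q' (\<tau> z0)" using zt by (metis move_inverse(2))
        then show ?thesis by (simp add: move_tau q' y_def)
      qed
      moreover have "\<tau> z0 \<noteq> z0"
        using eq pk s by (auto simp: tau_eq_iff doubleton_eq_iff)
      ultimately show ?thesis using val2 by simp
    qed
  qed
  then show "projected_ladder s p q z0 h y = c \<or> projected_ladder s p q z0 h y = c + flip c"
    "\<tau> z0 = z0 \<or> \<tau> y \<noteq> y \<Longrightarrow> projected_ladder s p q z0 h y = c" by auto
qed

end

end

section \<open>Elements supported on few orbits\<close>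

lemma card_image_factor_le:
  assumes "finite M" "\<And>x y. x \<in> M \<Longrightarrow> y \<in> M \<Longrightarrow> f x = f y \<Longrightarrow> g x = g y"
  shows "card (g ` M) \<le> card (f ` M)"
proof -
  have "g ` M \<subseteq> (\<lambda>b. g (inv_into M f b)) ` (f ` M)"
  proof
    fix c assume "c \<in> g ` M"
    then obtain x where x: "x \<in> M" "c = g x" by blast
    then have "g (inv_into M f (f x)) = g x"
      using assms(2)[of "inv_into M f (f x)" x] by (simp add: inv_into_into f_inv_into_f)
    then show "c \<in> (\<lambda>b. g (inv_into M f b)) ` (f ` M)" using x by force
  qed
  then show ?thesis using assms(1) by (meson card_image_le card_mono finite_imageI le_trans)
qed

context invariant_subspace
begin

definition orb :: "shift \<Rightarrow> shift set" where "orb z = {z, \<tau> z}"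

definition orbits :: "(shift \<Rightarrow> complex fls) \<Rightarrow> shift set set" where
  "orbits h = orb ` {z. h z \<noteq> 0}"

text \<open>Orbits are counted instead of tableaux, because a step can merge the two members of
an orbit into one fixed tableau or split a fixed tableau into two.\<close>

definition minimal :: "(shift \<Rightarrow> complex fls) \<Rightarrow> bool" where
  "minimal h \<longleftrightarrow> h \<in> W \<and> h \<notin> small \<and> (\<forall>g\<in>W. g \<notin> small \<longrightarrow> card (orbits h) \<le> card (orbits g))"

lemma orb_tau [simp]: "orb (\<tau> z) = orb z"
  by (auto simp: orb_def)

lemma orb_eq_iff: "orb z = orb y \<longleftrightarrow> z = y \<or> z = \<tau> y"
  unfolding orb_def doubleton_eq_iff by (metis tau_tau)

lemma finite_orbits: "h \<in> W \<Longrightarrow> finite (orbits h)"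
  using latticeD(1)[of h] W_lattice by (auto simp: orbits_def)

lemma not_smallI: "h \<in> W \<Longrightarrow> \<not> order_ge 1 (h z) \<Longrightarrow> h \<notin> small"
  by (auto simp: small_def)

lemma not_smallD: "h \<in> W \<Longrightarrow> h \<notin> small \<Longrightarrow> \<exists>z. \<not> order_ge 1 (h z)"
  using W_lattice by (auto simp: small_def)

text \<open>Restricting to a \<open>\<tau>\<close>-invariant set that misses a tableau of the support lowers the number of orbits,
which minimality forbids as long as the restriction stays in \<open>W\<close> and outside \<open>t\<^sup>2 L\<close>.\<close>

lemma minimal_support_subset:
  assumes "minimal h" and S: "\<And>z. \<tau> z \<in> S \<longleftrightarrow> z \<in> S"
    and g: "(\<lambda>z. if z \<in> S then h z else 0) \<in> W" "z \<in> S" "\<not> order_ge 1 (h z)"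
    and y: "h y \<noteq> 0"
  shows "y \<in> S"
proof (rule ccontr)
  assume yS: "y \<notin> S"
  let ?g = "\<lambda>z. if z \<in> S then h z else 0"
  have "orbits ?g \<subseteq> orbits h" by (auto simp: orbits_def split: if_splits)
  moreover have "orb y \<notin> orbits ?g"
    using yS S by (auto simp: orbits_def orb_eq_iff split: if_splits)
  moreover have "orb y \<in> orbits h" using y by (auto simp: orbits_def)
  ultimately have "orbits ?g \<subset> orbits h" by blast
  then have "card (orbits ?g) < card (orbits h)"
    using assms(1) finite_orbits by (intro psubset_card_mono) (auto simp: minimal_def)
  moreover have "?g \<notin> small" using g by (intro not_smallI[of _ z]) auto
  ultimately show False using assms(1) g(1) by (auto simp: minimal_def)
qed

lemma minimal_row_square:
  assumes h: "minimal h" "h z \<noteq> 0" "h y \<noteq> 0" "p \<le> n - 1"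
  shows "row_square p z $$ 0 = row_square p y $$ 0"
proof -
  obtain x where x: "\<not> order_ge 1 (h x)" using h(1) not_smallD by (auto simp: minimal_def)
  let ?S = "{z. row_square p z $$ 0 = row_square p x $$ 0}"
  have "w \<in> ?S" if "h w \<noteq> 0" for w
  proof (rule minimal_support_subset[OF h(1) _ _ _ x that])
    show "(\<lambda>z. if z \<in> ?S then h z else 0) \<in> W"
      using W_restrict_row[of h p] h by (simp add: minimal_def)
  qed (simp_all add: row_square_tau)
  then show ?thesis using h(2,3) by simp
qed

text \<open>The square sum of row \<open>k\<close> is the quantity that detects the derivative tableaux: along the line it
has nonzero derivative at every tableau with \<open>\<tau> z \<noteq> z\<close>.\<close>

lemma row_square_k_1: "row_square k z $$ 1 = 2 * of_int (z k i - z k j)"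
proof -
  have kn: "k \<noteq> n" using ij by auto
  have e1: "entry z k q $$ 1 = (if q = i then 1 else if q = j then -1 else 0)" for q
    using kn ij by (auto simp: entry_def line_def fls_of_int)
  have sq: "((x :: complex fls)\<^sup>2) $$ 1 = 2 * x $$ 0 * x $$ 1" if "order_ge 0 x" for x
  proof -
    let ?y = "x - fls_const (x $$ 0)"
    have y: "order_ge 1 ?y" using that by (simp add: order_ge_1_iff order_ge_diff)
    have "x\<^sup>2 = ?y * ?y + fls_const (2 * x $$ 0) * ?y + fls_const ((x $$ 0)\<^sup>2)"
    proof -
      have "x = ?y + fls_const (x $$ 0)" by simp
      then have "x\<^sup>2 = (?y + fls_const (x $$ 0))\<^sup>2" by metis
      also have "\<dots> = ?y * ?y + (2 * fls_const (x $$ 0)) * ?y + fls_const (x $$ 0) * fls_const (x $$ 0)"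
        by (simp only: power2_eq_square distrib_left distrib_right mult_2) (simp only: ac_simps)
      finally show ?thesis
        by (simp add: power2_eq_square fls_const_mult_const[symmetric] del: fls_const_mult_const)
    qed
    moreover have "(?y * ?y) $$ 1 = 0"
      using order_ge_mult[OF y y] by (auto simp: order_ge_def)
    ultimately show ?thesis by simp
  qed
  have nth_sum: "sum f A $$ m = (\<Sum>q\<in>A. f q $$ m)" for f :: "nat \<Rightarrow> complex fls" and A m
    by (induction A rule: infinite_finite_induct) auto
  have "row_square k z $$ 1 = (\<Sum>q=1..k. 2 * (entry z k q $$ 0) * (entry z k q $$ 1))"
    unfolding row_square_def by (simp add: nth_sum sq entry_regular)
  also have "\<dots> = (\<Sum>q\<in>{i,j}. 2 * (entry z k q $$ 0) * (entry z k q $$ 1))"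
    using ij by (intro sum.mono_neutral_right) (auto simp: e1)
  also have "\<dots> = 2 * of_int (z k i - z k j)"
    using ij kn by (simp add: e1 entry_0 ext_def singular algebra_simps)
  finally show ?thesis .
qed

text \<open>Modulo \<open>t\<^sup>2 L\<close>, the operator \<open>Q\<^sub>k - c\<close> is nilpotent on the generalized eigenspace for \<open>c\<close>: it kills the
tableaux and maps a derivative tableau to a nonzero multiple of the corresponding tableau.\<close>

lemma nilpotent_part:
  assumes h: "h \<in> W" and same: "\<forall>z. h z \<noteq> 0 \<longrightarrow> row_square k z $$ 0 = c"
  defines "g \<equiv> \<lambda>z. (row_square k z - fls_const c) * h z"
  shows "g \<in> W" "order_ge 0 (g z)" "h z $$ (-1) \<noteq> 0 \<Longrightarrow> g z $$ 0 \<noteq> 0"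
proof -
  have hl: "h \<in> lattice" using h W_lattice by auto
  have "preserves (\<lambda>z. row_square k z - fls_const c)"
    using preserves_row_square ij by (intro preserves_diff preserves_const) auto
  then show "g \<in> W" using h by (simp add: preserves_def g_def)
  have o: "order_ge 1 (row_square k z - fls_const c)" if "h z \<noteq> 0" for z
    unfolding order_ge_1_iff using row_order(2)[of k z] same that by (simp add: order_ge_diff)
  show "order_ge 0 (g z)"
  proof (cases "h z = 0")
    case False
    then show ?thesis unfolding g_def
      by (intro order_ge_mult_eq[OF o latticeD(4)[OF hl]]) auto
  qed (simp add: g_def)
  assume h1: "h z $$ (-1) \<noteq> 0"
  then have hz: "h z \<noteq> 0" by auto
  have "\<tau> z \<noteq> z" using lattice_fixed[OF hl, of z] h1 by (auto simp: order_ge_0_iff)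
  then have "z k i - z k j \<noteq> 0" by (simp add: tau_eq_iff)
  then have "(row_square k z - fls_const c) $$ 1 \<noteq> 0"
    by (simp add: row_square_k_1 del: of_int_diff)
  moreover have "g z $$ 0 = (row_square k z - fls_const c) $$ 1 * h z $$ (-1)"
    unfolding g_def by (rule leading_mult[OF o[OF hz] latticeD(4)[OF hl]]) simp
  ultimately show "g z $$ 0 \<noteq> 0" using h1 by simp
qed

text \<open>Among the elements with minimal support there is one without poles: if poles occur,
\<open>nilpotent_part\<close> turns them into constant terms without enlarging the support.\<close>

lemma exists_minimal:
  assumes "h \<in> W" "h \<notin> small"
  obtains g where "minimal g" "\<And>z. g z \<noteq> 0 \<Longrightarrow> order_ge 0 (g z) \<and> g z $$ 0 \<noteq> 0"
proof -
  obtain h1 where h1: "minimal h1"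
    using ex_has_least_nat[of "\<lambda>g. g \<in> W \<and> g \<notin> small" h "\<lambda>g. card (orbits g)"] assms
    unfolding minimal_def by blast
  obtain h2 where h2: "minimal h2" "\<And>z. order_ge 0 (h2 z)"
  proof (cases "\<forall>z. order_ge 0 (h1 z)")
    case True
    then show ?thesis using that h1 by blast
  next
    case False
    have h1W: "h1 \<in> W" using h1 by (simp add: minimal_def)
    have "\<exists>z. h1 z $$ (-1) \<noteq> 0"
      using False latticeD(4)[of h1] W_lattice h1W by (auto simp: order_ge_0_iff)
    then obtain x where x: "h1 x $$ (-1) \<noteq> 0" by blast
    let ?c = "row_square k x $$ 0"
    have hx: "h1 x \<noteq> 0" using x by auto
    define g where "g = (\<lambda>z. (row_square k z - fls_const ?c) * h1 z)"
    have "\<forall>z. h1 z \<noteq> 0 \<longrightarrow> row_square k z $$ 0 = ?c"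
      using minimal_row_square[OF h1 _ hx] ij by simp
    note np = nilpotent_part[OF h1W this, folded g_def]
    have "g \<notin> small"
    proof (rule not_smallI[OF np(1), of x])
      have "g x $$ 0 \<noteq> 0" unfolding g_def by (rule np(3)[OF x])
      then show "\<not> order_ge 1 (g x)" by (simp add: order_ge_1_iff)
    qed
    moreover have "card (orbits g) \<le> card (orbits h1)"
      by (rule card_mono[OF finite_orbits[OF h1W]]) (auto simp: orbits_def g_def)
    ultimately have "minimal g" using np(1) h1 unfolding minimal_def by (meson le_trans)
    then show ?thesis by (rule that) (unfold g_def, rule np(2))
  qed
  obtain x where x: "\<not> order_ge 1 (h2 x)" using h2(1) not_smallD by (auto simp: minimal_def)
  let ?S = "{z. h2 z $$ 0 \<noteq> 0}"
  have h2W: "h2 \<in> W" and hl: "h2 \<in> lattice" using h2(1) W_lattice by (auto simp: minimal_def)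
  have tau: "\<tau> z \<in> ?S \<longleftrightarrow> z \<in> ?S" for z using latticeD(3)[OF hl, of z] by simp
  have "y \<in> ?S" if "h2 y \<noteq> 0" for y
  proof (rule minimal_support_subset[OF h2(1) tau _ _ x that])
    show "x \<in> ?S" using x h2(2)[of x] by (simp add: order_ge_1_iff)
    have "(\<lambda>z. (if z \<in> ?S then h2 z else 0) - h2 z) \<in> small"
      using lattice_diff[OF lattice_restrict[OF hl tau] hl] h2(2) by (auto simp: small_def order_ge_1_iff)
    then show "(\<lambda>z. if z \<in> ?S then h2 z else 0) \<in> W" by (rule W_small_cong[OF h2W])
  qed
  then show ?thesis using that h2 by blast
qed

lemma Tvec_in_W:
  assumes h: "h \<in> W" and supp: "\<And>y. h y \<noteq> 0 \<Longrightarrow> y = z \<or> y = \<tau> z"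
    and o: "order_ge 0 (h z)" "h z $$ 0 \<noteq> 0"
  shows "Tvec z \<in> W"
proof -
  have hl: "h \<in> lattice" using h W_lattice by auto
  have zs: "z \<in> shifts n" using latticeD(2)[OF hl, of z] o by (metis fls_zero_nth)
  define b where "b = Tvec z z $$ 0 / h z $$ 0"
  have "order_ge 1 (Tvec z y - fls_const b * h y)" for y
  proof -
    have z: "order_ge 1 (Tvec z z - fls_const b * h z)"
      using o by (auto simp: order_ge_1_iff b_def Tvec_def order_ge_def)
    have eq: "Tvec z (\<tau> z) - fls_const b * h (\<tau> z) = flip (Tvec z z - fls_const b * h z)"
      using latticeD(3)[OF hl, of z] latticeD(3)[OF Tvec_lattice[OF zs], of z] by simp
    have "order_ge 1 (Tvec z (\<tau> z) - fls_const b * h (\<tau> z))"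
      unfolding eq flip_order_ge by (rule z)
    then show ?thesis using z supp[of y]
      by (cases "y = z \<or> y = \<tau> z"; cases "h y = 0") (auto simp: Tvec_def)
  qed
  then have "(\<lambda>y. Tvec z y - fls_const b * h y) \<in> small"
    using lattice_diff[OF Tvec_lattice[OF zs] lattice_scale[OF hl]] by (auto simp: small_def)
  then show ?thesis using W_small_cong[OF W_scale[OF h]] by blast
qed

text \<open>A pole at a single orbit gives the tableau by \<open>nilpotent_part\<close>; subtracting a multiple of it
leaves the derivative tableau.\<close>

lemma Dvec_in_W:
  assumes h: "h \<in> W" and supp: "\<And>y. h y \<noteq> 0 \<Longrightarrow> y = z \<or> y = \<tau> z"
    and o: "h z $$ (-1) \<noteq> 0"
  shows "Tvec z \<in> W" "Dvec z \<in> W"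
proof -
  have hl: "h \<in> lattice" using h W_lattice by auto
  have zs: "z \<in> shifts n" using latticeD(2)[OF hl, of z] o by (metis fls_zero_nth)
  have zt: "\<tau> z \<noteq> z" using lattice_fixed[OF hl, of z] o by (auto simp: order_ge_0_iff)
  define g where "g = (\<lambda>y. (row_square k y - fls_const (row_square k z $$ 0)) * h y)"
  have "\<forall>y. h y \<noteq> 0 \<longrightarrow> row_square k y $$ 0 = row_square k z $$ 0"
    using supp by (metis row_square_tau flip_nth_simps(1))
  note np = nilpotent_part[OF h this, folded g_def]
  show T: "Tvec z \<in> W"
  proof (rule Tvec_in_W[OF np(1)])
    show "g z $$ 0 \<noteq> 0" unfolding g_def by (rule np(3)[OF o])
    show "order_ge 0 (g z)" unfolding g_def by (rule np(2))
    show "y = z \<or> y = \<tau> z" if "g y \<noteq> 0" for y using that supp by (auto simp: g_def)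
  qed
  \<comment> \<open>The coefficients that match \<open>Dvec z\<close> in orders \<open>-1\<close> and \<open>0\<close>.\<close>
  define b where "b = 1 / (2 * h z $$ (-1))"
  define d where "d = - b * h z $$ 0"
  let ?f = "\<lambda>y. fls_const b * h y + fls_const d * Tvec z y"
  have f: "?f \<in> W" by (intro W_add W_scale h T)
  have "order_ge 1 (Dvec z y - ?f y)" for y
  proof -
    have z: "order_ge 1 (Dvec z z - ?f z)"
      using o zt zt[symmetric] latticeD(4)[OF hl, of z]
      by (auto simp: order_ge_1_iff order_ge_0_iff b_def d_def Tvec_def Dvec_def
          intro!: order_ge_diff order_ge_add order_ge_mult_eq[of 0 _ "-1"])
    have eq: "Dvec z (\<tau> z) - ?f (\<tau> z) = flip (Dvec z z - ?f z)"
      using latticeD(3)[OF hl, of z] latticeD(3)[OF Tvec_lattice[OF zs], of z]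
        latticeD(3)[OF Dvec_lattice[OF zs], of z] by simp
    have "order_ge 1 (Dvec z (\<tau> z) - ?f (\<tau> z))"
      unfolding eq flip_order_ge by (rule z)
    then show ?thesis using z supp[of y]
      by (cases "y = z \<or> y = \<tau> z"; cases "h y = 0") (auto simp: Tvec_def Dvec_def)
  qed
  moreover have "(\<lambda>y. Dvec z y - ?f y) \<in> lattice"
    using f W_lattice by (intro lattice_diff Dvec_lattice zs) auto
  ultimately have "(\<lambda>y. Dvec z y - ?f y) \<in> small" by (auto simp: small_def)
  then show "Dvec z \<in> W" by (rule W_small_cong[OF f])
qed

end

section \<open>Reaching all tableaux\<close>

context invariant_subspace
begin

text \<open>The projected step never loses its starting tableau: the leading term of the new coefficient is
that of a ladder coefficient times \<open>h z0\<close>, up to the factor \<open>2\<close> of \<open>projected_value\<close>.\<close>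

lemma projected_leading_term:
  assumes p: "1 \<le> p" "p \<le> n - 1" and q: "q \<in> {1..p}" and s: "s = 1 \<or> s = -1"
    and same: "\<And>z. h z \<noteq> 0 \<Longrightarrow> row_square p z $$ 0 = row_square p z0 $$ 0"
    and h: "h \<in> lattice" "order_ge 0 (h z0)" "h z0 $$ 0 \<noteq> 0"
  defines "g \<equiv> projected_ladder s p q z0 h" and "y \<equiv> move s p q z0"
  shows "sing p q z0 \<Longrightarrow> g y $$ (-1) \<noteq> 0" "\<not> sing p q z0 \<Longrightarrow> order_ge 0 (g y) \<and> g y $$ 0 \<noteq> 0"
proof -
  define c where "c = coef s p q z0 * h z0"
  note pv = projected_value[OF s p q same h(1), folded g_def y_def c_def]
  show "g y $$ (-1) \<noteq> 0" if sg: "sing p q z0"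
  proof -
    have "g y = c" using sg by (intro pv(2)) (auto simp: sing_def)
    moreover have "c $$ (-1) = coef s p q z0 $$ (-1) * h z0 $$ 0"
      unfolding c_def using coef_leading(1)[OF p q, of z0 s] sg h(2) by (intro leading_mult) auto
    ultimately show ?thesis using coef_leading(2)[OF p q, where z = z0 and s = s] sg h(3) by simp
  qed
  show "order_ge 0 (g y) \<and> g y $$ 0 \<noteq> 0" if sg: "\<not> sing p q z0"
  proof -
    have oc: "order_ge 0 (coef s p q z0)" "coef s p q z0 $$ 0 \<noteq> 0"
      using coef_leading[OF p q, where z = z0 and s = s] sg by auto
    have "c $$ 0 = coef s p q z0 $$ 0 * h z0 $$ 0"
      unfolding c_def by (rule leading_mult[OF oc(1) h(2)]) simp
    moreover have "order_ge 0 c"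
      unfolding c_def by (rule order_ge_mult_eq[OF oc(1) h(2)]) simp
    ultimately show ?thesis using pv(1) oc(2) h(3) by (auto intro!: order_ge_add)
  qed
qed

text \<open>Otherwise the projected step at \<open>(p,q)\<close> would lose the orbit of \<open>z\<close>. It creates no new orbits: its
support consists of the orbits of \<open>y + \<delta>\<^sup>p\<^sup>q\<close> for \<open>y\<close> in the support of \<open>g\<close> with the entry of \<open>z0\<close> at \<open>(p,q)\<close>,
and two such \<open>y\<close> in one orbit give the same orbit.\<close>

lemma minimal_same_entries:
  assumes g: "minimal g" and unit: "\<And>z. g z \<noteq> 0 \<Longrightarrow> order_ge 0 (g z) \<and> g z $$ 0 \<noteq> 0"
    and z: "g z0 \<noteq> 0" "g z \<noteq> 0" and p: "1 \<le> p" "p \<le> n - 1" and q: "q \<in> {1..p}"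
  shows "z p q = z0 p q \<or> z p (perm p q) = z0 p q"
proof (rule ccontr)
  assume neq: "\<not> ?thesis"
  have gW: "g \<in> W" and gl: "g \<in> lattice" using g W_lattice by (auto simp: minimal_def)
  have same: "row_square p y $$ 0 = row_square p z0 $$ 0" if "g y \<noteq> 0" for y
    using minimal_row_square[OF g that z(1) p(2)] .
  define g' where "g' = projected_ladder 1 p q z0 g"
  have g'W: "g' \<in> W" unfolding g'_def using projected_ladder_W[OF gW p] by blast
  have "g' \<notin> small"
  proof (rule not_smallI[OF g'W, of "move 1 p q z0"])
    note pn = projected_leading_term[OF p q disjI1[OF refl] same gl]
    show "\<not> order_ge 1 (g' (move 1 p q z0))"
    proof (cases "sing p q z0")
      case True
      then have "g' (move 1 p q z0) $$ (-1) \<noteq> 0"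
        unfolding g'_def using unit[OF z(1)] by (intro pn(1)) auto
      then show ?thesis by (auto simp: order_ge_1_iff order_ge_0_iff)
    next
      case False
      then have "g' (move 1 p q z0) $$ 0 \<noteq> 0"
        unfolding g'_def using unit[OF z(1)] pn(2) by blast
      then show ?thesis by (auto simp: order_ge_1_iff)
    qed
  qed
  define M where "M = {y. g y \<noteq> 0 \<and> y p q = z0 p q}"
  let ?F = "\<lambda>y. orb (move 1 p q y)"
  have finM: "finite M" using latticeD(1)[OF gl] by (auto simp: M_def)
  have "orbits g' \<subseteq> ?F ` M"
  proof
    fix b assume "b \<in> orbits g'"
    then obtain y where y: "g' y \<noteq> 0" "b = orb y" by (auto simp: orbits_def)
    then obtain x u where x: "g x \<noteq> 0" "u = q \<or> u = perm p q" "y = move 1 p u x" "x p u = z0 p q"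
      using projected_support[OF disjI1[OF refl] p q same, of g y] unfolding g'_def by blast
    show "b \<in> ?F ` M"
    proof (cases "u = q")
      case True
      then show ?thesis using x y by (auto simp: M_def)
    next
      case False
      then have u: "u = perm p q" using x by blast
      have "\<tau> x \<in> M" using x(1,4) latticeD(3)[OF gl, of x] u
        by (auto simp: M_def tau_apply dest: arg_cong[of _ _ flip])
      moreover have "?F (\<tau> x) = b" using x y u by (simp add: move_tau)
      ultimately show ?thesis by blast
    qed
  qed
  then have "card (orbits g') \<le> card (?F ` M)" using finM by (intro card_mono) auto
  also have "\<dots> \<le> card (orb ` M)"
  proof (rule card_image_factor_le[OF finM])
    fix x y assume xy: "x \<in> M" "y \<in> M" "orb x = orb y"
    then consider "x = y" | "x = \<tau> y" by (auto simp: orb_eq_iff)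
    then show "?F x = ?F y"
    proof cases
      case 2
      show ?thesis
      proof (cases "perm p q = q")
        case True
        then show ?thesis using 2 by (simp add: move_tau)
      next
        case False
        moreover have "y p (perm p q) = y p q" using xy 2 by (auto simp: M_def tau_apply)
        ultimately have "\<tau> y = y"
          by (auto simp: tau_eq_iff perm_def Transposition.transpose_def split: if_splits)
        then show ?thesis using 2 by simp
      qed
    qed simp
  qed
  also have "\<dots> < card (orbits g)"
  proof (rule psubset_card_mono[OF finite_orbits[OF gW]])
    have "orb z \<notin> orb ` M" using neq by (auto simp: M_def orb_eq_iff tau_apply)
    moreover have "orb z \<in> orbits g" "orb ` M \<subseteq> orbits g" using z by (auto simp: orbits_def M_def)
    ultimately show "orb ` M \<subset> orbits g" by blast
  qed
  finally show False using g g'W \<open>g' \<notin> small\<close> by (auto simp: minimal_def)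
qed

lemma minimal_single_orbit:
  assumes g: "minimal g" and unit: "\<And>z. g z \<noteq> 0 \<Longrightarrow> order_ge 0 (g z) \<and> g z $$ 0 \<noteq> 0"
    and z: "g z0 \<noteq> 0" "g z \<noteq> 0"
  shows "z = z0 \<or> z = \<tau> z0"
proof -
  have gl: "g \<in> lattice" using g W_lattice by (auto simp: minimal_def)
  have sh: "z \<in> shifts n" "z0 \<in> shifts n" using latticeD(2)[OF gl] z by auto
  have e1: "z p q = z0 p q \<or> z p (perm p q) = z0 p q" if "1 \<le> q" "q \<le> p" "p \<le> n - 1" for p q
    using minimal_same_entries[OF g unit z, of p q] that by auto
  have e2: "z0 p q = z p q \<or> z0 p (perm p q) = z p q" if "1 \<le> q" "q \<le> p" "p \<le> n - 1" for p q
    using minimal_same_entries[OF g unit z(2,1), of p q] that by auto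
  have off: "z p q = z0 p q \<and> perm p q = q" if "\<not> (p = k \<and> (q = i \<or> q = j))" for p q
  proof -
    have "perm p q = q" using that by (auto simp: perm_def)
    moreover have "z p q = z0 p q"
    proof (cases "1 \<le> q \<and> q \<le> p \<and> p \<le> n - 1")
      case True
      then show ?thesis using e1[of q p] calculation by auto
    next
      case False
      then show ?thesis using sh by (simp add: shifts_def)
    qed
    ultimately show ?thesis by simp
  qed
  have pi: "perm k i = j" "perm k j = i" by (auto simp: perm_def)
  have ri: "z k i = z0 k i \<or> z k j = z0 k i" "z k j = z0 k j \<or> z k i = z0 k j"
    "z0 k i = z k i \<or> z0 k j = z k i" "z0 k j = z k j \<or> z0 k i = z k j"
    using e1[of i k] e1[of j k] e2[of i k] e2[of j k] ij by (auto simp: pi)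
  then consider "z k i = z0 k i" "z k j = z0 k j" | "z k i = z0 k j" "z k j = z0 k i" by metis
  then show ?thesis
  proof cases
    case 1
    then have "z p q = z0 p q" for p q using off[of p q] by (cases "p = k \<and> (q = i \<or> q = j)") auto
    then show ?thesis by (intro disjI1 ext)
  next
    case 2
    then have "z p q = \<tau> z0 p q" for p q
      using off[of p q] by (cases "p = k \<and> (q = i \<or> q = j)") (auto simp: tau_apply pi)
    then show ?thesis by (intro disjI2 ext)
  qed
qed

lemma exists_Tvec:
  assumes "h \<in> W" "h \<notin> small"
  shows "\<exists>z \<in> shifts n. Tvec z \<in> W"
proof -
  obtain g where g: "minimal g" and unit: "\<And>z. g z \<noteq> 0 \<Longrightarrow> order_ge 0 (g z) \<and> g z $$ 0 \<noteq> 0"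
    using exists_minimal[OF assms] by blast
  have gW: "g \<in> W" "g \<notin> small" "g \<in> lattice" using g W_lattice by (auto simp: minimal_def)
  obtain z where z: "\<not> order_ge 1 (g z)" using not_smallD gW by blast
  then have gz: "g z \<noteq> 0" by auto
  have "Tvec z \<in> W"
    using unit[OF gz] by (intro Tvec_in_W[OF gW(1)] minimal_single_orbit[OF g unit gz]) auto
  then show ?thesis using latticeD(2)[OF gW(3) gz] by blast
qed

lemma Tvec_simps: "Tvec z z $$ 0 \<noteq> 0" "order_ge 0 (Tvec z y)" "Tvec z y \<noteq> 0 \<Longrightarrow> y = z \<or> y = \<tau> z"
  by (auto simp: Tvec_def order_ge_def split: if_splits)

lemma Tvec_step:
  assumes T: "Tvec z \<in> W" and p: "1 \<le> p" "p \<le> n - 1" and q: "q \<in> {1..p}" and s: "s = 1 \<or> s = -1"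
  shows "Tvec (move s p q z) \<in> W" "sing p q z \<Longrightarrow> Dvec (move s p q z) \<in> W"
proof -
  have Tl: "Tvec z \<in> lattice" using T W_lattice by auto
  have same: "row_square p y $$ 0 = row_square p z $$ 0" if "Tvec z y \<noteq> 0" for y
    using Tvec_simps(3)[OF that] by (metis row_square_tau flip_nth_simps(1))
  define g where "g = projected_ladder s p q z (Tvec z)"
  have gW: "g \<in> W" unfolding g_def by (rule projected_ladder_W[OF T p s])
  have supp: "y = move s p q z \<or> y = \<tau> (move s p q z)" if "g y \<noteq> 0" for y
    using projected_support_single[OF s p q same Tvec_simps(3)] that unfolding g_def by blast
  note pn = projected_leading_term[OF p q s same Tl Tvec_simps(2,1), folded g_def]
  show D: "Dvec (move s p q z) \<in> W" if "sing p q z"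
    by (rule Dvec_in_W(2)[OF gW supp]) (use pn(1) that in \<open>auto simp: g_def\<close>)
  show "Tvec (move s p q z) \<in> W"
  proof (cases "sing p q z")
    case True
    show ?thesis
      by (rule Dvec_in_W(1)[OF gW supp]) (use pn(1) True in \<open>auto simp: g_def\<close>)
  next
    case False
    show ?thesis
      by (rule Tvec_in_W[OF gW supp]) (use pn(2) False in \<open>auto simp: g_def\<close>)
  qed
qed

lemma Tvec_all:
  assumes T: "Tvec z0 \<in> W" and z0: "z0 \<in> shifts n" and z: "z \<in> shifts n"
  shows "Tvec z \<in> W"
  using T z0
proof (induction "\<Sum>p\<in>{1..n-1}. \<Sum>q\<in>{1..p}. nat \<bar>z p q - z0 p q\<bar>" arbitrary: z0 rule: less_induct)
  case less
  show ?case
  proof (cases "\<forall>p\<in>{1..n-1}. \<forall>q\<in>{1..p}. z p q = z0 p q")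
    case True
    have "z p q = z0 p q" for p q
    proof (cases "1 \<le> q \<and> q \<le> p \<and> p \<le> n - 1")
      case r: True
      then show ?thesis using True by auto
    next
      case False
      then show ?thesis using z less.prems(2) by (simp add: shifts_def)
    qed
    then have "z = z0" by (intro ext)
    then show ?thesis using less.prems by simp
  next
    case False
    then obtain p q where pq: "p \<in> {1..n-1}" "q \<in> {1..p}" "z p q \<noteq> z0 p q" by blast
    define s :: int where "s = (if z p q > z0 p q then 1 else -1)"
    have s: "s = 1 \<or> s = -1" by (simp add: s_def)
    let ?z1 = "move s p q z0"
    have "Tvec ?z1 \<in> W" using Tvec_step(1)[OF less.prems(1) _ _ pq(2) s] pq by auto
    moreover have "?z1 \<in> shifts n" using less.prems(2) pq by simp
    moreover have "(\<Sum>p\<in>{1..n-1}. \<Sum>q\<in>{1..p}. nat \<bar>z p q - ?z1 p q\<bar>)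
        < (\<Sum>p\<in>{1..n-1}. \<Sum>q\<in>{1..p}. nat \<bar>z p q - z0 p q\<bar>)"
    proof -
      have le: "nat \<bar>z r u - ?z1 r u\<bar> \<le> nat \<bar>z r u - z0 r u\<bar>" for r u
        using pq(3) by (auto simp: move_apply s_def)
      have lt: "nat \<bar>z p q - ?z1 p q\<bar> < nat \<bar>z p q - z0 p q\<bar>"
        using pq(3) by (auto simp: move_apply s_def)
      have "(\<Sum>u\<in>{1..p}. nat \<bar>z p u - ?z1 p u\<bar>) < (\<Sum>u\<in>{1..p}. nat \<bar>z p u - z0 p u\<bar>)"
        using le lt pq by (intro sum_strict_mono_ex1) auto
      then show ?thesis
        using le pq by (intro sum_strict_mono_ex1 ballI sum_mono) auto
    qed
    ultimately show ?thesis using less.hyps by blast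
  qed
qed

text \<open>Raising the larger entry of the singular pair never leads to a fixed tableau, so no
cancellation with the mirror image can destroy the pole.\<close>

lemma Dvec_step:
  assumes D: "Dvec z \<in> W" and lt: "z k i > z k j"
  shows "Dvec (move 1 k i z) \<in> W"
proof -
  have p: "1 \<le> k" "k \<le> n - 1" "i \<in> {1..k}" using ij by auto
  have Dl: "Dvec z \<in> lattice" using D W_lattice by auto
  have supp0: "y = z \<or> y = \<tau> z" if "Dvec z y \<noteq> 0" for y
    using that by (auto simp: Dvec_def split: if_splits)
  have same: "row_square k y $$ 0 = row_square k z $$ 0" if "Dvec z y \<noteq> 0" for y
    using supp0[OF that] by (metis row_square_tau flip_nth_simps(1))
  have zt: "\<tau> z \<noteq> z" and yt: "\<tau> (move 1 k i z) \<noteq> move 1 k i z"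
    using lt ij by (auto simp: tau_eq_iff move_apply)
  define g where "g = projected_ladder 1 k i z (Dvec z)"
  have s: "(1::int) = 1 \<or> (1::int) = -1" by simp
  have gW: "g \<in> W" unfolding g_def by (rule projected_ladder_W[OF D p(1,2) s])
  have supp: "y = move 1 k i z \<or> y = \<tau> (move 1 k i z)" if "g y \<noteq> 0" for y
    using projected_support_single[OF s p same supp0] that unfolding g_def by blast
  have "g (move 1 k i z) = coef 1 k i z * Dvec z z"
    unfolding g_def using projected_value(2)[OF s p same Dl] yt by blast
  moreover have "(coef 1 k i z * Dvec z z) $$ (-1) = coef 1 k i z $$ 0 * Dvec z z $$ (-1)"
    using coef_leading(1)[OF p, of z 1] zt latticeD(4)[OF Dl] by (intro leading_mult) (auto simp: sing_def)
  moreover have "coef 1 k i z $$ 0 \<noteq> 0"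
    using coef_leading(2)[OF p, where z = z and s = 1] zt by (auto simp: sing_def)
  moreover have "Dvec z z $$ (-1) \<noteq> 0" using zt[symmetric] by (simp add: Dvec_def)
  ultimately have "g (move 1 k i z) $$ (-1) \<noteq> 0" by simp
  then show ?thesis using supp by (intro Dvec_in_W(2)[OF gW])
qed

text \<open>The first derivative tableaux, with \<open>z k i = z k j + 1\<close>, come from the poles of the steps out of
fixed tableaux; the others follow by raising \<open>z k i\<close> further, or by applying \<open>\<tau>\<close>.\<close>

lemma W_full:
  assumes h: "h \<in> W" "h \<notin> small" and z: "z \<in> shifts n"
  shows "Tvec z \<in> W" "Dvec z \<in> W"
proof -
  obtain z0 where "z0 \<in> shifts n" "Tvec z0 \<in> W" using exists_Tvec[OF h] by blast
  then have T: "Tvec y \<in> W" if "y \<in> shifts n" for y using Tvec_all that by blast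
  then show "Tvec z \<in> W" using z by blast
  have pos: "Dvec y \<in> W" if "y k i = y k j + int (Suc m)" "y \<in> shifts n" for y m
    using that
  proof (induction m arbitrary: y)
    case 0
    let ?y = "move (-1) k i y"
    have k: "1 \<le> k" "k \<le> n - 1" "i \<in> {1..k}" using ij by auto
    have "sing k i ?y" using 0 ij by (simp add: sing_def tau_eq_iff move_apply)
    moreover have "?y \<in> shifts n" using 0 k by simp
    ultimately have "Dvec (move 1 k i ?y) \<in> W" using Tvec_step(2)[OF T k] by blast
    then show ?case using move_inverse(2)[of 1 k i y] by simp
  next
    case (Suc m)
    let ?y = "move (-1) k i y"
    have k: "1 \<le> i" "i \<le> k" "k \<le> n - 1" using ij by auto
    have "?y \<in> shifts n" using Suc.prems(2) k by simp
    moreover have "?y k i = ?y k j + int (Suc m)" using Suc.prems(1) ij by (simp add: move_apply)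
    ultimately have "Dvec ?y \<in> W" by (intro Suc.IH)
    then have "Dvec (move 1 k i ?y) \<in> W"
      using Suc.prems ij by (intro Dvec_step) (auto simp: move_apply)
    then show ?case using move_inverse(2)[of 1 k i y] by simp
  qed
  have pos: "Dvec y \<in> W" if "y k i > y k j" "y \<in> shifts n" for y
    using pos[of y "nat (y k i - y k j) - 1"] that by simp
  show "Dvec z \<in> W"
  proof (cases "z k i" "z k j" rule: linorder_cases)
    case less
    have "Dvec (\<tau> z) \<in> W" using less z by (intro pos) (auto simp: tau_apply perm_def)
    then have "(\<lambda>y. fls_const (-1) * Dvec (\<tau> z) y) \<in> W" by (rule W_scale)
    then show ?thesis by (simp add: const_minus_one Dvec_tau)
  next
    case equal
    then have "\<tau> z = z" by (simp add: tau_eq_iff)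
    then have "Dvec z = (\<lambda>y. 0)" by (auto simp: Dvec_def)
    then show ?thesis by simp
  next
    case greater
    then show ?thesis using pos z by blast
  qed
qed

end

section \<open>Rational functions and their germs along the line\<close>

lemma poly_fun_on_line:
  "poly_fun n R \<Longrightarrow> \<exists>r. \<forall>t. R (\<lambda>p q. u p q + t * d p q) = poly r t"
proof (induction rule: poly_fun.induct)
  case (const c)
  then show ?case by (intro exI[of _ "[:c:]"]) simp
next
  case (coord q p)
  then show ?case by (intro exI[of _ "[:u p q, d p q:]"]) simp
next
  case (add P Q)
  then obtain r s where "\<And>t. P (\<lambda>p q. u p q + t * d p q) = poly r t" "\<And>t. Q (\<lambda>p q. u p q + t * d p q) = poly s t"
    by blast
  then show ?case by (intro exI[of _ "r + s"]) simp
next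
  case (mult P Q)
  then obtain r s where "\<And>t. P (\<lambda>p q. u p q + t * d p q) = poly r t" "\<And>t. Q (\<lambda>p q. u p q + t * d p q) = poly s t"
    by blast
  then show ?case by (intro exI[of _ "r * s"]) simp
qed

lemma countable_nongeneric:
  "countable {t. \<not> generic n (\<lambda>p q. u p q + t * of_nat q)}"
proof -
  let ?f = "\<lambda>(r, s, s', m). (of_int m - (u r s - u r s')) / (of_nat s - of_nat s') :: complex"
  have "{t. \<not> generic n (\<lambda>p q. u p q + t * of_nat q)} \<subseteq> ?f ` (UNIV :: (nat \<times> nat \<times> nat \<times> int) set)"
  proof
    fix t assume "t \<in> {t. \<not> generic n (\<lambda>p q. u p q + t * of_nat q)}"
    then obtain r s s' where rs: "s < s'" "(u r s + t * of_nat s) - (u r s' + t * of_nat s') \<in> \<int>"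
      unfolding generic_def mem_Collect_eq by blast
    then obtain m where "(u r s + t * of_nat s) - (u r s' + t * of_nat s') = of_int m"
      by (blast elim: Ints_cases)
    then have "t * (of_nat s - of_nat s') = of_int m - (u r s - u r s')"
      by (simp add: algebra_simps)
    moreover have "(of_nat s - of_nat s' :: complex) \<noteq> 0" using rs(1) by simp
    ultimately have "t = ?f (r, s, s', m)" by (simp only: prod.case eq_divide_eq not_False_eq_True if_True)
    then show "t \<in> range ?f" by blast
  qed
  then show ?thesis by (meson countableI_type countable_image countable_subset)
qed

text \<open>Generic arrays are Zariski dense: on the line from \<open>u\<close> in the direction with entries \<open>q\<close> all but
countably many arrays are generic. So the value of a rational function does not depend on the
fraction that represents it.\<close>

lemma poly_fun_zero:
  assumes R: "poly_fun n R" and zero: "\<And>v. generic n v \<Longrightarrow> R v = 0"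
  shows "R u = 0"
proof -
  obtain r where r: "\<And>t. R (\<lambda>p q. u p q + t * of_nat q) = poly r t"
    using poly_fun_on_line[OF R, of u "\<lambda>p q. of_nat q"] by blast
  have "{t. generic n (\<lambda>p q. u p q + t * of_nat q)} \<subseteq> {t. poly r t = 0}"
  proof (rule subsetI, unfold mem_Collect_eq)
    fix t assume "generic n (\<lambda>p q. u p q + t * of_nat q)"
    then show "poly r t = 0" using zero r[of t] by metis
  qed
  moreover have "infinite {t. generic n (\<lambda>p q. u p q + t * of_nat q)}"
  proof
    let ?G = "{t. generic n (\<lambda>p q. u p q + t * of_nat q)}"
    assume "finite ?G"
    moreover have "- ?G = {t. \<not> generic n (\<lambda>p q. u p q + t * of_nat q)}" by blast
    ultimately have "countable (?G \<union> - ?G)"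
      using countable_nongeneric[of n u] by (simp only: countable_Un countable_finite)
    then show False using uncountable_UNIV_complex by (simp only: Compl_partition)
  qed
  ultimately have "r = 0" using poly_roots_finite finite_subset by blast
  then show ?thesis using r[of 0] by simp
qed

lemma poly_fun_uminus: "poly_fun n P \<Longrightarrow> poly_fun n (\<lambda>v. - P v)"
  using poly_fun.mult[OF poly_fun.const[of n "-1"], of P] by simp

lemma poly_fun_diff: "poly_fun n P \<Longrightarrow> poly_fun n Q \<Longrightarrow> poly_fun n (\<lambda>v. P v - Q v)"
  using poly_fun.add[of n P "\<lambda>v. - Q v"] poly_fun_uminus by simp

lemma rat_value_eq:
  assumes "represents n P Q f" "Q u \<noteq> 0"
  shows "rat_value n f u = P u / Q u"
  unfolding rat_value_def
proof (rule the_equality)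
  show "\<exists>P' Q'. represents n P' Q' f \<and> Q' u \<noteq> 0 \<and> P u / Q u = P' u / Q' u" using assms by blast
  fix c assume "\<exists>P' Q'. represents n P' Q' f \<and> Q' u \<noteq> 0 \<and> c = P' u / Q' u"
  then obtain P' Q' where PQ: "represents n P' Q' f" "Q' u \<noteq> 0" "c = P' u / Q' u" by blast
  have "poly_fun n (\<lambda>v. P v * Q' v - P' v * Q v)"
    using assms PQ by (intro poly_fun_diff poly_fun.mult) (auto simp: represents_def)
  moreover have "P v * Q' v - P' v * Q v = 0" if "generic n v" for v
  proof -
    have "f v * Q v = P v" "f v * Q' v = P' v" using assms(1) PQ(1) that by (auto simp: represents_def)
    then show ?thesis by (metis mult.assoc mult.commute right_minus_eq)
  qed
  ultimately have "P u * Q' u - P' u * Q u = 0" using poly_fun_zero by blast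
  then show "c = P u / Q u"
    unfolding PQ(3) frac_eq_eq[OF PQ(2) assms(2)] right_minus_eq by (rule sym)
qed

context singular_tableau
begin

text \<open>Only two terms of the Taylor expansion of \<open>P\<close> along the line matter: the value at \<open>vb\<close>, and the
derivative along the line, which is the difference of the two partial derivatives. The higher
coefficients of \<open>g\<close> are left open; the relation is compatible with sums and products.\<close>

definition germ :: "(arr \<Rightarrow> complex) \<Rightarrow> complex fls \<Rightarrow> bool" where
  "germ P g \<longleftrightarrow> poly_fun n P \<and> (\<exists>p. g = fps_to_fls p \<and> p $ 0 = P vb \<and>
     (\<exists>A B. ((\<lambda>t. P (upd vb k i t)) has_field_derivative A) (at (vb k i)) \<and>
            ((\<lambda>t. P (upd vb k j t)) has_field_derivative B) (at (vb k j)) \<and> p $ 1 = A - B))"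

lemma upd_same [simp]: "upd v p q (v p q) = v"
  by (intro ext) (simp add: upd_def)

lemma germ_const [simp]: "germ (\<lambda>v. c) (fls_const c)"
  unfolding germ_def
  by (intro conjI poly_fun.const exI[of _ "fps_const c"] exI[of _ 0] DERIV_const) auto

lemma germ_coord: "1 \<le> q \<Longrightarrow> q \<le> p \<Longrightarrow> p \<le> n - 1 \<Longrightarrow> germ (\<lambda>v. v p q) (line p q)"
proof -
  assume pq: "1 \<le> q" "q \<le> p" "p \<le> n - 1"
  have "((\<lambda>t. upd vb k l t p q) has_field_derivative (if p = k \<and> q = l then 1 else 0)) (at (vb k l))" for l
  proof -
    have "(\<lambda>t. upd vb k l t p q) = (if p = k \<and> q = l then (\<lambda>t. t) else (\<lambda>t. vb p q))"
      by (auto simp: upd_def fun_eq_iff)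
    then show ?thesis by (cases "p = k \<and> q = l") (simp_all only: if_True if_False simp_thms DERIV_ident DERIV_const)
  qed
  then show ?thesis
    unfolding germ_def line_def
    using ij
    by (intro conjI poly_fun.coord pq
         exI[of _ "fps_const (vb p q) + (if p = k \<and> q = i then fps_X else if p = k \<and> q = j then - fps_X else 0)"]
         exI[of _ "if p = k \<and> q = i then 1 else 0"] exI[of _ "if p = k \<and> q = j then 1 else 0"]) auto
qed

lemma germ_add:
  assumes "germ P g" "germ Q h"
  shows "germ (\<lambda>v. P v + Q v) (g + h)"
proof -
  obtain p A B where P: "poly_fun n P" "g = fps_to_fls p" "p $ 0 = P vb"
    "((\<lambda>t. P (upd vb k i t)) has_field_derivative A) (at (vb k i))"
    "((\<lambda>t. P (upd vb k j t)) has_field_derivative B) (at (vb k j))" "p $ 1 = A - B"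
    using assms(1) unfolding germ_def by blast
  obtain q A' B' where Q: "poly_fun n Q" "h = fps_to_fls q" "q $ 0 = Q vb"
    "((\<lambda>t. Q (upd vb k i t)) has_field_derivative A') (at (vb k i))"
    "((\<lambda>t. Q (upd vb k j t)) has_field_derivative B') (at (vb k j))" "q $ 1 = A' - B'"
    using assms(2) unfolding germ_def by blast
  show ?thesis
    unfolding germ_def
    by (intro conjI poly_fun.add exI[of _ "p + q"] exI[of _ "A + A'"] exI[of _ "B + B'"] DERIV_add)
       (use P Q in auto)
qed

lemma germ_mult:
  assumes "germ P g" "germ Q h"
  shows "germ (\<lambda>v. P v * Q v) (g * h)"
proof -
  obtain p A B where P: "poly_fun n P" "g = fps_to_fls p" "p $ 0 = P vb"
    "((\<lambda>t. P (upd vb k i t)) has_field_derivative A) (at (vb k i))"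
    "((\<lambda>t. P (upd vb k j t)) has_field_derivative B) (at (vb k j))" "p $ 1 = A - B"
    using assms(1) unfolding germ_def by blast
  obtain q A' B' where Q: "poly_fun n Q" "h = fps_to_fls q" "q $ 0 = Q vb"
    "((\<lambda>t. Q (upd vb k i t)) has_field_derivative A') (at (vb k i))"
    "((\<lambda>t. Q (upd vb k j t)) has_field_derivative B') (at (vb k j))" "q $ 1 = A' - B'"
    using assms(2) unfolding germ_def by blast
  have "(p * q) $ 1 = (A * Q vb + A' * P vb) - (B * Q vb + B' * P vb)"
    unfolding fps_mult_nth_1 P Q by (simp add: algebra_simps)
  then show ?thesis
    unfolding germ_def
    using DERIV_mult[OF P(4) Q(4)] DERIV_mult[OF P(5) Q(5)] P Q
    by (intro conjI poly_fun.mult exI[of _ "p * q"] exI[of _ "A * Q vb + A' * P vb"] exI[of _ "B * Q vb + B' * P vb"])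
       (auto simp: fls_times_fps_to_fls)
qed

lemma germ_uminus: "germ P g \<Longrightarrow> germ (\<lambda>v. - P v) (- g)"
  using germ_mult[OF germ_const[of "-1"], of P g] by (simp add: fls_eq_iff)

lemma germ_diff: "germ P g \<Longrightarrow> germ Q h \<Longrightarrow> germ (\<lambda>v. P v - Q v) (g - h)"
  using germ_add[of P g "\<lambda>v. - Q v" "- h"] germ_uminus by simp

lemma germ_sum: "(\<And>u. u \<in> A \<Longrightarrow> germ (P u) (g u)) \<Longrightarrow> germ (\<lambda>v. \<Sum>u\<in>A. P u v) (\<Sum>u\<in>A. g u)"
  using germ_const[of 0] by (induction A rule: infinite_finite_induct) (auto intro: germ_add)

lemma germ_prod: "(\<And>u. u \<in> A \<Longrightarrow> germ (P u) (g u)) \<Longrightarrow> germ (\<lambda>v. \<Prod>u\<in>A. P u v) (\<Prod>u\<in>A. g u)"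
  using germ_const[of 1] by (induction A rule: infinite_finite_induct) (auto intro: germ_mult)

lemma germ_0: "germ P g \<Longrightarrow> order_ge 0 g \<and> g $$ 0 = P vb"
  by (auto simp: germ_def order_ge_def)

text \<open>The same for a rational function without pole at \<open>vb\<close>, which is known only on generic arrays.\<close>

definition rgerm :: "(arr \<Rightarrow> complex) \<Rightarrow> complex fls \<Rightarrow> bool" where
  "rgerm f g \<longleftrightarrow> (\<exists>P Q p q. germ P p \<and> germ Q q \<and> Q vb \<noteq> 0 \<and>
      (\<forall>v. generic n v \<longrightarrow> f v * Q v = P v) \<and> g * q = p)"

lemma rgerm_germ: "germ P g \<Longrightarrow> rgerm P g"
  unfolding rgerm_def using germ_const[of 1]
  by (intro exI[of _ P] exI[of _ "\<lambda>v. 1"] exI[of _ g] exI[of _ 1]) auto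

lemma rgerm_cong: "rgerm f g \<Longrightarrow> (\<And>v. generic n v \<Longrightarrow> f' v = f v) \<Longrightarrow> rgerm f' g"
  unfolding rgerm_def by metis

lemma rgerm_mult:
  assumes "rgerm f g" "rgerm f' g'"
  shows "rgerm (\<lambda>v. f v * f' v) (g * g')"
proof -
  obtain P Q p q where 1: "germ P p" "germ Q q" "Q vb \<noteq> 0" "\<And>v. generic n v \<Longrightarrow> f v * Q v = P v" "g * q = p"
    using assms(1) unfolding rgerm_def by blast
  obtain P' Q' p' q' where 2: "germ P' p'" "germ Q' q'" "Q' vb \<noteq> 0" "\<And>v. generic n v \<Longrightarrow> f' v * Q' v = P' v" "g' * q' = p'"
    using assms(2) unfolding rgerm_def by blast
  show ?thesis
    unfolding rgerm_def
    by (intro exI[of _ "\<lambda>v. P v * P' v"] exI[of _ "\<lambda>v. Q v * Q' v"] exI[of _ "p * p'"] exI[of _ "q * q'"]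
         conjI germ_mult 1 2)
       (simp_all add: 1(3) 2(3) 1(4,5)[symmetric] 2(4,5)[symmetric] mult_ac)
qed

lemma rgerm_add:
  assumes "rgerm f g" "rgerm f' g'"
  shows "rgerm (\<lambda>v. f v + f' v) (g + g')"
proof -
  obtain P Q p q where 1: "germ P p" "germ Q q" "Q vb \<noteq> 0" "\<And>v. generic n v \<Longrightarrow> f v * Q v = P v" "g * q = p"
    using assms(1) unfolding rgerm_def by blast
  obtain P' Q' p' q' where 2: "germ P' p'" "germ Q' q'" "Q' vb \<noteq> 0" "\<And>v. generic n v \<Longrightarrow> f' v * Q' v = P' v" "g' * q' = p'"
    using assms(2) unfolding rgerm_def by blast
  show ?thesis
    unfolding rgerm_def
    by (intro exI[of _ "\<lambda>v. P v * Q' v + P' v * Q v"] exI[of _ "\<lambda>v. Q v * Q' v"] exI[of _ "p * q' + p' * q"] exI[of _ "q * q'"]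
         conjI germ_mult germ_add 1 2)
       (simp_all add: 1(3) 2(3) 1(4,5)[symmetric] 2(4,5)[symmetric] algebra_simps)
qed

lemma rgerm_sum: "(\<And>u. u \<in> A \<Longrightarrow> rgerm (f u) (g u)) \<Longrightarrow> rgerm (\<lambda>v. \<Sum>u\<in>A. f u v) (\<Sum>u\<in>A. g u)"
  using rgerm_germ[OF germ_const[of 0]]
  by (induction A rule: infinite_finite_induct) (auto intro: rgerm_add)

lemma rgerm_divide:
  assumes "germ P p" "germ Q q" "Q vb \<noteq> 0" "\<And>v. generic n v \<Longrightarrow> Q v \<noteq> 0"
  shows "rgerm (\<lambda>v. P v / Q v) (p / q)"
proof -
  have "q \<noteq> 0" using germ_0[OF assms(2)] assms(3) by auto
  then show ?thesis unfolding rgerm_def using assms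
    by (intro exI[of _ P] exI[of _ Q] exI[of _ p] exI[of _ q]) auto
qed

text \<open>The operator \<open>\<D>\<close> is half the derivative along the line.\<close>

lemma rgerm_value:
  assumes "rgerm f g"
  shows "rat_value n f vb = g $$ 0" "D_bar n k i j vb f = g $$ 1 / 2" "order_ge 0 g"
proof -
  obtain P Q p q where PQ: "germ P p" "germ Q q" "Q vb \<noteq> 0" "\<And>v. generic n v \<Longrightarrow> f v * Q v = P v" "g * q = p"
    using assms unfolding rgerm_def by blast
  obtain p' A B where P: "poly_fun n P" "p = fps_to_fls p'" "p' $ 0 = P vb"
    "((\<lambda>t. P (upd vb k i t)) has_field_derivative A) (at (vb k i))"
    "((\<lambda>t. P (upd vb k j t)) has_field_derivative B) (at (vb k j))" "p' $ 1 = A - B"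
    using PQ(1) unfolding germ_def by blast
  obtain q' A' B' where Q: "poly_fun n Q" "q = fps_to_fls q'" "q' $ 0 = Q vb"
    "((\<lambda>t. Q (upd vb k i t)) has_field_derivative A') (at (vb k i))"
    "((\<lambda>t. Q (upd vb k j t)) has_field_derivative B') (at (vb k j))" "q' $ 1 = A' - B'"
    using PQ(2) unfolding germ_def by blast
  \<comment> \<open>The power series of the quotient; its first two coefficients give value and derivative.\<close>
  define x where "x = p' * inverse q'"
  have q0: "q' $ 0 \<noteq> 0" using Q PQ by simp
  have xq: "x * q' = p'"
    unfolding x_def using inverse_mult_eq_1[OF q0] by (simp add: mult.assoc)
  have "q \<noteq> 0" using q0 Q(2) by auto
  moreover have "fps_to_fls x * q = g * q"
    using xq PQ(5) P(2) Q(2) by (simp flip: fls_times_fps_to_fls)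
  ultimately have gx: "g = fps_to_fls x" by simp
  have x0: "x $ 0 = P vb / Q vb"
    using arg_cong[OF xq, of "\<lambda>y. y $ 0"] P Q PQ by (simp add: field_simps)
  have "P vb / Q vb * (A' - B') + x $ 1 * Q vb = A - B"
    using arg_cong[OF xq, of "\<lambda>y. y $ 1"] unfolding fps_mult_nth_1 x0 P(6) Q(6) Q(3) .
  then have x1: "x $ 1 = ((A - B) - P vb / Q vb * (A' - B')) / Q vb"
    using PQ(3) by (simp add: eq_divide_eq algebra_simps)
  have rep: "represents n P Q f" using P Q PQ by (simp add: represents_def)
  show "rat_value n f vb = g $$ 0" using rat_value_eq[OF rep PQ(3)] x0 gx by simp
  show "order_ge 0 g" by (simp add: gx order_ge_def)
  have part: "rat_partial n k l f vb = (C * Q vb - P vb * C') / (Q vb * Q vb)"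
    if "((\<lambda>t. P (upd vb k l t)) has_field_derivative C) (at (vb k l))"
       "((\<lambda>t. Q (upd vb k l t)) has_field_derivative C') (at (vb k l))" for l C C'
  proof -
    have "isCont (\<lambda>t. Q (upd vb k l t)) (vb k l)" using that(2) by (rule DERIV_isCont)
    then have "((\<lambda>t. Q (upd vb k l t)) \<longlongrightarrow> Q (upd vb k l (vb k l))) (nhds (vb k l))"
      unfolding isCont_def by (subst (asm) tendsto_at_iff_tendsto_nhds)
    then have "((\<lambda>t. Q (upd vb k l t)) \<longlongrightarrow> Q vb) (nhds (vb k l))" by simp
    then have "\<forall>\<^sub>F t in nhds (vb k l). Q (upd vb k l t) \<noteq> 0"
      using PQ(3) by (rule tendsto_imp_eventually_ne)
    then have ev: "\<forall>\<^sub>F t in nhds (vb k l). rat_value n f (upd vb k l t) = P (upd vb k l t) / Q (upd vb k l t)"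
      by (rule eventually_mono) (rule rat_value_eq[OF rep])
    have "((\<lambda>t. P (upd vb k l t) / Q (upd vb k l t)) has_field_derivative (C * Q vb - P vb * C') / (Q vb * Q vb)) (at (vb k l))"
      using DERIV_divide[OF that] PQ(3) by simp
    then have "deriv (\<lambda>t. P (upd vb k l t) / Q (upd vb k l t)) (vb k l) = (C * Q vb - P vb * C') / (Q vb * Q vb)"
      by (rule DERIV_imp_deriv)
    then show ?thesis unfolding rat_partial_def using deriv_cong_ev[OF ev refl] by simp
  qed
  have "D_bar n k i j vb f = x $ 1 / 2"
    unfolding D_bar_def part[OF P(4) Q(4)] part[OF P(5) Q(5)] x1
    using PQ(3) by (simp add: field_simps power2_eq_square)
  then show "D_bar n k i j vb f = g $$ 1 / 2" by (simp add: gx)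
qed

end

section \<open>Germs of the Gelfand-Tsetlin coefficients\<close>

lemma lookup_lin_ext: "Poly_Mapping.lookup (lin_ext A f) c
    = (\<Sum>b\<in>Poly_Mapping.keys f. Poly_Mapping.lookup f b * Poly_Mapping.lookup (A b) c)"
  by (simp add: lin_ext_def lookup_sum)

lemma lin_ext_single: "lin_ext A (Poly_Mapping.single b 1) = A b"
  by (intro poly_mapping_eqI) (simp add: lookup_lin_ext)

lemma ext_translate: "ext n a (translate v z) = tableaux.entry n a v z"
  by (auto simp: fun_eq_iff ext_def translate_def tableaux.entry_def)

lemma gen_coeff_up:
  assumes "1 \<le> p"
  shows "gen_coeff n a p (p+1) z z' v
    = (\<Sum>q=1..p. if move 1 p q z = z' then tableaux.coef n a v 1 p q z else 0)"
proof -
  have "gen_coeff n a p (p+1) z z' v = Poly_Mapping.lookup (gen_up n a v p z) z'"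
    using assms unfolding gen_coeff_def gen_E.simps[of n a v p "p+1"] by (simp add: lin_ext_single)
  also have "\<dots> = (\<Sum>q=1..p. if move 1 p q z = z' then tableaux.coef n a v 1 p q z else 0)"
    unfolding gen_up_def Let_def ext_translate lookup_uminus lookup_sum lookup_single when_def
      sum_negf[symmetric] move_def tableaux.coef_def
    by (intro sum.cong refl) auto
  finally show ?thesis .
qed

lemma gen_coeff_down:
  assumes "1 \<le> p"
  shows "gen_coeff n a (p+1) p z z' v
    = (\<Sum>q=1..p. if move (-1) p q z = z' then tableaux.coef n a v (-1) p q z else 0)"
proof -
  have "gen_coeff n a (p+1) p z z' v = Poly_Mapping.lookup (gen_down n a v p z) z'"
    using assms unfolding gen_coeff_def gen_E.simps[of n a v "p+1" p] by (simp add: lin_ext_single)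
  also have "\<dots> = (\<Sum>q=1..p. if move (-1) p q z = z' then tableaux.coef n a v (-1) p q z else 0)"
    unfolding gen_down_def Let_def ext_translate lookup_sum lookup_single when_def
      move_def tableaux.coef_def
    by (intro sum.cong refl) auto
  finally show ?thesis .
qed

text \<open>The eigenvalue of \<open>E\<^sub>p\<^sub>p\<close> on \<open>T(v + z)\<close> as a function of \<open>v\<close>; its restriction to the line is \<open>weight\<close>.\<close>

definition cweight :: "nat \<Rightarrow> (nat \<Rightarrow> complex) \<Rightarrow> nat \<Rightarrow> shift \<Rightarrow> arr \<Rightarrow> complex" where
  "cweight n a p z v = (\<Sum>q=1..p. tableaux.entry n a v z p q + of_nat q - 1)
     - (\<Sum>q=1..p-1. tableaux.entry n a v z (p-1) q + of_nat q - 1)"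

lemma gen_coeff_diag: "gen_coeff n a p p z z' v = (if z = z' then cweight n a p z v else 0)"
  unfolding gen_coeff_def gen_E.simps[of n a v p p]
  by (simp add: lin_ext_single gen_diag_def Let_def lookup_single when_def cweight_def ext_translate)

lemma sign_cancel:
  fixes x :: "'a::field"
  assumes "x \<noteq> 0" "e * e = 1"
  shows "x * (N / ((e * x) * R)) = e * N / R"
proof -
  have e: "inverse e = e" using assms(2) by (rule inverse_unique)
  have "x * (N / ((e * x) * R)) = (x * inverse x) * (inverse e * N * inverse R)"
    by (simp only: divide_inverse inverse_mult_distrib mult_ac)
  then show ?thesis using assms(1) by (simp add: e divide_inverse)
qed

context singular_tableau
begin

lemma germ_entry:
  assumes "1 \<le> q" "q \<le> p" "p \<le> n"
  shows "germ (\<lambda>v. tableaux.entry n a v z p q) (entry z p q)"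
proof (cases "p = n")
  case True
  then show ?thesis by (simp add: entry_def tableaux.entry_def)
next
  case False
  then have "germ (\<lambda>v. v p q + of_int (z p q)) (line p q + fls_const (of_int (z p q)))"
    using assms by (intro germ_add germ_coord germ_const) auto
  then show ?thesis using False by (simp add: entry_def tableaux.entry_def fls_of_int)
qed

lemma germ_entry_diff:
  assumes "1 \<le> q" "q \<le> p" "p \<le> n" "1 \<le> u" "u \<le> r" "r \<le> n"
  shows "germ (\<lambda>v. tableaux.entry n a v z p q - tableaux.entry n a v z r u) (entry z p q - entry z r u)"
  by (intro germ_diff germ_entry assms)

lemma germ_pair: "germ (\<lambda>v. v k i - v k j) (2 * fls_X)"
proof -
  have "germ (\<lambda>v. v k i - v k j) (line k i - line k j)"
    using ij by (intro germ_diff germ_coord) auto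
  moreover have "line k i - line k j = 2 * fls_X"
    using ij by (simp add: line_def singular)
  ultimately show ?thesis by simp
qed

lemma germ_numerator:
  assumes p: "1 \<le> p" "p \<le> n - 1" "q \<in> {1..p}"
  shows "germ (\<lambda>v. if s = 1 then - (\<Prod>u=1..p+1. tableaux.entry n a v z p q - tableaux.entry n a v z (p+1) u)
      else (\<Prod>u=1..p-1. tableaux.entry n a v z p q - tableaux.entry n a v z (p-1) u))
     (if s = 1 then - (\<Prod>u=1..p+1. entry z p q - entry z (p+1) u)
      else (\<Prod>u=1..p-1. entry z p q - entry z (p-1) u))"
proof -
  have pn: "p + 1 \<le> n" "p \<le> n" "p - 1 \<le> n" using p by linarith+
  have q: "1 \<le> q" "q \<le> p" using p by auto
  show ?thesis
  proof (cases "s = 1")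
    case True
    show ?thesis
      unfolding if_P[OF True]
      by (intro germ_uminus germ_prod germ_entry_diff q pn) simp_all
  next
    case False
    show ?thesis
      unfolding if_not_P[OF False]
      by (intro germ_prod germ_entry_diff q pn) simp_all
  qed
qed

lemma generic_entry_diff:
  assumes "generic n v" "p \<le> n - 1" "q \<in> {1..p}" "u \<in> {1..p}" "q \<noteq> u"
  shows "tableaux.entry n a v z p q - tableaux.entry n a v z p u \<noteq> 0"
proof
  assume eq: "tableaux.entry n a v z p q - tableaux.entry n a v z p u = 0"
  have "p \<noteq> n" using assms ij by auto
  then have "v p q - v p u = of_int (z p u - z p q)" "v p u - v p q = of_int (z p q - z p u)"
    using eq by (simp_all add: tableaux.entry_def algebra_simps)
  then have "v p q - v p u \<in> \<int>" "v p u - v p q \<in> \<int>" by (metis Ints_of_int)+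
  then show False using assms unfolding generic_def atLeastAtMost_iff
    by (metis linorder_neqE_nat)
qed

lemma entry_diff_regular_0:
  assumes "p \<le> n - 1" "q \<in> {1..p}" "u \<in> {1..p}" "q \<noteq> u" "\<not> sing p q z"
  shows "(entry z p q - entry z p u) $$ 0 \<noteq> 0"
proof (cases "p = k \<and> {q, u} = {i, j}")
  case True
  then have "z k i \<noteq> z k j" using assms(5) by (auto simp: sing_def tau_eq_iff doubleton_eq_iff)
  then have "(entry z k i - entry z k j) $$ 0 \<noteq> 0" unfolding entry_diff_pair_nth by simp
  then show ?thesis using True by (auto simp: doubleton_eq_iff)
next
  case False
  then show ?thesis using entry_diff_row_not_int[OF assms(1-4), of z z] by (metis Ints_0)
qed

lemma rgerm_coef:
  assumes p: "1 \<le> p" "p \<le> n - 1" "q \<in> {1..p}" and ns: "\<not> sing p q z"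
  shows "rgerm (\<lambda>v. tableaux.coef n a v s p q z) (coef s p q z)"
  unfolding coef_def tableaux.coef_def
proof (rule rgerm_divide[OF germ_numerator[OF p]])
  let ?Q = "\<lambda>v. \<Prod>u\<in>{1..p} - {q}. tableaux.entry n a v z p q - tableaux.entry n a v z p u"
  have pn: "p \<le> n" using p by linarith
  show g: "germ ?Q (\<Prod>u\<in>{1..p} - {q}. entry z p q - entry z p u)"
    using p(3) pn by (intro germ_prod germ_entry_diff) auto
  have "(\<Prod>u\<in>{1..p} - {q}. entry z p q - entry z p u) $$ 0 \<noteq> 0"
    using p ns entry_diff_regular_0[of p q _ z] by (intro leading_prod order_ge_diff entry_regular) auto
  then show "?Q vb \<noteq> 0" using germ_0[OF g] by simp
  show "?Q v \<noteq> 0" if "generic n v" for v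
    using generic_entry_diff[OF that p(2,3)] by auto
qed

text \<open>If the coefficient has a pole, its denominator contains the factor \<open>x - y\<close> up to sign, which cancels;
on the line \<open>x - y\<close> is \<open>2 t\<close>.\<close>

lemma rgerm_pair_coef:
  assumes p: "1 \<le> p" "p \<le> n - 1" "q \<in> {1..p}"
  shows "rgerm (\<lambda>v. (v k i - v k j) * tableaux.coef n a v s p q z) (2 * fls_X * coef s p q z)"
proof (cases "sing p q z")
  case False
  then show ?thesis by (intro rgerm_mult rgerm_germ[OF germ_pair] rgerm_coef p)
next
  case True
  define q' where "q' = perm k q"
  have pk: "p = k" "q = i \<or> q = j" "z k i = z k j" using True by (auto simp: sing_def tau_eq_iff)
  have q': "q' \<in> {1..p} - {q}" "{q, q'} = {i, j}"
    using pk ij by (auto simp: q'_def perm_def Transposition.transpose_def)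
  define \<epsilon> :: complex where "\<epsilon> = (if q = i then 1 else -1)"
  have \<epsilon>: "\<epsilon> * \<epsilon> = 1" by (simp add: \<epsilon>_def)
  let ?N = "\<lambda>v. if s = 1 then - (\<Prod>u=1..p+1. tableaux.entry n a v z p q - tableaux.entry n a v z (p+1) u)
      else (\<Prod>u=1..p-1. tableaux.entry n a v z p q - tableaux.entry n a v z (p-1) u)"
  let ?R = "\<lambda>v. \<Prod>u\<in>{1..p} - {q} - {q'}. tableaux.entry n a v z p q - tableaux.entry n a v z p u"
  define N where "N = (if s = 1 then - (\<Prod>u=1..p+1. entry z p q - entry z (p+1) u)
      else (\<Prod>u=1..p-1. entry z p q - entry z (p-1) u))"
  define R where "R = (\<Prod>u\<in>{1..p} - {q} - {q'}. entry z p q - entry z p u)"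
  have pn: "p \<le> n" "k \<noteq> n" using p ij by linarith+
  have gN: "germ (\<lambda>v. \<epsilon> * ?N v) (fls_const \<epsilon> * N)"
    unfolding N_def by (intro germ_mult germ_const germ_numerator p)
  have gR: "germ ?R R" unfolding R_def
    using p(3) pn by (intro germ_prod germ_entry_diff) auto
  have ind: "\<not> {q, u} = {i, j}" if "u \<noteq> q'" for u
    using that q' by (auto simp: doubleton_eq_iff)
  have "(entry z p q - entry z p u) $$ 0 \<noteq> 0" if "u \<in> {1..p} - {q} - {q'}" for u
    using entry_diff_row_not_int[OF p(2,3), of u z z] that ind[of u] by (metis DiffE Ints_0 insertI1)
  then have R0: "R $$ 0 \<noteq> 0"
    unfolding R_def by (intro leading_prod order_ge_diff entry_regular) auto
  have Rg: "?R v \<noteq> 0" if "generic n v" for v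
    using generic_entry_diff[OF that p(2,3)] by auto
  have rg: "rgerm (\<lambda>v. \<epsilon> * ?N v / ?R v) (fls_const \<epsilon> * N / R)"
    using germ_0[OF gR] R0 Rg by (intro rgerm_divide gN gR) auto
  have K: "2 * fls_X * coef s p q z = fls_const \<epsilon> * N / R"
  proof -
    have "entry z p q - entry z p q' = fls_const \<epsilon> * (2 * fls_X)"
    proof (cases "q = i")
      case True
      then have "q' = j" using q' by (auto simp: doubleton_eq_iff)
      then show ?thesis using entry_diff_pair[of z] True pk by (simp add: \<epsilon>_def)
    next
      case False
      then have "q = j" "q' = i" using q' by (auto simp: doubleton_eq_iff)
      then have "entry z p q - entry z p q' = - (entry z k i - entry z k j)" using pk by simp
      then show ?thesis
        using entry_diff_pair[of z] False pk(3) const_minus_one[of "2 * fls_X"] by (simp add: \<epsilon>_def)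
    qed
    then have "(\<Prod>u\<in>{1..p} - {q}. entry z p q - entry z p u) = (fls_const \<epsilon> * (2 * fls_X)) * R"
      unfolding R_def using q' by (subst prod.remove[of _ q']) auto
    then have "coef s p q z = N / ((fls_const \<epsilon> * (2 * fls_X)) * R)"
      by (simp only: coef_def N_def)
    moreover have E: "fls_const \<epsilon> * fls_const \<epsilon> = 1" using \<epsilon> by simp
    moreover have X: "2 * fls_X \<noteq> (0 :: complex fls)" by simp
    ultimately show ?thesis by (simp only: sign_cancel[OF X E])
  qed
  show ?thesis
    unfolding K
  proof (rule rgerm_cong[OF rg])
    fix v assume v: "generic n v"
    have "v k i - v k j \<notin> \<int>" using v ij by (auto simp: generic_def)
    then have xy: "v k i - v k j \<noteq> 0" by auto
    have "tableaux.entry n a v z p q - tableaux.entry n a v z p q' = \<epsilon> * (v k i - v k j)"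
      using q' pk pn by (auto simp: \<epsilon>_def tableaux.entry_def doubleton_eq_iff)
    then have "(\<Prod>u\<in>{1..p} - {q}. tableaux.entry n a v z p q - tableaux.entry n a v z p u)
        = (\<epsilon> * (v k i - v k j)) * ?R v"
      using q' by (subst prod.remove[of _ q']) auto
    then have "tableaux.coef n a v s p q z = ?N v / ((\<epsilon> * (v k i - v k j)) * ?R v)"
      by (simp only: tableaux.coef_def)
    then show "(v k i - v k j) * tableaux.coef n a v s p q z = \<epsilon> * ?N v / ?R v"
      by (simp only: sign_cancel[OF xy \<epsilon>])
  qed
qed

lemma germ_cweight:
  assumes "1 \<le> p" "p \<le> n - 1"
  shows "germ (cweight n a p z) (weight p z)"
proof -
  have pn: "p \<le> n" "p - 1 \<le> n" using assms by linarith+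
  have c: "germ (\<lambda>v. of_nat q) (of_nat q)" for q
    using germ_const[of "of_nat q"] by (simp add: fls_of_nat)
  have "germ (\<lambda>v. cweight n a p z v) (weight p z)"
    unfolding cweight_def weight_def
    using germ_const[of 1] pn by (intro germ_diff germ_sum germ_add germ_entry c) auto
  then show ?thesis .
qed

lemma weight_tau: "weight p (\<tau> z) = flip (weight p z)"
proof -
  have eq: "weight p z = row_sum p z - row_sum (p-1) z + (of_nat (\<Sum>q=1..p. q) - of_nat p - of_nat (\<Sum>q=1..p-1. q) + of_nat (p-1))" for z
    by (simp add: weight_def row_sum_def sum.distrib sum_subtractf)
  show ?thesis unfolding eq by (simp only: row_sum_tau flip_simps)
qed

end

section \<open>The singular module as a quotient of the lattice\<close>

context singular_tableau
begin

text \<open>The function with value \<open>x\<close> at \<open>z\<close>, made invariant by adding its mirror image.\<close>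

definition vec :: "complex fls \<Rightarrow> shift \<Rightarrow> shift \<Rightarrow> complex fls" where
  "vec x z y = (if y = z then x else 0) + (if y = \<tau> z then flip x else 0)"

text \<open>The isomorphism of the singular module with the quotient of the lattice by \<open>t\<^sup>2 L\<close>, on representatives.\<close>

definition Psi :: "(symb \<Rightarrow>\<^sub>0 complex) \<Rightarrow> shift \<Rightarrow> complex fls" where
  "Psi f y = fls_const (Poly_Mapping.lookup f (Tab y) + Poly_Mapping.lookup f (Tab (\<tau> y)))
     + fls_const ((Poly_Mapping.lookup f (DTab y) - Poly_Mapping.lookup f (DTab (\<tau> y))) / 2) * fls_X_inv"

lemma tau_eq_swap: "\<tau> z = y \<longleftrightarrow> z = \<tau> y"
  by (metis tau_tau)

lemma Tvec_vec: "Tvec z = vec 1 z"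
  by (rule ext) (simp add: Tvec_def vec_def)

lemma Dvec_vec: "Dvec z = vec (fls_const (1/2) * fls_X_inv) z"
  by (rule ext) (simp add: Dvec_def vec_def flip_X_inv)

lemma Psi_tab: "Psi (tab z) = Tvec z"
proof
  fix y
  have "z = \<tau> y \<longleftrightarrow> y = \<tau> z" "z = y \<longleftrightarrow> y = z" using tau_eq_swap by blast+
  then show "Psi (tab z) y = Tvec z y"
    by (simp add: Psi_def Tvec_def lookup_single when_def fls_eq_iff)
qed

lemma Psi_dtab: "Psi (dtab z) = Dvec z"
proof
  fix y
  have "z = \<tau> y \<longleftrightarrow> y = \<tau> z" "z = y \<longleftrightarrow> y = z" using tau_eq_swap by blast+
  then show "Psi (dtab z) y = Dvec z y"
    by (simp add: Psi_def Dvec_def lookup_single when_def fls_eq_iff)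
qed

lemma Psi_add: "Psi (f + g) y = Psi f y + Psi g y"
  by (simp add: Psi_def lookup_add fls_eq_iff algebra_simps add_divide_distrib diff_divide_distrib)

lemma Psi_scale: "Psi (cscale c f) y = fls_const c * Psi f y"
  by (simp add: Psi_def fls_eq_iff algebra_simps)

lemma Psi_zero: "Psi 0 y = 0"
  by (simp add: Psi_def)

lemma Psi_sum: "Psi (sum f A) y = (\<Sum>b\<in>A. Psi (f b) y)"
  by (induction A rule: infinite_finite_induct) (simp_all add: Psi_add Psi_zero)

lemma Psi_diff: "Psi (f - g) y = Psi f y - Psi g y"
  using Psi_add[of "f - g" g y] by simp

lemma vec_add: "vec (x + x') z y = vec x z y + vec x' z y"
  and vec_diff: "vec (x - x') z y = vec x z y - vec x' z y"
  and vec_zero: "vec 0 z y = 0"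
  by (auto simp: vec_def)

lemma vec_sum: "vec (sum g A) z y = (\<Sum>q\<in>A. vec (g q) z y)"
  by (induction A rule: infinite_finite_induct) (simp_all add: vec_add vec_zero)

lemma order_ge_vec: "order_ge d x \<Longrightarrow> order_ge d (vec x z y)"
  by (auto simp: vec_def intro!: order_ge_add)

text \<open>The definition of \<open>\<D>\<close> on combinations is truncation: if \<open>2 t c\<close> is the germ of \<open>f\<close>, then \<open>\<D>(f)\<close> and \<open>f(vb)\<close>
are the constant term of \<open>c\<close> and twice its residue, and \<open>Psi\<close> of \<open>\<D>(f) T + f(vb) DT\<close> is the part of \<open>c\<close> of
order at most \<open>0\<close>, made invariant.\<close>

lemma Psi_D_comb:
  fixes A :: "'q set" and m :: "'q \<Rightarrow> shift"
  assumes A: "finite A" and F: "\<And>z' v. F z' v = (\<Sum>q\<in>A. if m q = z' then f q v else 0)"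
    and f: "\<And>q. q \<in> A \<Longrightarrow> rgerm (f q) (2 * fls_X * c q)"
    and c: "\<And>q. q \<in> A \<Longrightarrow> order_ge (-1) (c q)"
  shows "order_ge 1 (Psi (D_comb n k i j vb F) y - (\<Sum>q\<in>A. vec (c q) (m q) y))"
proof -
  define G where "G = (\<lambda>z'. \<Sum>q\<in>{q\<in>A. m q = z'}. c q)"
  have FG: "rgerm (F z') (2 * fls_X * G z')" for z'
  proof -
    have "rgerm (\<lambda>v. \<Sum>q\<in>{q\<in>A. m q = z'}. f q v) (\<Sum>q\<in>{q\<in>A. m q = z'}. 2 * fls_X * c q)"
      by (intro rgerm_sum f) auto
    moreover have "F z' v = (\<Sum>q\<in>{q\<in>A. m q = z'}. f q v)" for v
      unfolding F using A by (simp add: sum.inter_filter)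
    moreover have "(\<Sum>q\<in>{q\<in>A. m q = z'}. 2 * fls_X * c q) = 2 * fls_X * G z'"
      by (simp add: G_def sum_distrib_left)
    ultimately show ?thesis by (simp add: rgerm_cong)
  qed
  have G: "order_ge (-1) (G z')" for z' unfolding G_def by (intro order_ge_sum c) auto
  have "((2 :: complex fls) * fls_X * x) $$ l = 2 * x $$ (l - 1)" for x l
    unfolding mult.assoc fls_mult_of_numeral_nth by (simp add: fls_X_times_conv_shift)
  then have rv: "rat_value n (F z') vb = 2 * G z' $$ (-1)" and Db: "D_bar n k i j vb (F z') = G z' $$ 0" for z'
    using rgerm_value(1,2)[OF FG, of z'] by simp_all
  have zero: "rat_value n (F z') vb = 0" "D_bar n k i j vb (F z') = 0"
    if "\<not> (\<exists>v. generic n v \<and> F z' v \<noteq> 0)" for z'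
  proof -
    have "rgerm (F z') 0"
      using rgerm_cong[OF rgerm_germ[OF germ_const[of 0]], of "F z'"] that by auto
    then show "rat_value n (F z') vb = 0" "D_bar n k i j vb (F z') = 0"
      using rgerm_value(1,2)[of "F z'" 0] by simp_all
  qed
  let ?t = "\<lambda>z'. cscale (D_bar n k i j vb (F z')) (tab z') + cscale (rat_value n (F z') vb) (dtab z')"
  have t0: "cscale 0 x = 0" for x :: "symb \<Rightarrow>\<^sub>0 complex" by (rule free.scale_zero_left)
  have "F z' v = 0" if "z' \<notin> m ` A" for z' v
    unfolding F using that by (intro sum.neutral) auto
  then have "{z'. \<exists>v. generic n v \<and> F z' v \<noteq> 0} \<subseteq> m ` A" by blast
  then have "D_comb n k i j vb F = (\<Sum>z'\<in>m ` A. ?t z')"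
    unfolding D_comb_def using A zero t0 by (intro sum.mono_neutral_left) auto
  then have "Psi (D_comb n k i j vb F) y
      = (\<Sum>z'\<in>m ` A. fls_const (G z' $$ 0) * Tvec z' y + fls_const (2 * G z' $$ (-1)) * Dvec z' y)"
    by (simp add: Psi_sum Psi_add Psi_scale Psi_tab Psi_dtab rv Db)
  also have "\<dots> = (\<Sum>z'\<in>m ` A. vec (fls_const (G z' $$ 0) + fls_const (G z' $$ (-1)) * fls_X_inv) z' y)"
    by (intro sum.cong refl) (auto simp: Tvec_def Dvec_def vec_def flip_X_inv fls_eq_iff)
  finally have 1: "Psi (D_comb n k i j vb F) y = \<dots>" .
  have 2: "(\<Sum>q\<in>A. vec (c q) (m q) y) = (\<Sum>z'\<in>m ` A. vec (G z') z' y)"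
    unfolding G_def vec_sum sum.image_gen[OF A, of "\<lambda>q. vec (c q) (m q) y" m] by (intro sum.cong refl) auto
  have "order_ge 1 (fls_const (G z' $$ 0) + fls_const (G z' $$ (-1)) * fls_X_inv - G z')" for z'
  proof -
    have "order_ge (-1) (fls_const (G z' $$ (-1)) * fls_X_inv)"
      by (rule order_ge_mult_eq[of 0 _ "-1"]) auto
    then show ?thesis
      unfolding order_ge_1_iff order_ge_0_iff using G[of z'] by (auto intro!: order_ge_add order_ge_diff)
  qed
  then show ?thesis
    unfolding 1 2 sum_subtractf[symmetric] vec_diff[symmetric]
    by (intro order_ge_sum order_ge_vec)
qed

text \<open>Both clauses of the action are instances of \<open>Psi_D_comb\<close>: with \<open>(x - y)\<close> times the coefficients,
of germ \<open>2 t c\<close>, for \<open>T\<close>, and with the coefficients themselves, of germ \<open>2 t (c / 2t)\<close>, for \<open>DT\<close>.\<close>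

lemma Psi_sing_E:
  fixes A :: "'q set" and m :: "'q \<Rightarrow> shift"
  assumes A: "finite A" and gen: "\<And>z' v. gen_coeff n a r s z z' v = (\<Sum>q\<in>A. if m q = z' then C q v else 0)"
    and sing: "\<And>q. q \<in> A \<Longrightarrow> rgerm (\<lambda>v. (v k i - v k j) * C q v) (2 * fls_X * c q)"
    and reg: "\<And>q. q \<in> A \<Longrightarrow> \<tau> z \<noteq> z \<Longrightarrow> rgerm (C q) (c q)"
    and c: "\<And>q. q \<in> A \<Longrightarrow> order_ge (-1) (c q)"
    and Op: "\<And>x y. Op (vec x z) y = (\<Sum>q\<in>A. vec (x * c q) (m q) y)"
  shows "order_ge 1 (Psi (sing_E_symb n k i j a vb r s (Tab z)) y - Op (Tvec z) y)"
    "order_ge 1 (Psi (sing_E_symb n k i j a vb r s (DTab z)) y - Op (Dvec z) y)"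
proof -
  have F: "(v k i - v k j) * gen_coeff n a r s z z' v = (\<Sum>q\<in>A. if m q = z' then (v k i - v k j) * C q v else 0)" for z' v
    unfolding gen sum_distrib_left by (intro sum.cong refl) simp
  show "order_ge 1 (Psi (sing_E_symb n k i j a vb r s (Tab z)) y - Op (Tvec z) y)"
    unfolding Tvec_vec Op sing_E_symb.simps mult_1_left
    by (rule Psi_D_comb[OF A F]) (fact sing, fact c)
  show "order_ge 1 (Psi (sing_E_symb n k i j a vb r s (DTab z)) y - Op (Dvec z) y)"
  proof (cases "\<tau> z = z")
    case True
    then have "Dvec z y = vec 0 z y" for y by (simp add: Dvec_def vec_def)
    then have "Dvec z = vec 0 z" by (rule ext)
    then show ?thesis using True by (simp add: \<tau>_def Op vec_zero Psi_zero)
  next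
    case False
    let ?h = "fls_const (1/2) * fls_X_inv"
    have h: "2 * fls_X * (?h * c q) = c q" for q
    proof -
      have "fls_X * fls_X_inv = (1 :: complex fls)" by (simp add: fls_inverse_X[symmetric])
      moreover have "2 * fls_const (1/2) = (1 :: complex fls)"
        by (simp add: fls_eq_iff)
      moreover have "2 * fls_X * (?h * c q) = (2 * fls_const (1/2)) * (fls_X * fls_X_inv) * c q"
        by (simp only: mult_ac)
      ultimately show ?thesis by simp
    qed
    have "sing_E_symb n k i j a vb r s (DTab z) = D_comb n k i j vb (gen_coeff n a r s z)"
      using False by (simp add: \<tau>_def)
    moreover have "order_ge 1 (Psi (D_comb n k i j vb (gen_coeff n a r s z)) y - (\<Sum>q\<in>A. vec (?h * c q) (m q) y))"
    proof (rule Psi_D_comb[OF A gen])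
      fix q assume q: "q \<in> A"
      show "rgerm (C q) (2 * fls_X * (?h * c q))" unfolding h by (rule reg[OF q False])
      have "order_ge (-1) ?h" by (rule order_ge_mult_eq[of 0 _ "-1"]) auto
      then show "order_ge (-1) (?h * c q)"
        using rgerm_value(3)[OF reg[OF q False]] by (rule order_ge_mult_eq) simp
    qed
    ultimately show ?thesis unfolding Dvec_vec Op by simp
  qed
qed

lemma ladder_vec: "ladder s p (vec x z) y = (\<Sum>q=1..p. vec (x * coef s p q z) (move s p q z) y)"
proof -
  have mv: "move (- s) p q y = w \<longleftrightarrow> y = move s p q w" for q w
    by (metis move_inverse)
  have pick: "coef s p q (move (- s) p q y) * (if y = move s p q w then x' else 0)
      = (if y = move s p q w then coef s p q w * x' else 0)" for q w x'
    by auto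
  have "ladder s p (vec x z) y
      = (\<Sum>q=1..p. if y = move s p q z then coef s p q z * x else 0)
      + (\<Sum>q=1..p. if y = move s p q (\<tau> z) then coef s p q (\<tau> z) * flip x else 0)"
    unfolding ladder_def vec_def mv sum.distrib[symmetric] distrib_left pick by (rule refl)
  also have "(\<Sum>q=1..p. if y = move s p q (\<tau> z) then coef s p q (\<tau> z) * flip x else 0)
      = (\<Sum>q=1..p. if y = \<tau> (move s p (perm p q) z) then flip (coef s p (perm p q) z * x) else 0)"
    by (intro sum.cong refl) (simp add: move_tau coef_tau)
  also have "\<dots> = (\<Sum>q=1..p. if y = \<tau> (move s p q z) then flip (coef s p q z * x) else 0)"
    by (rule sum_row_perm)
  finally have eq: "ladder s p (vec x z) y
      = (\<Sum>q=1..p. if y = move s p q z then coef s p q z * x else 0)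
      + (\<Sum>q=1..p. if y = \<tau> (move s p q z) then flip (coef s p q z * x) else 0)" .
  show ?thesis unfolding eq vec_def sum.distrib by (simp only: mult.commute)
qed

lemma weight_vec: "weight p y * vec x z y = vec (x * weight p z) z y"
proof -
  have pick: "weight p y * (if y = w then x' else 0) = (if y = w then weight p w * x' else 0)" for w x'
    by auto
  show ?thesis unfolding vec_def distrib_left pick weight_tau by (simp add: mult.commute)
qed

lemma coef_order: "1 \<le> p \<Longrightarrow> p \<le> n - 1 \<Longrightarrow> q \<in> {1..p} \<Longrightarrow> order_ge (-1) (coef s p q z)"
  using coef_leading(1)[of p q z s] by (auto intro: order_ge_mono split: if_splits)

lemma Psi_up:
  assumes p: "1 \<le> p" "p \<le> n - 1"
  shows "order_ge 1 (Psi (sing_E_symb n k i j a vb p (p+1) (Tab z)) y - ladder 1 p (Tvec z) y)"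
    "order_ge 1 (Psi (sing_E_symb n k i j a vb p (p+1) (DTab z)) y - ladder 1 p (Dvec z) y)"
  using rgerm_coef[OF p, of _ z 1]
  by (intro Psi_sing_E[OF finite_atLeastAtMost gen_coeff_up[OF p(1)] rgerm_pair_coef[OF p] _ coef_order[OF p] ladder_vec];
      simp add: sing_def)+

lemma Psi_down:
  assumes p: "1 \<le> p" "p \<le> n - 1"
  shows "order_ge 1 (Psi (sing_E_symb n k i j a vb (p+1) p (Tab z)) y - ladder (-1) p (Tvec z) y)"
    "order_ge 1 (Psi (sing_E_symb n k i j a vb (p+1) p (DTab z)) y - ladder (-1) p (Dvec z) y)"
  using rgerm_coef[OF p, of _ z "-1"]
  by (intro Psi_sing_E[OF finite_atLeastAtMost gen_coeff_down[OF p(1)] rgerm_pair_coef[OF p] _ coef_order[OF p] ladder_vec];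
      simp add: sing_def)+

lemma Psi_diag:
  assumes p: "1 \<le> p" "p \<le> n - 1"
  shows "order_ge 1 (Psi (sing_E_symb n k i j a vb p p (Tab z)) y - weight p y * Tvec z y)"
    "order_ge 1 (Psi (sing_E_symb n k i j a vb p p (DTab z)) y - weight p y * Dvec z y)"
proof -
  have 1: "gen_coeff n a p p z z' v = (\<Sum>q\<in>{()}. if z = z' then cweight n a p z v else 0)" for z' v
    by (simp add: gen_coeff_diag)
  have 2: "weight p y * vec x z y = (\<Sum>q\<in>{()}. vec (x * weight p z) z y)" for x y
    by (simp add: weight_vec)
  have g: "rgerm (cweight n a p z) (weight p z)" by (rule rgerm_germ[OF germ_cweight[OF p]])
  have 3: "rgerm (\<lambda>v. (v k i - v k j) * cweight n a p z v) (2 * fls_X * weight p z)"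
    by (rule rgerm_mult[OF rgerm_germ[OF germ_pair] g])
  have 4: "order_ge (-1) (weight p z)" using rgerm_value(3)[OF g] by (rule order_ge_mono) simp
  show "order_ge 1 (Psi (sing_E_symb n k i j a vb p p (Tab z)) y - weight p y * Tvec z y)"
    "order_ge 1 (Psi (sing_E_symb n k i j a vb p p (DTab z)) y - weight p y * Dvec z y)"
    by (rule Psi_sing_E[where A = "{()}" and m = "\<lambda>_. z" and C = "\<lambda>_. cweight n a p z" and c = "\<lambda>_. weight p z"
        and Op = "\<lambda>h y. weight p y * h y", OF _ 1 3 g 4 2]; simp)+
qed

end

section \<open>Irreducibility\<close>

lemma coset_eq_iff:
  assumes "free.subspace R"
  shows "coset R f = coset R g \<longleftrightarrow> f - g \<in> R"
proof
  assume "coset R f = coset R g"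
  moreover have "f \<in> coset R f" using free.subspace_0[OF assms] by (simp add: coset_def)
  ultimately have "f \<in> coset R g" by simp
  then show "f - g \<in> R" by (simp add: coset_def)
next
  assume fg: "f - g \<in> R"
  have "h - f \<in> R \<longleftrightarrow> h - g \<in> R" for h
  proof
    show "h - g \<in> R" if "h - f \<in> R" using free.subspace_add[OF assms that fg] by simp
    show "h - f \<in> R" if "h - g \<in> R" using free.subspace_diff[OF assms that fg] by simp
  qed
  then show "coset R f = coset R g" by (simp add: coset_def)
qed

lemma mem_coset: "free.subspace R \<Longrightarrow> f \<in> coset R f"
  by (simp add: coset_def free.subspace_0)

lemma coset_add:
  assumes R: "free.subspace R"
  shows "(\<Union>f\<in>coset R f0. \<Union>g\<in>coset R g0. coset R (f + g)) = coset R (f0 + g0)"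
proof -
  have "coset R (f + g) = coset R (f0 + g0)" if "f \<in> coset R f0" "g \<in> coset R g0" for f g
  proof -
    have "(f - f0) + (g - g0) \<in> R"
      using that by (intro free.subspace_add[OF R]) (auto simp: coset_def)
    then show ?thesis by (simp add: coset_eq_iff[OF R] algebra_simps)
  qed
  then show ?thesis using mem_coset[OF R] by blast
qed

lemma coset_scale:
  assumes R: "free.subspace R"
  shows "(\<Union>f\<in>coset R f0. coset R (cscale c f)) = coset R (cscale c f0)"
proof -
  have "coset R (cscale c f) = coset R (cscale c f0)" if "f \<in> coset R f0" for f
  proof -
    have "cscale c (f - f0) \<in> R" using that by (intro free.subspace_scale[OF R]) (simp add: coset_def)
    then show ?thesis by (simp add: coset_eq_iff[OF R] free.scale_right_diff_distrib)
  qed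
  then show ?thesis using mem_coset[OF R] by blast
qed

lemma subspace_symb_space: "free.subspace (symb_space n)"
proof (rule free.subspaceI)
  fix f g :: "symb \<Rightarrow>\<^sub>0 complex" and c :: complex
  show "0 \<in> symb_space n" by (simp add: symb_space_def)
  show "f + g \<in> symb_space n" if "f \<in> symb_space n" "g \<in> symb_space n"
    using that keys_add[of f g] by (auto simp: symb_space_def)
  have "Poly_Mapping.keys (cscale c f) \<subseteq> Poly_Mapping.keys f" by (auto simp: in_keys_iff)
  then show "cscale c f \<in> symb_space n" if "f \<in> symb_space n"
    using that by (auto simp: symb_space_def)
qed

lemma single_symb_space: "b \<in> Tab ` shifts n \<union> DTab ` shifts n \<Longrightarrow> Poly_Mapping.single b 1 \<in> symb_space n"
  by (simp add: symb_space_def)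

lemma combination: "f = (\<Sum>b\<in>Poly_Mapping.keys f. cscale (Poly_Mapping.lookup f b) (Poly_Mapping.single b 1))"
proof (intro poly_mapping_eqI)
  fix c
  have "(\<Sum>b\<in>Poly_Mapping.keys f. Poly_Mapping.lookup f b * (1 when b = c)) = Poly_Mapping.lookup f c"
    by (cases "c \<in> Poly_Mapping.keys f")
       (auto simp: when_def in_keys_iff sum.delta' if_distrib[of "(*) _"] cong: if_cong)
  then show "Poly_Mapping.lookup f c
      = Poly_Mapping.lookup (\<Sum>b\<in>Poly_Mapping.keys f. cscale (Poly_Mapping.lookup f b) (Poly_Mapping.single b 1)) c"
    by (simp add: lookup_sum lookup_single)
qed

context singular_tableau
begin

abbreviation R where "R \<equiv> relators n k i j"

lemma subspace_R: "free.subspace R"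
  unfolding relators_def by (rule free.subspace_span)

lemma relator_tab: "z \<in> shifts n \<Longrightarrow> tab z - tab (\<tau> z) \<in> R"
  and relator_dtab: "z \<in> shifts n \<Longrightarrow> dtab z + dtab (\<tau> z) \<in> R"
  unfolding relators_def \<tau>_def by (auto intro: free.span_base)

lemma Tvec_tau: "Tvec (\<tau> z) y = Tvec z y"
  by (simp add: Tvec_def add.commute)

lemma R_symb_space: "R \<subseteq> symb_space n"
  unfolding relators_def \<tau>_def[symmetric]
  by (rule free.span_minimal[OF _ subspace_symb_space])
     (auto intro!: free.subspace_diff[OF subspace_symb_space] free.subspace_add[OF subspace_symb_space]
        single_symb_space)

lemma Psi_R:
  assumes "f \<in> R"
  shows "Psi f y = 0"
proof -
  have sub: "free.subspace {f. Psi f y = 0}"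
    by (rule free.subspaceI) (auto simp: Psi_zero Psi_add Psi_scale)
  have "R \<subseteq> {f. Psi f y = 0}"
    unfolding relators_def \<tau>_def[symmetric]
    by (rule free.span_minimal[OF _ sub])
       (auto simp: Psi_diff Psi_add Psi_tab Psi_dtab Tvec_tau Dvec_tau)
  then show ?thesis using assms by blast
qed

lemma Psi_lattice:
  assumes f: "f \<in> symb_space n"
  shows "Psi f \<in> lattice"
proof -
  define T where "T = {y. Tab y \<in> Poly_Mapping.keys f \<or> DTab y \<in> Poly_Mapping.keys f}"
  have "T = Tab -` Poly_Mapping.keys f \<union> DTab -` Poly_Mapping.keys f" by (auto simp: T_def)
  then have finT: "finite T" by (auto intro!: finite_vimageI injI)
  have Tsh: "T \<subseteq> shifts n" using f by (auto simp: T_def symb_space_def)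
  have nz: "y \<in> T \<or> \<tau> y \<in> T" if "Psi f y \<noteq> 0" for y
    using that by (auto simp: Psi_def T_def in_keys_iff)
  show ?thesis
  proof (rule latticeI[of "T \<union> \<tau> ` T"])
    fix y
    show "y \<in> T \<union> \<tau> ` T" if "Psi f y \<noteq> 0" using nz[OF that] by (metis UnI1 UnI2 image_eqI tau_tau)
    show "y \<in> shifts n" if "Psi f y \<noteq> 0" using nz[OF that] Tsh tau_shifts by blast
    show "Psi f (\<tau> y) = flip (Psi f y)"
      by (simp add: Psi_def flip_X_inv fls_eq_iff algebra_simps diff_divide_distrib)
    show "order_ge (-1) (Psi f y)"
      unfolding Psi_def by (intro order_ge_add order_ge_mult_eq[of 0 _ "-1"]) auto
  qed (use finT in auto)
qed

text \<open>If the coefficients of \<open>f\<close> at \<open>Tab\<close> are antisymmetric and those at \<open>DTab\<close> symmetric under \<open>\<tau>\<close>, then \<open>f\<close> is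
half the sum of the relators with the coefficients of \<open>f\<close>.\<close>

lemma Psi_small_R:
  assumes f: "f \<in> symb_space n" and small: "Psi f \<in> small"
  shows "f \<in> R"
proof -
  let ?l = "Poly_Mapping.lookup f"
  have o: "order_ge 1 (Psi f y)" for y using small by (simp add: small_def)
  have A: "?l (Tab (\<tau> y)) = - ?l (Tab y)" for y
    using o[of y] by (simp add: order_ge_1_iff Psi_def eq_neg_iff_add_eq_0 add.commute)
  have B: "?l (DTab (\<tau> y)) = ?l (DTab y)" for y
    using o[of y] by (simp add: order_ge_1_iff order_ge_0_iff Psi_def)
  define T where "T = {y. Tab y \<in> Poly_Mapping.keys f \<or> DTab y \<in> Poly_Mapping.keys f}"
  have "T = Tab -` Poly_Mapping.keys f \<union> DTab -` Poly_Mapping.keys f" by (auto simp: T_def)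
  then have finT: "finite T" by (auto intro!: finite_vimageI injI)
  have Tsh: "T \<subseteq> shifts n" using f by (auto simp: T_def symb_space_def)
  have Tt: "\<tau> y \<in> T \<longleftrightarrow> y \<in> T" for y by (simp add: T_def in_keys_iff A B)
  define g where "g = (\<Sum>y\<in>T. cscale (?l (Tab y) / 2) (tab y - tab (\<tau> y)) + cscale (?l (DTab y) / 2) (dtab y + dtab (\<tau> y)))"
  have "g \<in> R" unfolding g_def
    by (intro free.subspace_sum[OF subspace_R] free.subspace_add[OF subspace_R] free.subspace_scale[OF subspace_R]
        relator_tab relator_dtab) (use Tsh in auto)
  moreover have "f = g"
  proof (rule poly_mapping_eqI)
    fix b
    have eqs: "\<tau> y = x \<longleftrightarrow> y = \<tau> x" for x y by (rule tau_eq_swap)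
    show "?l b = Poly_Mapping.lookup g b"
    proof (cases b)
      case (Tab x)
      have "Poly_Mapping.lookup g b = (\<Sum>y\<in>T. (if y = x then ?l (Tab y) / 2 else 0) - (if y = \<tau> x then ?l (Tab y) / 2 else 0))"
        unfolding g_def lookup_sum
        by (intro sum.cong refl) (auto simp: Tab lookup_add lookup_minus lookup_single when_def eqs)
      also have "\<dots> = ?l (Tab x)"
        using finT Tt[of x] by (auto simp: sum_subtractf A T_def in_keys_iff)
      finally show ?thesis by (simp add: Tab)
    next
      case (DTab x)
      have "Poly_Mapping.lookup g b = (\<Sum>y\<in>T. (if y = x then ?l (DTab y) / 2 else 0) + (if y = \<tau> x then ?l (DTab y) / 2 else 0))"
        unfolding g_def lookup_sum
        by (intro sum.cong refl) (auto simp: DTab lookup_add lookup_minus lookup_single when_def eqs)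
      also have "\<dots> = ?l (DTab x)"
        using finT Tt[of x] by (auto simp: sum.distrib B T_def in_keys_iff)
      finally show ?thesis by (simp add: DTab)
    qed
  qed
  ultimately show ?thesis by simp
qed

lemma Psi_lin_ext:
  assumes lin: "\<And>(S :: symb set) l g y. finite S \<Longrightarrow> Op (\<lambda>y. \<Sum>b\<in>S. fls_const (l b) * g b y) y = (\<Sum>b\<in>S. fls_const (l b) * Op (g b) y)"
    and basis: "\<And>z y. order_ge 1 (Psi (sing_E_symb n k i j a vb r s (Tab z)) y - Op (Tvec z) y)"
      "\<And>z y. order_ge 1 (Psi (sing_E_symb n k i j a vb r s (DTab z)) y - Op (Dvec z) y)"
  shows "order_ge 1 (Psi (lin_ext (sing_E_symb n k i j a vb r s) f) y - Op (Psi f) y)"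
proof -
  let ?E = "sing_E_symb n k i j a vb r s" and ?l = "Poly_Mapping.lookup f"
  have b: "order_ge 1 (Psi (?E b) y - Op (Psi (Poly_Mapping.single b 1)) y)" for b
    by (cases b) (simp_all only: basis Psi_tab Psi_dtab)
  have "Psi f = (\<lambda>y. \<Sum>b\<in>Poly_Mapping.keys f. fls_const (?l b) * Psi (Poly_Mapping.single b 1) y)"
    by (subst combination) (rule ext, simp only: Psi_sum Psi_scale)
  then have "Op (Psi f) y = (\<Sum>b\<in>Poly_Mapping.keys f. fls_const (?l b) * Op (Psi (Poly_Mapping.single b 1)) y)"
    using lin[of "Poly_Mapping.keys f" ?l "\<lambda>b. Psi (Poly_Mapping.single b 1)" y] by simp
  then have "Psi (lin_ext ?E f) y - Op (Psi f) y
      = (\<Sum>b\<in>Poly_Mapping.keys f. fls_const (?l b) * (Psi (?E b) y - Op (Psi (Poly_Mapping.single b 1)) y))"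
    by (simp add: lin_ext_def Psi_sum Psi_scale sum_subtractf right_diff_distrib)
  then show ?thesis by (auto intro!: order_ge_sum order_ge_mult_eq[of 0 _ 1] b)
qed

lemma ladder_linear:
  "finite S \<Longrightarrow> ladder s p (\<lambda>y. \<Sum>b\<in>S. fls_const (l b) * g b y) y = (\<Sum>b\<in>S. fls_const (l b) * ladder s p (g b) y)"
  unfolding ladder_def sum_distrib_left by (subst sum.swap) (simp add: mult_ac)

lemma ladder_diff: "ladder s p (\<lambda>y. g y - h y) y = ladder s p g y - ladder s p h y"
  by (simp add: ladder_def right_diff_distrib sum_subtractf)

lemma Psi_E:
  assumes p: "1 \<le> p" "p \<le> n - 1"
  shows "order_ge 1 (Psi (lin_ext (sing_E_symb n k i j a vb p (p+1)) f) y - ladder 1 p (Psi f) y)"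
    "order_ge 1 (Psi (lin_ext (sing_E_symb n k i j a vb (p+1) p) f) y - ladder (-1) p (Psi f) y)"
    "order_ge 1 (Psi (lin_ext (sing_E_symb n k i j a vb p p) f) y - weight p y * Psi f y)"
proof -
  show "order_ge 1 (Psi (lin_ext (sing_E_symb n k i j a vb p (p+1)) f) y - ladder 1 p (Psi f) y)"
    by (rule Psi_lin_ext[OF ladder_linear Psi_up[OF p]])
  show "order_ge 1 (Psi (lin_ext (sing_E_symb n k i j a vb (p+1) p) f) y - ladder (-1) p (Psi f) y)"
    by (rule Psi_lin_ext[OF ladder_linear Psi_down[OF p]])
  show "order_ge 1 (Psi (lin_ext (sing_E_symb n k i j a vb p p) f) y - weight p y * Psi f y)"
    by (rule Psi_lin_ext[where Op = "\<lambda>h y. weight p y * h y", OF _ Psi_diag[OF p]])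
       (simp add: sum_distrib_left mult_ac)
qed

lemma small_mult:
  assumes "h \<in> small" "\<And>z. D (\<tau> z) = flip (D z)" "\<And>z. order_ge 0 (D z)"
  shows "(\<lambda>z. D z * h z) \<in> small"
  using assms unfolding small_def by (auto intro!: lattice_mult order_ge_mult_eq[of 0 _ 1])

lemma weight_order: "order_ge 0 (weight p z)"
proof -
  have "order_ge 0 (of_nat q :: complex fls)" for q
    using order_ge_const[of 0 "of_nat q"] by (simp add: fls_of_nat)
  from this this[of 1] show ?thesis
    unfolding weight_def by (intro order_ge_diff order_ge_sum order_ge_add entry_regular) simp_all
qed

text \<open>The value of \<open>E\<^sub>r\<^sub>s\<close> on a coset in \<open>W\<close> is by assumption again a coset, and it contains the image of each
representative. Hence the set \<open>U\<close> of representatives of elements of \<open>W\<close> is stable under the operators on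
symbols, and its image \<open>V\<close> in the lattice is an invariant subspace.\<close>

lemma submodule_zero_or_all:
  assumes W: "gl_submodule n W (sing_module n k i j a vb)"
  shows "W = {coset R 0} \<or> W = coset R ` symb_space n"
proof -
  let ?M = "sing_module n k i j a vb"
  let ?E = "\<lambda>r s. lin_ext (sing_E_symb n k i j a vb r s)"
  have M: "m_carrier ?M = coset R ` symb_space n" "m_zero ?M = coset R 0"
    "m_add ?M X Y = (\<Union>f\<in>X. \<Union>g\<in>Y. coset R (f + g))" "m_scale ?M c X = (\<Union>f\<in>X. coset R (cscale c f))"
    "m_E ?M r s X = (\<Union>f\<in>X. coset R (?E r s f))" for X Y c r s
    by (simp_all add: sing_module_def Let_def)
  have Wc: "W \<subseteq> coset R ` symb_space n" and W0: "coset R 0 \<in> W"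
    and Wadd: "\<And>x y. x \<in> W \<Longrightarrow> y \<in> W \<Longrightarrow> m_add ?M x y \<in> W"
    and Wscale: "\<And>c x. x \<in> W \<Longrightarrow> m_scale ?M c x \<in> W"
    and WE: "\<And>r s x. r \<in> {1..n} \<Longrightarrow> s \<in> {1..n} \<Longrightarrow> x \<in> W \<Longrightarrow> m_E ?M r s x \<in> W"
    using W unfolding gl_submodule_def M(1,2) by blast+
  define U where "U = {f \<in> symb_space n. coset R f \<in> W}"
  have U_add: "f + g \<in> U" if "f \<in> U" "g \<in> U" for f g
    using that Wadd[of "coset R f" "coset R g"] free.subspace_add[OF subspace_symb_space]
    unfolding U_def M(3) coset_add[OF subspace_R] by auto
  have U_scale: "cscale c f \<in> U" if "f \<in> U" for c f
    using that Wscale[of "coset R f" c] free.subspace_scale[OF subspace_symb_space]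
    unfolding U_def M(4) coset_scale[OF subspace_R] by auto
  have R_U: "R \<subseteq> U"
  proof
    fix f assume f: "f \<in> R"
    then have "coset R f = coset R 0" by (simp add: coset_eq_iff[OF subspace_R])
    then show "f \<in> U" using f W0 R_symb_space by (auto simp: U_def)
  qed
  have U_E: "?E r s f \<in> U" if rs: "r \<in> {1..n}" "s \<in> {1..n}" and f: "f \<in> U" for r s f
  proof -
    have mW: "m_E ?M r s (coset R f) \<in> W" using WE rs f by (simp add: U_def)
    then obtain g where g: "g \<in> symb_space n" "m_E ?M r s (coset R f) = coset R g" using Wc by blast
    have "?E r s f \<in> m_E ?M r s (coset R f)"
      unfolding M(5) using mem_coset[OF subspace_R] by blast
    then have d: "?E r s f - g \<in> R" unfolding g(2) by (simp add: coset_def)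
    then have "coset R (?E r s f) = coset R g" by (simp add: coset_eq_iff[OF subspace_R])
    moreover have "(?E r s f - g) + g \<in> symb_space n"
      using d R_symb_space g(1) by (intro free.subspace_add[OF subspace_symb_space]) auto
    ultimately show ?thesis using mW g(2) by (simp add: U_def)
  qed
  have U_symb: "f \<in> symb_space n" if "f \<in> U" for f using that by (simp add: U_def)
  define V where "V = {h \<in> lattice. \<exists>f\<in>U. (\<lambda>y. h y - Psi f y) \<in> small}"
  have V_I: "h \<in> V" if "h \<in> lattice" "f \<in> U" "\<And>y. order_ge 1 (h y - Psi f y)" for h f
    using that lattice_diff[OF that(1) Psi_lattice[OF U_symb[OF that(2)]]]
    unfolding V_def small_def by blast
  have V_D: "\<exists>f\<in>U. (\<lambda>y. h y - Psi f y) \<in> small" "h \<in> lattice" if "h \<in> V" for h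
    using that by (auto simp: V_def)
  have so: "order_ge 1 (h y)" if "h \<in> small" for h y using that by (simp add: small_def)
  interpret V: invariant_subspace n i j k a vb V
  proof
    show "V \<subseteq> lattice" by (auto simp: V_def)
    show "small \<subseteq> V"
    proof
      fix h assume h: "h \<in> small"
      then show "h \<in> V"
        using R_U free.subspace_0[OF subspace_R] by (intro V_I[of h 0]) (auto simp: Psi_zero small_def)
    qed
    fix g h :: "shift \<Rightarrow> complex fls" and c :: complex and p :: nat and s :: int
    show "(\<lambda>z. g z + h z) \<in> V" if gh: "g \<in> V" "h \<in> V"
    proof -
      obtain f f' where f: "f \<in> U" "(\<lambda>y. g y - Psi f y) \<in> small" "f' \<in> U" "(\<lambda>y. h y - Psi f' y) \<in> small"
        using V_D(1)[OF gh(1)] V_D(1)[OF gh(2)] by blast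
      have "order_ge 1 (g y + h y - Psi (f + f') y)" for y
        using order_ge_add[OF so[OF f(2), of y] so[OF f(4), of y]] by (simp add: Psi_add algebra_simps)
      then show ?thesis using V_D(2) gh f by (intro V_I[of _ "f + f'"] lattice_add U_add)
    qed
    show "(\<lambda>z. fls_const c * h z) \<in> V" if h: "h \<in> V"
    proof -
      obtain f where f: "f \<in> U" "(\<lambda>y. h y - Psi f y) \<in> small" using V_D(1)[OF h] by blast
      have "order_ge 1 (fls_const c * (h y - Psi f y))" for y
        by (rule order_ge_mult_eq[of 0 _ 1]) (use so[OF f(2)] in auto)
      then have "order_ge 1 (fls_const c * h y - Psi (cscale c f) y)" for y
        by (simp add: Psi_scale right_diff_distrib)
      then show ?thesis using V_D(2) h f by (intro V_I[of _ "cscale c f"] lattice_scale U_scale)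
    qed
    show "ladder s p h \<in> V" if h: "h \<in> V" and p: "1 \<le> p" "p \<le> n - 1" and s: "s = 1 \<or> s = -1"
    proof -
      obtain f where f: "f \<in> U" "(\<lambda>y. h y - Psi f y) \<in> small" using V_D(1)[OF h] by blast
      define g where "g = (if s = 1 then ?E p (p+1) f else ?E (p+1) p f)"
      have "p \<in> {1..n}" "p + 1 \<in> {1..n}" using p by auto
      then have gU: "g \<in> U" using U_E f(1) by (simp add: g_def)
      have 1: "order_ge 1 (Psi g y - ladder s p (Psi f) y)" for y
        using s Psi_E(1,2)[OF p, of f y] by (auto simp: g_def)
      have 2: "order_ge 1 (ladder s p (\<lambda>y. h y - Psi f y) y)" for y
        by (rule so[OF ladder_small[OF p f(2)]])
      have "order_ge 1 (ladder s p h y - Psi g y)" for y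
        using order_ge_diff[OF 2[of y] 1[of y]] by (simp add: ladder_diff)
      then show ?thesis using V_D(2)[OF h] by (intro V_I[of _ g] ladder_lattice p gU)
    qed
    show "(\<lambda>z. weight p z * h z) \<in> V" if h: "h \<in> V" and p: "1 \<le> p" "p \<le> n - 1"
    proof -
      obtain f where f: "f \<in> U" "(\<lambda>y. h y - Psi f y) \<in> small" using V_D(1)[OF h] by blast
      have "p \<in> {1..n}" using p by auto
      then have gU: "?E p p f \<in> U" using U_E f(1) by blast
      have 2: "order_ge 1 (weight p y * (h y - Psi f y))" for y
        using so[OF small_mult[OF f(2), of "weight p"]] weight_tau weight_order by blast
      have "order_ge 1 (weight p y * h y - Psi (?E p p f) y)" for y
        using order_ge_diff[OF 2[of y] Psi_E(3)[OF p, of f y]] by (simp add: right_diff_distrib)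
      then show ?thesis using V_D(2)[OF h]
        by (intro V_I[of _ "?E p p f"] lattice_mult gU weight_tau weight_order)
    qed
  qed
  have V_single: "g \<in> U" if g: "Psi g \<in> V" "g \<in> symb_space n" for g
  proof -
    obtain f where f: "f \<in> U" "(\<lambda>y. Psi g y - Psi f y) \<in> small" using V_D(1)[OF g(1)] by blast
    have "Psi (g - f) \<in> small" using f(2) by (simp add: Psi_diff[abs_def])
    moreover have "g - f \<in> symb_space n"
      using g(2) U_symb[OF f(1)] by (rule free.subspace_diff[OF subspace_symb_space])
    ultimately have "g - f \<in> U" using Psi_small_R R_U by blast
    then have "(g - f) + f \<in> U" using f(1) by (rule U_add)
    then show ?thesis by simp
  qed
  show ?thesis
  proof (cases "V \<subseteq> small")
    case True
    have "f \<in> R" if "f \<in> U" for f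
    proof -
      have "Psi f \<in> V" using that by (intro V_I[of _ f] Psi_lattice U_symb) auto
      then show ?thesis using True Psi_small_R U_symb[OF that] by blast
    qed
    then have "X = coset R 0" if X: "X \<in> W" for X
    proof -
      obtain f where "f \<in> symb_space n" "X = coset R f" using Wc X by blast
      moreover from this have "f \<in> U" using X by (simp add: U_def)
      ultimately show ?thesis using \<open>\<And>f. f \<in> U \<Longrightarrow> f \<in> R\<close> by (simp add: coset_eq_iff[OF subspace_R])
    qed
    then show ?thesis using W0 by blast
  next
    case False
    then obtain h where h: "h \<in> V" "h \<notin> small" by blast
    have "Poly_Mapping.single b 1 \<in> U" if "b \<in> Tab ` shifts n \<union> DTab ` shifts n" for b
      using that V.W_full[OF h] single_symb_space[OF that]
      by (intro V_single) (auto simp: Psi_tab Psi_dtab)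
    then have "f \<in> U" if f: "f \<in> symb_space n" for f
    proof -
      have U0: "0 \<in> U" using R_U free.subspace_0[OF subspace_R] by blast
      have sumU: "(\<Sum>b\<in>A. F b) \<in> U" if "\<And>b. b \<in> A \<Longrightarrow> F b \<in> U" for A and F :: "symb \<Rightarrow> symb \<Rightarrow>\<^sub>0 complex"
        using that by (induction A rule: infinite_finite_induct) (auto intro: U_add U0)
      have "Poly_Mapping.keys f \<subseteq> Tab ` shifts n \<union> DTab ` shifts n" using f by (simp add: symb_space_def)
      then have "cscale (Poly_Mapping.lookup f b) (Poly_Mapping.single b 1) \<in> U" if "b \<in> Poly_Mapping.keys f" for b
        using that \<open>\<And>b. b \<in> Tab ` shifts n \<union> DTab ` shifts n \<Longrightarrow> Poly_Mapping.single b 1 \<in> U\<close> by (intro U_scale) blast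
      then show ?thesis by (subst combination) (rule sumU)
    qed
    then show ?thesis using Wc by (auto simp: U_def)
  qed
qed

lemma carrier_nonzero: "coset R ` symb_space n \<noteq> {coset R 0}"
proof
  let ?z = "\<lambda>_ _. 0 :: int"
  assume eq: "coset R ` symb_space n = {coset R 0}"
  have "tab ?z \<in> symb_space n" by (rule single_symb_space) (auto simp: shifts_def)
  then have "coset R (tab ?z) = coset R 0" using eq by blast
  then have "tab ?z \<in> R" by (simp add: coset_eq_iff[OF subspace_R])
  then have "Psi (tab ?z) ?z = 0" by (rule Psi_R)
  then have "Psi (tab ?z) ?z $$ 0 = 0" by simp
  moreover have "\<tau> ?z = ?z" by (simp add: tau_eq_iff)
  ultimately show False by (simp add: Psi_tab Tvec_def)
qed

end

theorem theorem6p4: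
  fixes n i j k :: nat and a :: "nat \<Rightarrow> complex" and vb :: "nat \<Rightarrow> nat \<Rightarrow> complex"
  assumes "1 \<le> i" and "i < j" and "j \<le> k" and "k \<le> n - 1"
    and "vb k i = vb k j"
    and "\<And>r s u. \<lbrakk>1 \<le> s; s < u; u \<le> r; r \<le> n - 1; (r, s, u) \<noteq> (k, i, j)\<rbrakk>
           \<Longrightarrow> vb r s - vb r u \<notin> \<int>"
    and "\<And>r s t. \<lbrakk>1 \<le> t; t < r; r \<le> n; 1 \<le> s; s \<le> r\<rbrakk>
           \<Longrightarrow> ext n a vb r s - ext n a vb (r - 1) t \<notin> \<int>"
  shows "gl_irreducible n (sing_module n k i j a vb)"
proof -
  interpret singular_tableau n i j k a vb
    by unfold_locales (fact assms)+
  show ?thesis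
    unfolding gl_irreducible_def
    using submodule_zero_or_all carrier_nonzero by (auto simp: sing_module_def Let_def)
qed

end
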